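(* Let $w$ be an infinite pin word. Then the centred pin class $\mathcal{C}^{\circ}_{w}$ and the uncentred pin class $\mathcal{C}_{w}$ each have a proper growth rate, and both of these growth rates are equal to the growth rate of the $\boxplus$-interior $\mathcal{C}^{\boxplus}_{w}$.
   Context: **Centred permutations.** A centred permutation of length $n$ is a permutation of length $n+1$ with one entry designated as the origin (the origin does not count towards the length). Equivalently it is a finite set of points in the plane, no two sharing an $x$- or $y$-coordinate, one designated as origin, considered up to order-isomorphism in each coordinate. The origin splits the plane into quadrants $1,2,3,4$, numbered anticlockwise from the top right. $\pi^\circ\le\sigma^\circ$ means $\pi^\circ$ embeds order-isomorphically (as a permutation pattern) in $\sigma^\circ$ with origin mapped to origin. A centred permutation class is a non-empty set of centred permutations closed downwards under $\le$. The underlying permutation is obtained by deleting the origin; the underlying class of a centred class is the set of underlying permutations of its members (a permutation class, i.e. closed under pattern containment). **Growth rates.** For a (centred) class with $C_n$ members of length $n$, the upper and lower growth rates are $\limsup_n \sqrt[n]{C_n}$ and $\liminf_n\sqrt[n]{C_n}$. If they are finite and equal, the class has a (proper) growth rate, the common value. **Box sum.** $\pi^\circ\boxplus\sigma^\circ$ is obtained by inflating the origin of $\sigma^\circ$ by a copy of $\pi^\circ$ (whose origin becomes the new origin). A non-empty centred permutation is $\boxplus$-indecomposable if it is not a $\boxplus$-sum of two shorter ones. A centred class is $\boxplus$-closed if it is closed under $\boxplus$. The $\boxplus$-closure $\boxplus(S)$ of a set $S$ of centred permutations is the intersection of all $\boxplus$-closed centred classes containing $S$. **Pin words.** A finite pin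 word is a word whose first letter is in $\{1,2,3,4\}$, whose other letters are in $\{u,d,l,r\}$, and in which no two consecutive letters are both in $\{u,d\}$ or both in $\{l,r\}$. An infinite pin word is an infinite word all of whose finite non-empty prefixes are finite pin words. A finite pin word $w$ of length $n$ generates a centred permutation $\pi^\circ_w$ of length $n$: place an origin $p_0$; place $p_1$ in the quadrant given by the initial numeral; for $k\ge 2$ place $p_k$ beyond all of $p_0,\dots,p_{k-1}$ in the direction (up, down, left, right) given by the $k$th letter, with its other coordinate strictly separating $p_{k-1}$ from all of $p_0,\dots,p_{k-2}$. **Pin classes.** For an infinite pin word $w$, $\mathcal{C}^\circ_w$ is the set of centred permutations contained in $\pi^\circ_v$ for some finite prefix $v$ of $w$; $\mathcal{C}_w$ is its underlying permutation class. **Pin factors and $\boxplus$-interior.** For $i\le j$, $w_{i,j}$ is the subword of $w$ in positions $i,\dots,j$, with (if $i\ge2$) its first letter replaced by the numeral of the quadrant containing $p_i$; these are the pin factors of $w$. A finite pin word $\widetilde w$ is a recurrent pin factor of $w$ if for all $n\in\mathbb{N}$ there exist $j\ge i\ge n$ with $w_{i,j}=\widetilde w$. A recurrent $\boxplus$-indecomposable of $\mathcal{C}^\circ_w$ is a $\boxplus$-indecomposable $\pi^\circ_{\widetilde w}$ with $\widetilde w$ a recurrent pin factor of $w$. The $\boxplus$-interior $\mathcal{C}^\boxplus_w$ is the $\boxplus$-closure of the set of recurrent $\boxplus$-indecomposables of $\mathcal{C}^\circ_w$. *)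

theory Defs
  imports "HOL-Library.Liminf_Limsup" "HOL-Library.Extended_Real"
begin

section \<open>Permutations and centred permutations\<close>

text \<open>
  A permutation of length \<open>n\<close> is written in one-line notation, with values
  \<open>0, \<dots>, n - 1\<close>.  A centred permutation of length \<open>n\<close> is a permutation of length
  \<open>n + 1\<close> together with the (0-based) position of the entry that is the origin.
\<close>

definition perms :: "nat list set" where
  "perms = {xs. distinct xs \<and> set xs = {..<length xs}}"

type_synonym cperm = "nat list \<times> nat"

definition cperms :: "cperm set" where
  "cperms = {(xs, a). xs \<in> perms \<and> a < length xs}"

definition clength :: "cperm \<Rightarrow> nat" where
  "clength \<pi> = length (fst \<pi>) - 1"

definition embedding :: "(nat \<Rightarrow> nat) \<Rightarrow> nat list \<Rightarrow> nat list \<Rightarrow> bool" where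
  "embedding f xs ys \<longleftrightarrow>
     f ` {..<length xs} \<subseteq> {..<length ys} \<and> strict_mono_on {..<length xs} f \<and>
     (\<forall>i<length xs. \<forall>j<length xs. xs ! i < xs ! j \<longleftrightarrow> ys ! f i < ys ! f j)"

definition ccontained :: "cperm \<Rightarrow> cperm \<Rightarrow> bool" where
  "ccontained \<pi> \<sigma> \<longleftrightarrow> (\<exists>f. embedding f (fst \<pi>) (fst \<sigma>) \<and> f (snd \<pi>) = snd \<sigma>)"

definition centred_class :: "cperm set \<Rightarrow> bool" where
  "centred_class C \<longleftrightarrow> C \<noteq> {} \<and> C \<subseteq> cperms \<and>
     (\<forall>\<sigma>\<in>C. \<forall>\<pi>\<in>cperms. ccontained \<pi> \<sigma> \<longrightarrow> \<pi> \<in> C)"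

text \<open>The permutation order-isomorphic to a sequence of distinct elements.\<close>

definition standardise :: "'a::linorder list \<Rightarrow> nat list" where
  "standardise xs = map (\<lambda>x. card {y \<in> set xs. y < x}) xs"

definition underlying :: "cperm \<Rightarrow> nat list" where
  "underlying \<pi> = standardise (take (snd \<pi>) (fst \<pi>) @ drop (Suc (snd \<pi>)) (fst \<pi>))"

definition underlying_class :: "cperm set \<Rightarrow> nat list set" where
  "underlying_class C = underlying ` C"

section \<open>Growth rates\<close>

text \<open>
  The parameter \<open>len\<close> is the notion of length: \<open>clength\<close> for centred classes and
  \<open>length\<close> for uncentred ones.
\<close>

definition upper_growth_rate :: "('a \<Rightarrow> nat) \<Rightarrow> 'a set \<Rightarrow> ereal" where
  "upper_growth_rate len C = limsup (\<lambda>n. ereal (root n (real (card {\<pi> \<in> C. len \<pi> = n}))))"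

definition lower_growth_rate :: "('a \<Rightarrow> nat) \<Rightarrow> 'a set \<Rightarrow> ereal" where
  "lower_growth_rate len C = liminf (\<lambda>n. ereal (root n (real (card {\<pi> \<in> C. len \<pi> = n}))))"

definition has_growth_rate :: "('a \<Rightarrow> nat) \<Rightarrow> 'a set \<Rightarrow> real \<Rightarrow> bool" where
  "has_growth_rate len C g \<longleftrightarrow>
     upper_growth_rate len C = ereal g \<and> lower_growth_rate len C = ereal g"

section \<open>Box sums\<close>

text \<open>
  Inflating the origin of \<open>\<sigma>\<close>, of value \<open>m\<close>, by \<open>\<pi>\<close>: the \<open>k\<close> entries of \<open>\<pi>\<close> take the
  values \<open>m, \<dots>, m + k - 1\<close>, and the entries of \<open>\<sigma>\<close> above \<open>m\<close> move up by \<open>k - 1\<close>.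
\<close>

definition box_sum :: "cperm \<Rightarrow> cperm \<Rightarrow> cperm" (infixr "\<boxplus>" 65) where
  "\<pi> \<boxplus> \<sigma> =
     (let xs = fst \<pi>; a = snd \<pi>; ys = fst \<sigma>; b = snd \<sigma>; m = ys ! b;
          shift = (\<lambda>y. if y < m then y else y + (length xs - 1))
      in (map shift (take b ys) @ map (\<lambda>x. m + x) xs @ map shift (drop (Suc b) ys), b + a))"

definition box_indecomposable :: "cperm \<Rightarrow> bool" where
  "box_indecomposable \<pi> \<longleftrightarrow> \<pi> \<in> cperms \<and> clength \<pi> > 0 \<and>
     \<not> (\<exists>\<sigma>\<in>cperms. \<exists>\<tau>\<in>cperms. clength \<sigma> < clength \<pi> \<and> clength \<tau> < clength \<pi> \<and> \<pi> = \<sigma> \<boxplus> \<tau>)"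

definition box_closed :: "cperm set \<Rightarrow> bool" where
  "box_closed C \<longleftrightarrow> (\<forall>\<pi>\<in>C. \<forall>\<sigma>\<in>C. \<pi> \<boxplus> \<sigma> \<in> C)"

definition box_closure :: "cperm set \<Rightarrow> cperm set" where
  "box_closure S = \<Inter>{C. centred_class C \<and> box_closed C \<and> S \<subseteq> C}"

section \<open>Pin words\<close>

datatype quadrant = Q1 | Q2 | Q3 | Q4
datatype direction = U | D | L | R
datatype pin_letter = Numeral quadrant | Dir direction

fun vertical :: "direction \<Rightarrow> bool" where
  "vertical U = True"
| "vertical D = True"
| "vertical L = False"
| "vertical R = False"

definition pin_word :: "pin_letter list \<Rightarrow> bool" where
  "pin_word w \<longleftrightarrow> w \<noteq> [] \<and> w ! 0 \<in> range Numeral \<and>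
     (\<forall>k. 0 < k \<and> k < length w \<longrightarrow> w ! k \<in> range Dir) \<and>
     (\<forall>k d e. Suc k < length w \<and> w ! k = Dir d \<and> w ! Suc k = Dir e
        \<longrightarrow> vertical d \<noteq> vertical e)"

text \<open>
  The letter in position \<open>k \<ge> 1\<close> of an infinite word \<open>w\<close> is \<open>w (k - 1)\<close>.
\<close>

definition prefix_word :: "(nat \<Rightarrow> pin_letter) \<Rightarrow> nat \<Rightarrow> pin_letter list" where
  "prefix_word w n = map w [0..<n]"

definition infinite_pin_word :: "(nat \<Rightarrow> pin_letter) \<Rightarrow> bool" where
  "infinite_pin_word w \<longleftrightarrow> (\<forall>n>0. pin_word (prefix_word w n))"

section \<open>Pin sequences\<close>

type_synonym point = "real \<times> real"

fun in_quadrant :: "quadrant \<Rightarrow> point \<Rightarrow> point \<Rightarrow> bool" where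
  "in_quadrant Q1 c p \<longleftrightarrow> fst c < fst p \<and> snd c < snd p"
| "in_quadrant Q2 c p \<longleftrightarrow> fst p < fst c \<and> snd c < snd p"
| "in_quadrant Q3 c p \<longleftrightarrow> fst p < fst c \<and> snd p < snd c"
| "in_quadrant Q4 c p \<longleftrightarrow> fst c < fst p \<and> snd p < snd c"

fun beyond :: "direction \<Rightarrow> point \<Rightarrow> point \<Rightarrow> bool" where
  "beyond U p q \<longleftrightarrow> snd q < snd p"
| "beyond D p q \<longleftrightarrow> snd p < snd q"
| "beyond L p q \<longleftrightarrow> fst p < fst q"
| "beyond R p q \<longleftrightarrow> fst q < fst p"

definition other_coord :: "direction \<Rightarrow> point \<Rightarrow> real" where
  "other_coord d p = (if vertical d then fst p else snd p)"

definition separates :: "real \<Rightarrow> real \<Rightarrow> real set \<Rightarrow> bool" where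
  "separates c a B \<longleftrightarrow> (a < c \<and> (\<forall>b\<in>B. c < b)) \<or> (c < a \<and> (\<forall>b\<in>B. b < c))"

text \<open>\<open>p 0\<close> is the origin, and \<open>p k\<close> is the point placed by the \<open>k\<close>th letter.\<close>

definition pin_sequence :: "pin_letter list \<Rightarrow> (nat \<Rightarrow> point) \<Rightarrow> bool" where
  "pin_sequence w p \<longleftrightarrow> pin_word w \<and>
     (\<forall>q. w ! 0 = Numeral q \<longrightarrow> in_quadrant q (p 0) (p 1)) \<and>
     (\<forall>k\<in>{2..length w}. \<forall>d. w ! (k - 1) = Dir d \<longrightarrow>
        (\<forall>j<k. beyond d (p k) (p j)) \<and>
        separates (other_coord d (p k)) (other_coord d (p (k - 1)))
          ((\<lambda>j. other_coord d (p j)) ` {..k - 2}))"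

text \<open>
  The coordinates below realise a pin word: \<open>p k\<close> has an extreme coordinate \<open>\<plusminus> 2 k\<close> in its
  direction and \<open>\<plusminus> (2 k - 3)\<close> in the other one, on the same side as \<open>p (k - 1)\<close>.
\<close>

fun explicit_pins :: "pin_letter list \<Rightarrow> nat \<Rightarrow> point" where
  "explicit_pins w 0 = (0, 0)"
| "explicit_pins w (Suc 0) =
     (case w ! 0 of Numeral Q1 \<Rightarrow> (2, 2) | Numeral Q2 \<Rightarrow> (- 2, 2) | Numeral Q3 \<Rightarrow> (- 2, - 2)
      | _ \<Rightarrow> (2, - 2))"
| "explicit_pins w (Suc (Suc k)) =
     (let q = explicit_pins w (Suc k); c = 2 * real k + 1; e = 2 * real k + 4
      in case w ! Suc k of
           Dir U \<Rightarrow> (sgn (fst q) * c, e)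
         | Dir D \<Rightarrow> (sgn (fst q) * c, - e)
         | Dir L \<Rightarrow> (- e, sgn (snd q) * c)
         | Dir R \<Rightarrow> (e, sgn (snd q) * c)
         | _ \<Rightarrow> (0, 0))"

lemma explicit_pins_bound:
  "\<bar>fst (explicit_pins w k)\<bar> \<le> 2 * real k \<and> \<bar>snd (explicit_pins w k)\<bar> \<le> 2 * real k"
proof (induction w k rule: explicit_pins.induct)
  case (3 w k)
  show ?case
    by (auto simp: Let_def abs_mult abs_sgn_eq split: pin_letter.split direction.split)
qed (auto split: pin_letter.split quadrant.split)

lemma explicit_pins_extreme:
  assumes "pin_word w" "0 < k" "k < length w" "w ! k = Dir d"
  shows "\<bar>other_coord d (explicit_pins w k)\<bar> = 2 * real k"
proof (cases "k = 1")
  case True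
  then show ?thesis
    by (auto simp: other_coord_def split: pin_letter.split quadrant.split)
next
  case False
  then obtain m where m: "k = Suc (Suc m)"
    using assms(2) by (metis One_nat_def gr0_implies_Suc not_gr0)
  obtain e where e: "w ! Suc m = Dir e"
    using assms(1,3) m unfolding pin_word_def by (metis Suc_lessD imageE zero_less_Suc)
  have "vertical e \<noteq> vertical d"
    using assms(1,3,4) m e unfolding pin_word_def by blast
  then show ?thesis
    using m e by (cases d; cases e) (auto simp: other_coord_def Let_def)
qed

lemma pin_sequence_exists:
  assumes "pin_word w"
  shows "\<exists>p. pin_sequence w p"
proof
  let ?p = "explicit_pins w"
  have "(\<forall>j<k. beyond d (?p k) (?p j)) \<and>
        separates (other_coord d (?p k)) (other_coord d (?p (k - 1)))
          ((\<lambda>j. other_coord d (?p j)) ` {..k - 2})"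
    if k: "k \<in> {2..length w}" and d: "w ! (k - 1) = Dir d" for k d
  proof -
    obtain m where m: "k = Suc (Suc m)"
      using k by (metis Suc_le_D atLeastAtMost_iff numeral_2_eq_2 Suc_le_mono)
    have wd: "w ! Suc m = Dir d"
      using d m by simp
    have b: "\<bar>fst (?p j)\<bar> \<le> 2 * real m + 2 \<and> \<bar>snd (?p j)\<bar> \<le> 2 * real m + 2" if "j < k" for j
      using explicit_pins_bound[of w j] that m by auto
    have b': "\<bar>fst (?p j)\<bar> \<le> 2 * real m \<and> \<bar>snd (?p j)\<bar> \<le> 2 * real m" if "j \<le> m" for j
      using explicit_pins_bound[of w j] that by auto
    have ext: "\<bar>other_coord d (?p (Suc m))\<bar> = 2 * real m + 2"
      using explicit_pins_extreme[OF assms _ _ wd] k m by auto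
    have 1: "beyond d (?p k) (?p j)" if "j < k" for j
      using b[OF that] wd m by (cases d) (auto simp: Let_def abs_le_iff)
    have oc: "other_coord d (?p k) = sgn (other_coord d (?p (Suc m))) * (2 * real m + 1)"
      using wd m by (cases d) (auto simp: Let_def other_coord_def)
    have ob: "\<bar>other_coord d (?p j)\<bar> \<le> 2 * real m" if "j \<le> m" for j
      using b'[OF that] by (auto simp: other_coord_def)
    have 2: "separates (other_coord d (?p k)) (other_coord d (?p (k - 1)))
          ((\<lambda>j. other_coord d (?p j)) ` {..k - 2})"
    proof (cases "other_coord d (?p (Suc m)) > 0")
      case True
      moreover have "other_coord d (?p j) < 2 * real m + 1" if "j \<le> m" for j
        using ob[OF that] by linarith
      ultimately show ?thesis
        unfolding separates_def oc using ext m by auto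
    next
      case False
      with ext have "other_coord d (?p (Suc m)) < 0"
        by linarith
      moreover have "- (2 * real m + 1) < other_coord d (?p j)" if "j \<le> m" for j
        using ob[OF that] by linarith
      ultimately show ?thesis
        unfolding separates_def oc using ext m by auto
    qed
    show ?thesis
      using 1 2 by blast
  qed
  moreover have "in_quadrant q (?p 0) (?p 1)" if "w ! 0 = Numeral q" for q
    using that by (cases q) auto
  ultimately show "pin_sequence w ?p"
    using assms unfolding pin_sequence_def by blast
qed

definition same_order :: "nat \<Rightarrow> (nat \<Rightarrow> real) \<Rightarrow> (nat \<Rightarrow> real) \<Rightarrow> bool" where
  "same_order k f g \<longleftrightarrow>
     (\<forall>i\<le>k. \<forall>j\<le>k. (f i < f j \<longleftrightarrow> g i < g j) \<and> (i \<noteq> j \<longrightarrow> f i \<noteq> f j))"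

lemma same_order_Suc:
  assumes "same_order k f g"
    and "\<And>j. j \<le> k \<Longrightarrow> f j \<noteq> f (Suc k) \<and> g j \<noteq> g (Suc k) \<and> (f j < f (Suc k) \<longleftrightarrow> g j < g (Suc k))"
  shows "same_order (Suc k) f g"
  unfolding same_order_def
proof (intro allI impI)
  fix i j assume ij: "i \<le> Suc k" "j \<le> Suc k"
  consider "i \<le> k" "j \<le> k" | "i = Suc k" "j \<le> k" | "i \<le> k" "j = Suc k" | "i = Suc k" "j = Suc k"
    using ij by linarith
  then show "(f i < f j \<longleftrightarrow> g i < g j) \<and> (i \<noteq> j \<longrightarrow> f i \<noteq> f j)"
  proof cases
    case 1
    then show ?thesis using assms(1) unfolding same_order_def by blast
  next
    case 2
    then show ?thesis using assms(2)[of j] by (metis linorder_neqE_linordered_idom order_less_asym)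
  next
    case 3
    then show ?thesis using assms(2)[of i] by metis
  next
    case 4
    then show ?thesis by simp
  qed
qed

lemma same_order_separates:
  assumes so: "same_order (Suc m) f g"
    and f: "separates (f (Suc (Suc m))) (f (Suc m)) (f ` {..m})"
    and g: "separates (g (Suc (Suc m))) (g (Suc m)) (g ` {..m})"
  shows "same_order (Suc (Suc m)) f g"
proof (rule same_order_Suc[OF so])
  fix j assume j: "j \<le> Suc m"
  have iff: "f (Suc m) < f i \<longleftrightarrow> g (Suc m) < g i" if "i \<le> m" for i
    using so that unfolding same_order_def by auto
  have f': "f (Suc m) < f (Suc (Suc m)) \<and> (\<forall>i\<le>m. f (Suc (Suc m)) < f i) \<or>
            f (Suc (Suc m)) < f (Suc m) \<and> (\<forall>i\<le>m. f i < f (Suc (Suc m)))"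
    using f unfolding separates_def by auto
  have g': "g (Suc m) < g (Suc (Suc m)) \<and> (\<forall>i\<le>m. g (Suc (Suc m)) < g i) \<or>
            g (Suc (Suc m)) < g (Suc m) \<and> (\<forall>i\<le>m. g i < g (Suc (Suc m)))"
    using g unfolding separates_def by auto
  have "j = Suc m \<or> j \<le> m" using j by linarith
  then show "f j \<noteq> f (Suc (Suc m)) \<and> g j \<noteq> g (Suc (Suc m)) \<and>
             (f j < f (Suc (Suc m)) \<longleftrightarrow> g j < g (Suc (Suc m)))"
    using f' g' iff[of 0] iff[of j] by (smt (verit) le0)
qed

lemma pin_sequence_unique:
  assumes p: "pin_sequence w p" and q: "pin_sequence w q"
  shows "same_order (length w) (\<lambda>i. fst (p i)) (\<lambda>i. fst (q i)) \<and>
         same_order (length w) (\<lambda>i. snd (p i)) (\<lambda>i. snd (q i))"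
proof -
  have pw: "pin_word w"
    using p unfolding pin_sequence_def by blast
  have "same_order k (\<lambda>i. fst (p i)) (\<lambda>i. fst (q i)) \<and>
        same_order k (\<lambda>i. snd (p i)) (\<lambda>i. snd (q i))" if "k \<le> length w" for k
    using that
  proof (induction k rule: induct_nat_012)
    case 0
    then show ?case by (simp add: same_order_def)
  next
    case 1
    obtain a where a: "w ! 0 = Numeral a"
      using pw unfolding pin_word_def by blast
    then have "in_quadrant a (p 0) (p 1)" "in_quadrant a (q 0) (q 1)"
      using p q unfolding pin_sequence_def by blast+
    then show ?case
      by (cases a) (auto simp: same_order_def le_Suc_eq)
  next
    case (ge2 m)
    then have IH: "same_order (Suc m) (\<lambda>i. fst (p i)) (\<lambda>i. fst (q i))"
      "same_order (Suc m) (\<lambda>i. snd (p i)) (\<lambda>i. snd (q i))"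
      and m: "Suc (Suc m) \<in> {2..length w}"
      by auto
    obtain d where d: "w ! (Suc (Suc m) - 1) = Dir d"
      using pw m unfolding pin_word_def
      by (metis Suc_le_eq atLeastAtMost_iff diff_Suc_1 imageE zero_less_Suc)
    have step: "(\<forall>j<Suc (Suc m). beyond d (r (Suc (Suc m))) (r j)) \<and>
      separates (other_coord d (r (Suc (Suc m)))) (other_coord d (r (Suc m)))
         ((\<lambda>j. other_coord d (r j)) ` {..m})" if r: "pin_sequence w r" for r
    proof -
      have "\<forall>k\<in>{2..length w}. \<forall>d. w ! (k - 1) = Dir d \<longrightarrow>
        (\<forall>j<k. beyond d (r k) (r j)) \<and>
        separates (other_coord d (r k)) (other_coord d (r (k - 1)))
          ((\<lambda>j. other_coord d (r j)) ` {..k - 2})"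
        using r unfolding pin_sequence_def by blast
      from this[rule_format, OF m d] show ?thesis by simp
    qed
    have P: "\<forall>j<Suc (Suc m). beyond d (p (Suc (Suc m))) (p j)"
      "separates (other_coord d (p (Suc (Suc m)))) (other_coord d (p (Suc m)))
         ((\<lambda>j. other_coord d (p j)) ` {..m})"
      using step[OF p] by blast+
    have Q: "\<forall>j<Suc (Suc m). beyond d (q (Suc (Suc m))) (q j)"
      "separates (other_coord d (q (Suc (Suc m)))) (other_coord d (q (Suc m)))
         ((\<lambda>j. other_coord d (q j)) ` {..m})"
      using step[OF q] by blast+
    show ?case
    proof (cases "vertical d")
      case True
      have "same_order (Suc (Suc m)) (\<lambda>i. fst (p i)) (\<lambda>i. fst (q i))"
        using same_order_separates[OF IH(1)] P(2) Q(2) True by (simp add: other_coord_def)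
      moreover have "same_order (Suc (Suc m)) (\<lambda>i. snd (p i)) (\<lambda>i. snd (q i))"
      proof (rule same_order_Suc[OF IH(2)])
        fix j assume "j \<le> Suc m"
        then have "beyond d (p (Suc (Suc m))) (p j)" "beyond d (q (Suc (Suc m))) (q j)"
          using P(1) Q(1) by auto
        then show "snd (p j) \<noteq> snd (p (Suc (Suc m))) \<and> snd (q j) \<noteq> snd (q (Suc (Suc m))) \<and>
          (snd (p j) < snd (p (Suc (Suc m))) \<longleftrightarrow> snd (q j) < snd (q (Suc (Suc m))))"
          using True by (cases d) auto
      qed
      ultimately show ?thesis by blast
    next
      case False
      have "same_order (Suc (Suc m)) (\<lambda>i. snd (p i)) (\<lambda>i. snd (q i))"
        using same_order_separates[OF IH(2)] P(2) Q(2) False by (simp add: other_coord_def)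
      moreover have "same_order (Suc (Suc m)) (\<lambda>i. fst (p i)) (\<lambda>i. fst (q i))"
      proof (rule same_order_Suc[OF IH(1)])
        fix j assume "j \<le> Suc m"
        then have "beyond d (p (Suc (Suc m))) (p j)" "beyond d (q (Suc (Suc m))) (q j)"
          using P(1) Q(1) by auto
        then show "fst (p j) \<noteq> fst (p (Suc (Suc m))) \<and> fst (q j) \<noteq> fst (q (Suc (Suc m))) \<and>
          (fst (p j) < fst (p (Suc (Suc m))) \<longleftrightarrow> fst (q j) < fst (q (Suc (Suc m))))"
          using False by (cases d) auto
      qed
      ultimately show ?thesis by blast
    qed
  qed
  then show ?thesis by blast
qed

text \<open>
  Pin sequences of \<open>w\<close> exist and any two of them have the same order type in each
  coordinate (lemmas \<open>pin_sequence_exists\<close> and \<open>pin_sequence_unique\<close>), so an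
  arbitrary one may be chosen.
\<close>

definition pin_points :: "pin_letter list \<Rightarrow> nat \<Rightarrow> point" where
  "pin_points w = (SOME p. pin_sequence w p)"

text \<open>The centred permutation of a finite list of points in general position, with origin \<open>c\<close>.\<close>

definition cperm_of_points :: "point \<Rightarrow> point list \<Rightarrow> cperm" where
  "cperm_of_points c ps =
     (standardise (map snd (sort_key fst ps)), card {q \<in> set ps. fst q < fst c})"

definition pin_cperm :: "pin_letter list \<Rightarrow> cperm" where
  "pin_cperm w = cperm_of_points (pin_points w 0) (map (pin_points w) [0..<Suc (length w)])"

section \<open>Pin classes and the box-interior\<close>

definition centred_pin_class :: "(nat \<Rightarrow> pin_letter) \<Rightarrow> cperm set" where
  "centred_pin_class w = {\<pi> \<in> cperms. \<exists>n>0. ccontained \<pi> (pin_cperm (prefix_word w n))}"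

definition pin_class :: "(nat \<Rightarrow> pin_letter) \<Rightarrow> nat list set" where
  "pin_class w = underlying_class (centred_pin_class w)"

definition pin_quadrant :: "(nat \<Rightarrow> pin_letter) \<Rightarrow> nat \<Rightarrow> quadrant" where
  "pin_quadrant w i =
     (let p = pin_points (prefix_word w i) in THE q. in_quadrant q (p 0) (p i))"

text \<open>\<open>pin_factor w i j\<close> is the pin factor of \<open>w\<close> in positions \<open>i, \<dots>, j\<close>, for \<open>1 \<le> i \<le> j\<close>, with positions counted from 1.\<close>

definition pin_factor :: "(nat \<Rightarrow> pin_letter) \<Rightarrow> nat \<Rightarrow> nat \<Rightarrow> pin_letter list" where
  "pin_factor w i j =
     (if i \<ge> 2 then Numeral (pin_quadrant w i) # map w [i..<j] else map w [i - 1..<j])"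

definition recurrent_pin_factor :: "(nat \<Rightarrow> pin_letter) \<Rightarrow> pin_letter list \<Rightarrow> bool" where
  "recurrent_pin_factor w v \<longleftrightarrow> pin_word v \<and>
     (\<forall>n. \<exists>i j. n \<le> i \<and> 1 \<le> i \<and> i \<le> j \<and> pin_factor w i j = v)"

definition recurrent_box_indecomposables :: "(nat \<Rightarrow> pin_letter) \<Rightarrow> cperm set" where
  "recurrent_box_indecomposables w =
     {pin_cperm v | v. recurrent_pin_factor w v \<and> box_indecomposable (pin_cperm v)}"

definition box_interior :: "(nat \<Rightarrow> pin_letter) \<Rightarrow> cperm set" where
  "box_interior w = box_closure (recurrent_box_indecomposables w)"

end

theory Submission imports Defs begin

text \<open>
  Every member of the centred pin class is given by a finite set \<open>A\<close> of indices of the pin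
  sequence. A point \<open>p\<^sub>j\<close> cuts the rectangle spanned by the origin and \<open>p\<^sub>i\<close> only if \<open>j = i + 1\<close> (for
  \<open>j > i\<close>), so the maximal runs of consecutive indices in \<open>A\<close> are the summands of a box sum of pin
  factors.

  In the box-interior the map \<open>(\<sigma>, \<tau>) \<mapsto> \<sigma> \<boxplus> \<tau>\<close> is at most \<open>(n + 1)\<close>-to-one when \<open>\<sigma>\<close> has length \<open>n\<close>, since
  only the position of the origin of \<open>\<sigma>\<close> is missing; a variant of Fekete's lemma then gives a growth
  rate \<open>g\<close>. The interior lies in the centred class, which in turn differs from the uncentred class by
  a factor of at most \<open>(n + 1)\<^sup>2\<close> in each length.

  For the upper bound, fix \<open>l\<close>. Beyond some index all pin factors of length at most \<open>l\<close> are
  recurrent, so box sums of short runs lie in the interior. A run longer than \<open>l\<close> is chopped into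
  words of length \<open>l\<close>; as a word is determined by its centred permutation and its last letter, each
  piece costs only a constant factor over the interior. Splitting at the first long run yields a
  renewal inequality whose kernel is small for large \<open>l\<close>, and every \<open>x > g\<close> bounds the growth.
\<close>

section \<open>Permutations as lists\<close>

text \<open>The obstacle is that the centred class may contain arbitrarily long pin factors that
  never recur, and these cannot be compared with the interior directly. Recurrence is available only
  for a fixed length \<open>l\<close>, beyond an index \<open>N\<close> that depends on
  \<open>l\<close>. Words, unlike permutations, can be cut anywhere, so a long run is cut into
  blocks of length \<open>l\<close>, each again a pin factor starting at or beyond \<open>N\<close>.
  A full block costs a factor 64: 8 for its last letter, without which the permutation does not
  determine the word, and 8 for the letter that the next block replaces by a numeral. Spread over
  \<open>l\<close> letters, this constant becomes a factor close to 1 per letter. Rates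
  \<open>g < y < z < x\<close> leave the room: \<open>y\<close> bounds the interior,
  \<open>z\<close> also absorbs the blocks, and \<open>x\<close> absorbs the long runs, whose
  lengths exceed \<open>l\<close> and so contribute only a geometric tail in \<open>z / x\<close>.
  Choices among the finitely many indices below \<open>N\<close> cost a constant.\<close>

lemma permsD:
  assumes "xs \<in> perms"
  shows "distinct xs" "set xs = {..<length xs}"
  using assms unfolding perms_def by blast+

lemma cpermsD:
  assumes "\<pi> \<in> cperms"
  shows "fst \<pi> \<in> perms" "snd \<pi> < length (fst \<pi>)"
  using assms by (auto simp: cperms_def)

text \<open>Each value is its own rank, so a permutation can be recovered from comparisons alone;
  \<open>perms_eqI\<close> rests on this.\<close>

lemma perm_nth_eq_card:
  assumes "xs \<in> perms" "i < length xs"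
  shows "xs ! i = card {j. j < length xs \<and> xs ! j < xs ! i}"
proof -
  have d: "distinct xs" and s: "set xs = {..<length xs}"
    using permsD[OF assms(1)] by simp_all
  have "xs ! i < length xs"
    using s assms(2) nth_mem by blast
  then have "(!) xs ` {j. j < length xs \<and> xs ! j < xs ! i} = {..<xs ! i}"
  proof (intro equalityI subsetI)
    fix y assume "y \<in> {..<xs ! i}"
    then have "y \<in> set xs" using s \<open>xs ! i < length xs\<close> by simp
    then show "y \<in> (!) xs ` {j. j < length xs \<and> xs ! j < xs ! i}"
      using \<open>y \<in> {..<xs ! i}\<close> by (auto simp: in_set_conv_nth)
  qed auto
  moreover have "inj_on ((!) xs) {j. j < length xs \<and> xs ! j < xs ! i}"
    using d by (auto simp: inj_on_def nth_eq_iff_index_eq)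
  ultimately show ?thesis
    by (metis card_image card_lessThan)
qed

lemma perms_eqI:
  assumes "xs \<in> perms" "ys \<in> perms" "length xs = length ys"
    and "\<And>i j. i < length xs \<Longrightarrow> j < length xs \<Longrightarrow> xs ! i < xs ! j \<longleftrightarrow> ys ! i < ys ! j"
  shows "xs = ys"
proof (rule nth_equalityI[OF assms(3)])
  fix i assume i: "i < length xs"
  then have "{j. j < length xs \<and> xs ! j < xs ! i} = {j. j < length ys \<and> ys ! j < ys ! i}"
    using assms(3,4) by auto
  then show "xs ! i = ys ! i"
    using perm_nth_eq_card[OF assms(1) i] perm_nth_eq_card[OF assms(2), of i] i assms(3) by simp
qed

lemma strict_mono_bij_lessThan_id:
  fixes h :: "nat \<Rightarrow> nat"
  assumes "bij_betw h {..<n} {..<n}" "strict_mono_on {..<n} h" "i < n"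
  shows "h i = i"
proof -
  have "h ` {..<i} = {..<h i}"
  proof
    show "h ` {..<i} \<subseteq> {..<h i}"
      using assms(2,3) by (auto simp: strict_mono_on_def)
    show "{..<h i} \<subseteq> h ` {..<i}"
    proof
      fix y assume y: "y \<in> {..<h i}"
      have "h i < n"
        using assms(1,3) bij_betwE by blast
      then obtain x where x: "x < n" "h x = y"
        using y assms(1) by (metis (no_types, lifting) bij_betw_imp_surj_on image_iff lessThan_iff order_less_trans)
      have "x < i"
      proof (rule ccontr)
        assume "\<not> x < i"
        then have "i = x \<or> i < x" by linarith
        then have "h i \<le> h x"
          using strict_mono_onD[OF assms(2), of i x] x assms(3) by auto
        then show False using x y by simp
      qed
      then show "y \<in> h ` {..<i}" using x by blast
    qed
  qed
  moreover have "inj_on h {..<i}"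
    using assms(1,3) by (meson bij_betw_def inj_on_subset lessThan_subset_iff less_imp_le)
  ultimately show ?thesis
    by (metis card_image card_lessThan)
qed

lemma finite_cperms_clength: "finite {\<pi> \<in> cperms. clength \<pi> = n}"
proof (rule finite_subset)
  show "{\<pi> \<in> cperms. clength \<pi> = n} \<subseteq>
      {xs. set xs \<subseteq> {..<Suc n} \<and> length xs = Suc n} \<times> {..<Suc n}"
  proof
    fix \<pi> assume "\<pi> \<in> {\<pi> \<in> cperms. clength \<pi> = n}"
    then have *: "set (fst \<pi>) = {..<length (fst \<pi>)}" "snd \<pi> < length (fst \<pi>)" "length (fst \<pi>) - 1 = n"
      using permsD(2) by (auto simp: cperms_def clength_def)
    then have "length (fst \<pi>) = Suc n" by linarith
    with * show "\<pi> \<in> {xs. set xs \<subseteq> {..<Suc n} \<and> length xs = Suc n} \<times> {..<Suc n}"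
      by (simp add: mem_Times_iff)
  qed
  show "finite ({xs. set xs \<subseteq> {..<Suc n} \<and> length xs = Suc n} \<times> {..<Suc n})"
    by (intro finite_cartesian_product finite_lists_length_eq) auto
qed

section \<open>Centred permutations represented by points\<close>

text \<open>The map \<open>f\<close> sends the positions of \<open>\<pi>\<close> to the indices of the points, index \<open>0\<close> being the origin.\<close>

definition represents :: "(nat \<Rightarrow> nat) \<Rightarrow> cperm \<Rightarrow> (nat \<Rightarrow> point) \<Rightarrow> nat set \<Rightarrow> bool" where
  "represents f \<pi> P A \<longleftrightarrow> \<pi> \<in> cperms \<and> bij_betw f {..<length (fst \<pi>)} (insert 0 A) \<and> f (snd \<pi>) = 0 \<and>
     (\<forall>i<length (fst \<pi>). \<forall>j<length (fst \<pi>).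
        (i < j \<longleftrightarrow> fst (P (f i)) < fst (P (f j))) \<and>
        (fst \<pi> ! i < fst \<pi> ! j \<longleftrightarrow> snd (P (f i)) < snd (P (f j))))"

definition general_position :: "(nat \<Rightarrow> point) \<Rightarrow> nat set \<Rightarrow> bool" where
  "general_position P A \<longleftrightarrow> inj_on (fst \<circ> P) (insert 0 A) \<and> inj_on (snd \<circ> P) (insert 0 A)"

definition order_iso :: "(nat \<Rightarrow> nat) \<Rightarrow> (nat \<Rightarrow> point) \<Rightarrow> nat set \<Rightarrow> (nat \<Rightarrow> point) \<Rightarrow> nat set \<Rightarrow> bool" where
  "order_iso \<phi> P A Q B \<longleftrightarrow> bij_betw \<phi> (insert 0 A) (insert 0 B) \<and> \<phi> 0 = 0 \<and>
     (\<forall>i\<in>insert 0 A. \<forall>j\<in>insert 0 A.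
        (fst (P i) < fst (P j) \<longleftrightarrow> fst (Q (\<phi> i)) < fst (Q (\<phi> j))) \<and>
        (snd (P i) < snd (P j) \<longleftrightarrow> snd (Q (\<phi> i)) < snd (Q (\<phi> j))))"

lemma representsD:
  assumes "represents f \<pi> P A"
  shows "i < length (fst \<pi>) \<Longrightarrow> j < length (fst \<pi>) \<Longrightarrow> i < j \<longleftrightarrow> fst (P (f i)) < fst (P (f j))"
    and "i < length (fst \<pi>) \<Longrightarrow> j < length (fst \<pi>) \<Longrightarrow>
      fst \<pi> ! i < fst \<pi> ! j \<longleftrightarrow> snd (P (f i)) < snd (P (f j))"
    and "fst \<pi> \<in> perms" and "snd \<pi> < length (fst \<pi>)" and "f (snd \<pi>) = 0"
    and "bij_betw f {..<length (fst \<pi>)} (insert 0 A)" and "\<pi> \<in> cperms"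
proof -
  have "\<pi> \<in> cperms" using assms unfolding represents_def by blast
  then show "\<pi> \<in> cperms" "fst \<pi> \<in> perms" "snd \<pi> < length (fst \<pi>)"
    using cpermsD by blast+
qed (use assms in \<open>unfold represents_def, blast+\<close>)

lemma order_isoD:
  assumes "order_iso \<phi> P A Q B" "i \<in> insert 0 A" "j \<in> insert 0 A"
  shows "fst (P i) < fst (P j) \<longleftrightarrow> fst (Q (\<phi> i)) < fst (Q (\<phi> j))"
    and "snd (P i) < snd (P j) \<longleftrightarrow> snd (Q (\<phi> i)) < snd (Q (\<phi> j))"
  using assms unfolding order_iso_def by blast+

text \<open>Going from positions of \<open>\<pi>\<close> to points, across by \<open>\<phi>\<close>,
  and back to positions of \<open>\<sigma>\<close> is an increasing bijection of initial segments of
  the naturals, hence the identity. Positions therefore agree, and with them the values and the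
  origin.\<close>

lemma represents_order_iso_eq:
  assumes f: "represents f \<pi> P A" and g: "represents g \<sigma> Q B" and \<phi>: "order_iso \<phi> P A Q B"
  shows "\<pi> = \<sigma>"
proof -
  define n where "n = length (fst \<pi>)"
  define m where "m = length (fst \<sigma>)"
  define h where "h = inv_into {..<m} g \<circ> \<phi> \<circ> f"
  have fb: "bij_betw f {..<n} (insert 0 A)" and gb: "bij_betw g {..<m} (insert 0 B)"
    and \<phi>b: "bij_betw \<phi> (insert 0 A) (insert 0 B)"
    using representsD(6)[OF f] representsD(6)[OF g] \<phi> by (auto simp: order_iso_def n_def m_def)
  have hb: "bij_betw h {..<n} {..<m}"
    unfolding h_def using bij_betw_trans[OF bij_betw_trans[OF fb \<phi>b] bij_betw_inv_into[OF gb]]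
    by (simp add: comp_assoc)
  then have nm: "n = m"
    by (metis bij_betw_same_card card_lessThan)
  have hm: "h i < m" if "i < n" for i
    using hb that bij_betwE by blast
  have gh: "g (h i) = \<phi> (f i)" if "i < n" for i
    using that fb \<phi>b gb unfolding h_def comp_def
    by (metis bij_betwE bij_betw_inv_into_right lessThan_iff)
  have fA: "f i \<in> insert 0 A" if "i < n" for i
    using fb that bij_betwE by blast
  have x: "i < j \<longleftrightarrow> h i < h j" and y: "fst \<pi> ! i < fst \<pi> ! j \<longleftrightarrow> fst \<sigma> ! h i < fst \<sigma> ! h j"
    if "i < n" "j < n" for i j
    using representsD(1,2)[OF f that[unfolded n_def]] representsD(1,2)[OF g hm[OF that(1), unfolded m_def] hm[OF that(2), unfolded m_def]]
      order_isoD[OF \<phi> fA[OF that(1)] fA[OF that(2)]] gh[OF that(1)] gh[OF that(2)] that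
    by simp_all
  have "h i = i" if "i < n" for i
    using strict_mono_bij_lessThan_id[of h n i] hb nm x that by (auto simp: strict_mono_on_def)
  moreover note fD = representsD(3-5)[OF f] and gD = representsD(3-5)[OF g]
  ultimately have "fst \<pi> = fst \<sigma>" and "g (snd \<pi>) = g (snd \<sigma>)"
    using perms_eqI[OF fD(1) gD(1)] y nm \<phi> gh[of "snd \<pi>"]
    by (auto simp: n_def m_def order_iso_def)
  then show ?thesis
    using gb fD(2) gD(2) nm[unfolded n_def m_def]
    by (auto simp: m_def bij_betw_def prod_eq_iff dest: inj_onD)
qed

lemma represents_unique:
  assumes "represents f \<pi> P A" "represents g \<sigma> P A"
  shows "\<pi> = \<sigma>"
  using represents_order_iso_eq[OF assms, of id] by (simp add: order_iso_def)

lemma represents_imp_order_iso: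
  assumes f: "represents f \<pi> P A" and g: "represents g \<pi> Q B"
  obtains \<phi> where "order_iso \<phi> P A Q B"
proof
  define n where "n = length (fst \<pi>)"
  have fb: "bij_betw f {..<n} (insert 0 A)" and gb: "bij_betw g {..<n} (insert 0 B)"
    using representsD(6)[OF f] representsD(6)[OF g] by (simp_all add: n_def)
  have a: "snd \<pi> < n" "f (snd \<pi>) = 0" "g (snd \<pi>) = 0"
    using representsD(3-5)[OF f] representsD(3-5)[OF g] by (auto simp: n_def)
  have i: "inv_into {..<n} f k < n" "f (inv_into {..<n} f k) = k" if "k \<in> insert 0 A" for k
    using fb that by (metis bij_betwE bij_betw_inv_into lessThan_iff, metis bij_betw_inv_into_right)
  show "order_iso (g \<circ> inv_into {..<n} f) P A Q B"
    unfolding order_iso_def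
  proof (intro conjI ballI)
    show "bij_betw (g \<circ> inv_into {..<n} f) (insert 0 A) (insert 0 B)"
      using bij_betw_trans[OF bij_betw_inv_into[OF fb] gb] .
    show "(g \<circ> inv_into {..<n} f) 0 = 0"
      using a fb by (metis bij_betw_inv_into_left comp_apply lessThan_iff)
  next
    fix k l assume k: "k \<in> insert 0 A" and l: "l \<in> insert 0 A"
    have *: "inv_into {..<n} f k < length (fst \<pi>)" "inv_into {..<n} f l < length (fst \<pi>)"
      using i[OF k] i[OF l] by (auto simp: n_def)
    show "(fst (P k) < fst (P l)) = (fst (Q ((g \<circ> inv_into {..<n} f) k)) < fst (Q ((g \<circ> inv_into {..<n} f) l)))"
      using representsD(1)[OF f *] representsD(1)[OF g *] i[OF k] i[OF l] by simp
    show "(snd (P k) < snd (P l)) = (snd (Q ((g \<circ> inv_into {..<n} f) k)) < snd (Q ((g \<circ> inv_into {..<n} f) l)))"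
      using representsD(2)[OF f *] representsD(2)[OF g *] i[OF k] i[OF l] by simp
  qed
qed

text \<open>Composing the embedding with \<open>f\<close> selects some of the points. Patterns thus
  turn into subsets of indices, which is what allows a whole class to be indexed by finite
  sets.\<close>

lemma represents_contained:
  assumes f: "represents f \<sigma> P A" and \<pi>: "\<pi> \<in> cperms" and c: "ccontained \<pi> \<sigma>"
  obtains g A' where "A' \<subseteq> A" "0 \<notin> A'" "represents g \<pi> P A'"
proof -
  obtain e where e: "embedding e (fst \<pi>) (fst \<sigma>)" "e (snd \<pi>) = snd \<sigma>"
    using c by (auto simp: ccontained_def)
  define n where "n = length (fst \<pi>)"
  define m where "m = length (fst \<sigma>)"
  have em: "e i < m" if "i < n" for i
    using e that by (auto simp: embedding_def n_def m_def)
  have es: "strict_mono_on {..<n} e"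
    using e by (auto simp: embedding_def n_def)
  have fb: "bij_betw f {..<m} (insert 0 A)"
    using representsD(6)[OF f] by (simp add: m_def)
  have a: "snd \<pi> < n" "f (e (snd \<pi>)) = 0"
    using \<pi> e representsD(5)[OF f] by (auto simp: cperms_def n_def)
  have "inj_on (f \<circ> e) {..<n}"
    using fb em by (intro comp_inj_on strict_mono_on_imp_inj_on[OF es])
      (auto simp: bij_betw_def intro: inj_on_subset)
  moreover have "(f \<circ> e) ` {..<n} = insert 0 ((f \<circ> e) ` {..<n} - {0})"
    using a by force
  ultimately have b: "bij_betw (f \<circ> e) {..<n} (insert 0 ((f \<circ> e) ` {..<n} - {0}))"
    by (simp add: bij_betw_def)
  have ee: "i < j \<longleftrightarrow> e i < e j" if "i < n" "j < n" for i j
    using es that unfolding strict_mono_on_def by (metis lessThan_iff linorder_neqE_nat order_less_asym)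
  have ev: "fst \<pi> ! i < fst \<pi> ! j \<longleftrightarrow> fst \<sigma> ! e i < fst \<sigma> ! e j" if "i < n" "j < n" for i j
    using e that unfolding embedding_def n_def by blast
  have "represents (f \<circ> e) \<pi> P ((f \<circ> e) ` {..<n} - {0})"
    unfolding represents_def n_def[symmetric]
  proof (intro conjI allI impI)
    fix i j assume ij: "i < n" "j < n"
    show "(i < j) = (fst (P ((f \<circ> e) i)) < fst (P ((f \<circ> e) j)))"
      using representsD(1)[OF f em[OF ij(1), unfolded m_def] em[OF ij(2), unfolded m_def]] ee[OF ij] by simp
    show "(fst \<pi> ! i < fst \<pi> ! j) = (snd (P ((f \<circ> e) i)) < snd (P ((f \<circ> e) j)))"
      using representsD(2)[OF f em[OF ij(1), unfolded m_def] em[OF ij(2), unfolded m_def]] ev[OF ij] by simp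
  qed (use \<pi> b a in auto)
  moreover have "(f \<circ> e) ` {..<n} - {0} \<subseteq> A"
    using fb em by (auto simp: bij_betw_def)
  ultimately show thesis using that by blast
qed

lemma represents_subset_contained:
  assumes f: "represents f \<sigma> P A" and g: "represents g \<pi> P A'" and "A' \<subseteq> A"
  shows "ccontained \<pi> \<sigma>"
proof -
  define n where "n = length (fst \<pi>)"
  define m where "m = length (fst \<sigma>)"
  define e where "e = inv_into {..<m} f \<circ> g"
  have fb: "bij_betw f {..<m} (insert 0 A)" and gb: "bij_betw g {..<n} (insert 0 A')"
    using representsD(6)[OF f] representsD(6)[OF g] by (simp_all add: m_def n_def)
  have e: "e i < m" "f (e i) = g i" if "i < n" for i
  proof -
    have "g i \<in> insert 0 A"
      using gb assms(3) that bij_betwE by blast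
    then show "e i < m" "f (e i) = g i"
      using fb unfolding e_def comp_def
      by (metis bij_betwE bij_betw_inv_into lessThan_iff, metis bij_betw_inv_into_right)
  qed
  have a: "snd \<pi> < n" "snd \<sigma> < m" "g (snd \<pi>) = 0" "f (snd \<sigma>) = 0"
    using representsD(3-5)[OF f] representsD(3-5)[OF g] by (auto simp: n_def m_def)
  have "e i < e j" if "i < j" "j < n" for i j
    using representsD(1)[OF g, of i j] representsD(1)[OF f, of "e i" "e j"] e[of i] e[of j] that
    by (simp add: n_def m_def)
  moreover have "fst \<pi> ! i < fst \<pi> ! j \<longleftrightarrow> fst \<sigma> ! e i < fst \<sigma> ! e j" if "i < n" "j < n" for i j
    using representsD(2)[OF g, of i j] representsD(2)[OF f, of "e i" "e j"] e[of i] e[of j] that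
    by (simp add: n_def m_def)
  ultimately have "embedding e (fst \<pi>) (fst \<sigma>)"
    using e unfolding embedding_def n_def[symmetric] m_def[symmetric]
    by (auto simp: strict_mono_on_def)
  moreover have "e (snd \<pi>) = snd \<sigma>"
    using e[OF a(1)] a fb by (metis bij_betw_inv_into_left lessThan_iff)
  ultimately show ?thesis by (auto simp: ccontained_def)
qed

section \<open>Standardisation and the permutation of a list of points\<close>

lemma standardise_length [simp]: "length (standardise xs) = length xs"
  by (simp add: standardise_def)

lemma standardise_less_iff:
  fixes xs :: "'a::linorder list"
  assumes "i < length xs" "j < length xs"
  shows "standardise xs ! i < standardise xs ! j \<longleftrightarrow> xs ! i < xs ! j"
proof -
  have *: "card {y \<in> set xs. y < a} < card {y \<in> set xs. y < b}" if "a < b" "a \<in> set xs" for a b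
    using that by (intro psubset_card_mono) auto
  have "standardise xs ! i = card {y \<in> set xs. y < xs ! i}"
    "standardise xs ! j = card {y \<in> set xs. y < xs ! j}"
    using assms by (auto simp: standardise_def)
  then show ?thesis
    using *[of "xs ! i" "xs ! j"] *[of "xs ! j" "xs ! i"] assms
    by (metis linorder_cases nth_mem order_less_asym order_less_irrefl)
qed

lemma distinct_bounded_perms:
  assumes "distinct xs" "\<And>i. i < length xs \<Longrightarrow> xs ! i < length xs"
  shows "xs \<in> perms"
proof -
  have "set xs \<subseteq> {..<length xs}"
    using assms(2) by (auto simp: set_conv_nth)
  then have "set xs = {..<length xs}"
    using assms(1) by (intro card_subset_eq) (auto simp: distinct_card)
  then show ?thesis using assms(1) by (simp add: perms_def)
qed

lemma standardise_perms:
  fixes xs :: "'a::linorder list"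
  assumes "distinct xs"
  shows "standardise xs \<in> perms"
proof (rule distinct_bounded_perms)
  show "distinct (standardise xs)"
    unfolding distinct_conv_nth using assms standardise_less_iff[of _ xs]
    by (metis distinct_conv_nth linorder_neqE nat_neq_iff standardise_length)
next
  fix i assume i: "i < length (standardise xs)"
  then have "card {y \<in> set xs. y < xs ! i} < card (set xs)"
    using nth_mem[of i xs] by (intro psubset_card_mono finite_set psubsetI) (auto simp del: nth_mem)
  then show "standardise xs ! i < length (standardise xs)"
    using i assms by (simp add: standardise_def distinct_card)
qed

lemma insort_key_map: "insort_key f (g x) (map g xs) = map g (insort_key (\<lambda>a. f (g a)) x xs)"
  by (induction xs) auto

lemma sort_key_map: "sort_key f (map g xs) = map g (sort_key (f \<circ> g) xs)"
  by (induction xs) (simp_all add: insort_key_map comp_def)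

text \<open>Sorting the indices by abscissa, rather than the points, yields an explicit representing
  map: access to the sorted index list. The number of points left of the origin is then the place of
  index 0 in that list.\<close>

lemma represents_cperm_of_points:
  assumes gp: "general_position P A" and S: "set ks = insert 0 A" "distinct ks"
  obtains f where "represents f (cperm_of_points (P 0) (map P ks)) P A"
proof -
  define qs where "qs = sort_key (fst \<circ> P) ks"
  have qs: "set qs = insert 0 A" "distinct qs" "length qs = length ks"
    using S by (auto simp: qs_def)
  have sk: "sort_key fst (map P ks) = map P qs"
    unfolding qs_def by (rule sort_key_map)
  define n where "n = length qs"
  have srt: "sorted (map (fst \<circ> P) qs)" by (simp add: qs_def)
  have inj: "inj_on (fst \<circ> P) (insert 0 A)" "inj_on (snd \<circ> P) (insert 0 A)"
    using gp by (auto simp: general_position_def)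
  have x: "i < j \<longleftrightarrow> fst (P (qs ! i)) < fst (P (qs ! j))" if "i < n" "j < n" for i j
  proof -
    have *: "fst (P (qs ! i)) < fst (P (qs ! j))" if "i < j" "j < n" for i j
    proof -
      have "fst (P (qs ! i)) \<le> fst (P (qs ! j))"
        using sorted_nth_mono[OF srt, of i j] that by (simp add: n_def)
      moreover have "fst (P (qs ! i)) \<noteq> fst (P (qs ! j))"
        using inj(1) qs that nth_eq_iff_index_eq[of qs i j] nth_mem[of i qs] nth_mem[of j qs]
        unfolding n_def inj_on_def comp_def by (metis less_trans nat_neq_iff)
      ultimately show ?thesis by simp
    qed
    then show ?thesis using that by (metis linorder_neqE_nat order_less_asym order_less_irrefl)
  qed
  define zs where "zs = standardise (map snd (map P qs))"
  have "distinct (map snd (map P qs))"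
    using qs inj by (simp add: distinct_map comp_inj_on)
  then have zp: "zs \<in> perms" by (simp add: zs_def standardise_perms)
  have zl: "length zs = n" by (simp add: zs_def n_def)
  have y: "zs ! i < zs ! j \<longleftrightarrow> snd (P (qs ! i)) < snd (P (qs ! j))" if "i < n" "j < n" for i j
    using that standardise_less_iff[of i "map snd (map P qs)" j] by (simp add: zs_def n_def)
  obtain a where a: "a < n" "qs ! a = 0"
    using qs(1) by (metis in_set_conv_nth insertI1 n_def)
  have "{q \<in> set (map P ks). fst q < fst (P 0)} = (\<lambda>i. P (qs ! i)) ` {..<a}"
  proof -
    have "set (map P ks) = (\<lambda>i. P (qs ! i)) ` {..<n}"
      using qs S by (simp add: n_def nth_image image_image[symmetric] lessThan_atLeast0)
    then have "{q \<in> set (map P ks). fst q < fst (P 0)} =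
        (\<lambda>i. P (qs ! i)) ` {i. i < n \<and> fst (P (qs ! i)) < fst (P 0)}"
      by (simp only:) blast
    moreover have "{i. i < n \<and> fst (P (qs ! i)) < fst (P 0)} = {..<a}"
    proof (rule set_eqI)
      fix i show "i \<in> {i. i < n \<and> fst (P (qs ! i)) < fst (P 0)} \<longleftrightarrow> i \<in> {..<a}"
        using x[of i a] a by auto
    qed
    ultimately show ?thesis by simp
  qed
  moreover have "inj_on (\<lambda>i. P (qs ! i)) {..<a}"
  proof (rule inj_onI)
    fix i j assume "i \<in> {..<a}" "j \<in> {..<a}" "P (qs ! i) = P (qs ! j)"
    then show "i = j" using x[of i j] x[of j i] a by simp
  qed
  ultimately have ca: "card {q \<in> set (map P ks). fst q < fst (P 0)} = a"
    by (simp add: card_image)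
  have eq: "cperm_of_points (P 0) (map P ks) = (zs, a)"
    unfolding cperm_of_points_def sk ca zs_def ..
  have "bij_betw ((!) qs) {..<n} (insert 0 A)"
    using qs by (simp add: n_def bij_betw_nth)
  then have "represents ((!) qs) (zs, a) P A"
    unfolding represents_def cperms_def using a x y zp zl by simp
  then show thesis using eq that by metis
qed

section \<open>Box sums of represented permutations\<close>

definition box_shift :: "nat \<Rightarrow> nat \<Rightarrow> nat \<Rightarrow> nat" where
  "box_shift m n y = (if y < m then y else y + (n - 1))"

lemma box_sum_eq:
  "fst (\<sigma> \<boxplus> \<tau>) = map (box_shift (fst \<tau> ! snd \<tau>) (length (fst \<sigma>))) (take (snd \<tau>) (fst \<tau>)) @
     map (\<lambda>x. fst \<tau> ! snd \<tau> + x) (fst \<sigma>) @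
     map (box_shift (fst \<tau> ! snd \<tau>) (length (fst \<sigma>))) (drop (Suc (snd \<tau>)) (fst \<tau>))"
  "snd (\<sigma> \<boxplus> \<tau>) = snd \<tau> + snd \<sigma>"
  by (simp_all add: box_sum_def Let_def box_shift_def[abs_def])

text \<open>For a position \<open>k\<close> of a box sum outside the inflated block
  \<open>{b..<b + n}\<close>, this is the position in the outer summand that it comes from. The
  block of \<open>n\<close> entries replaces a single one, so later positions move back by
  \<open>n - 1\<close>.\<close>

definition box_outer :: "nat \<Rightarrow> nat \<Rightarrow> nat \<Rightarrow> nat" where
  "box_outer b n k = (if k < b then k else k - n + 1)"

lemma box_sum_length:
  assumes "\<sigma> \<in> cperms" "\<tau> \<in> cperms"
  shows "length (fst (\<sigma> \<boxplus> \<tau>)) = length (fst \<sigma>) + length (fst \<tau>) - 1"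
  using cpermsD(2)[OF assms(2)] by (simp add: box_sum_eq)

lemma clength_box_sum:
  assumes "\<sigma> \<in> cperms" "\<tau> \<in> cperms"
  shows "clength (\<sigma> \<boxplus> \<tau>) = clength \<sigma> + clength \<tau>"
  using cpermsD(2)[OF assms(1)] cpermsD(2)[OF assms(2)] box_sum_length[OF assms] by (simp add: clength_def)

lemma box_sum_nth:
  assumes "\<sigma> \<in> cperms" "\<tau> \<in> cperms" "k < length (fst (\<sigma> \<boxplus> \<tau>))"
  defines "b \<equiv> snd \<tau>" and "n \<equiv> length (fst \<sigma>)" and "m \<equiv> fst \<tau> ! snd \<tau>"
  shows "fst (\<sigma> \<boxplus> \<tau>) ! k =
    (if b \<le> k \<and> k < b + n then m + fst \<sigma> ! (k - b) else box_shift m n (fst \<tau> ! box_outer b n k))"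
  using assms(3) cpermsD(2)[OF assms(1)] cpermsD(2)[OF assms(2)]
  by (auto simp: box_sum_eq nth_append b_def n_def m_def box_outer_def min_def not_less)

text \<open>The length and the origin position of the inner summand locate the inflated block, so
  the list can be cut into its three parts. The only further unknown is the value \<open>m\<close>
  of the outer origin, and it can be read off the block.\<close>

lemma box_sum_inject:
  assumes c: "\<sigma> \<in> cperms" "\<tau> \<in> cperms" "\<sigma>' \<in> cperms" "\<tau>' \<in> cperms"
    and eq: "\<sigma> \<boxplus> \<tau> = \<sigma>' \<boxplus> \<tau>'" and l: "clength \<sigma> = clength \<sigma>'" and s: "snd \<sigma> = snd \<sigma>'"
  shows "\<sigma> = \<sigma>' \<and> \<tau> = \<tau>'"
proof -
  have n: "length (fst \<sigma>) = length (fst \<sigma>')"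
    using l cpermsD(2)[OF c(1)] cpermsD(2)[OF c(3)] by (simp add: clength_def)
  have len: "length (fst \<tau>) = length (fst \<tau>')"
    using box_sum_length[OF c(1,2)] box_sum_length[OF c(3,4)] eq n
      cpermsD(2)[OF c(2)] cpermsD(2)[OF c(4)] cpermsD(2)[OF c(1)] by simp
  have b: "snd \<tau> = snd \<tau>'"
    using box_sum_eq(2)[of \<sigma> \<tau>] box_sum_eq(2)[of \<sigma>' \<tau>'] eq s by simp
  define m where "m = fst \<tau> ! snd \<tau>"
  define m' where "m' = fst \<tau>' ! snd \<tau>'"
  define k where "k = length (fst \<sigma>)"
  have k: "k > 0" using cpermsD(2)[OF c(1)] unfolding k_def by linarith
  have "map (box_shift m k) (take (snd \<tau>) (fst \<tau>)) @ map ((+) m) (fst \<sigma>) @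
        map (box_shift m k) (drop (Suc (snd \<tau>)) (fst \<tau>)) =
      map (box_shift m' k) (take (snd \<tau>) (fst \<tau>')) @ map ((+) m') (fst \<sigma>') @
        map (box_shift m' k) (drop (Suc (snd \<tau>)) (fst \<tau>'))"
    using arg_cong[OF eq, of fst] unfolding box_sum_eq m_def m'_def k_def b n by simp
  then have e: "map (box_shift m k) (take (snd \<tau>) (fst \<tau>)) = map (box_shift m' k) (take (snd \<tau>) (fst \<tau>'))"
      "map ((+) m) (fst \<sigma>) = map ((+) m') (fst \<sigma>')"
      "map (box_shift m k) (drop (Suc (snd \<tau>)) (fst \<tau>)) = map (box_shift m' k) (drop (Suc (snd \<tau>)) (fst \<tau>'))"
    using len n by auto
  \<comment> \<open>A non-empty permutation contains the value 0, so the smallest value in the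
    shifted block is the shift itself.\<close>
  have min: "Min (set (map ((+) m) xs)) = m" if "xs \<in> perms" "0 < length xs" for m :: nat and xs
  proof (rule Min_eqI)
    have "0 \<in> set xs" unfolding permsD(2)[OF that(1)] using that(2) by simp
    then show "m \<in> set (map ((+) m) xs)" by force
  qed auto
  have mm: "m = m'"
    using min[OF cpermsD(1)[OF c(1)], of m] min[OF cpermsD(1)[OF c(3)], of m'] e(2) k n
    unfolding k_def by simp
  have \<sigma>: "fst \<sigma> = fst \<sigma>'"
    using e(2) mm by (simp add: inj_map_eq_map)
  have inj: "inj_on (box_shift m k) (- {m})"
    using k by (auto simp: inj_on_def box_shift_def split: if_splits)
  have un: "fst t = take (snd t) (fst t) @ fst t ! snd t # drop (Suc (snd t)) (fst t)"
    if "t \<in> cperms" for t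
    using cpermsD(2)[OF that] by (rule id_take_nth_drop)
  have ni: "fst t ! snd t \<notin> set (take (snd t) (fst t)) \<union> set (drop (Suc (snd t)) (fst t))"
    if "t \<in> cperms" for t
    using un[OF that] permsD(1)[OF cpermsD(1)[OF that]]
    by (metis Un_iff distinct.simps(2) distinct_append disjoint_iff list.set_intros(1))
  have "take (snd \<tau>) (fst \<tau>) = take (snd \<tau>) (fst \<tau>')"
    using ni[OF c(2)] ni[OF c(4)] mm b
    by (intro map_inj_on[OF e(1)[folded mm] inj_on_subset[OF inj]]) (auto simp: m_def m'_def)
  moreover have "drop (Suc (snd \<tau>)) (fst \<tau>) = drop (Suc (snd \<tau>)) (fst \<tau>')"
    using ni[OF c(2)] ni[OF c(4)] mm b
    by (intro map_inj_on[OF e(3)[folded mm] inj_on_subset[OF inj]]) (auto simp: m_def m'_def)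
  ultimately have "fst \<tau> = fst \<tau>'"
    using un[OF c(2)] un[OF c(4)] mm b by (simp add: m_def m'_def)
  then show ?thesis using \<sigma> s b by (simp add: prod_eq_iff)
qed

text \<open>No point of \<open>A\<^sub>2\<close> cuts the rectangle spanned by the origin and \<open>A\<^sub>1\<close>.\<close>

definition uncut :: "(nat \<Rightarrow> point) \<Rightarrow> nat set \<Rightarrow> nat set \<Rightarrow> bool" where
  "uncut P A\<^sub>1 A\<^sub>2 \<longleftrightarrow> (\<forall>i\<in>A\<^sub>1. \<forall>j\<in>A\<^sub>2.
     (fst (P j) < fst (P i) \<longleftrightarrow> fst (P j) < fst (P 0)) \<and> (snd (P j) < snd (P i) \<longleftrightarrow> snd (P j) < snd (P 0)))"

text \<open>Every point of \<open>A\<^sub>2\<close> lies on the same side of a point of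
  \<open>A\<^sub>1\<close> as of the origin. Hence the points of \<open>A\<^sub>1\<close> and the
  origin occupy consecutive positions and consecutive values, which is an inflation of the origin of
  \<open>\<tau>\<close>.\<close>

lemma represents_box_sum:
  assumes f: "represents f \<sigma> P A\<^sub>1" and g: "represents g \<tau> P A\<^sub>2"
    and gp: "general_position P (A\<^sub>1 \<union> A\<^sub>2)" and u: "uncut P A\<^sub>1 A\<^sub>2"
    and dis: "A\<^sub>1 \<inter> A\<^sub>2 = {}" "0 \<notin> A\<^sub>1" "0 \<notin> A\<^sub>2"
  obtains h where "represents h (\<sigma> \<boxplus> \<tau>) P (A\<^sub>1 \<union> A\<^sub>2)"
proof -
  define b where "b = snd \<tau>"
  define n where "n = length (fst \<sigma>)"
  define l where "l = length (fst \<tau>)"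
  define m where "m = fst \<tau> ! snd \<tau>"
  define N where "N = n + l - 1"
  define h where "h = (\<lambda>k. if b \<le> k \<and> k < b + n then f (k - b) else g (box_outer b n k))"
  define zs where "zs = fst (\<sigma> \<boxplus> \<tau>)"
  note F = representsD[OF f, folded n_def] and G = representsD[OF g, folded l_def b_def]
  have n0: "n > 0" and bl: "b < l" using F(4) G(4) by simp_all
  have zl: "length zs = N"
    using box_sum_length[OF F(7) G(7)] by (simp add: zs_def N_def n_def l_def)
  have znth: "zs ! k = (if b \<le> k \<and> k < b + n then m + fst \<sigma> ! (k - b) else box_shift m n (fst \<tau> ! box_outer b n k))"
    if "k < N" for k
    using box_sum_nth[OF F(7) G(7), of k] that zl by (simp add: zs_def b_def n_def m_def)
  have tl: "box_outer b n k < l" "box_outer b n k \<noteq> b" if "k < N" "\<not> (b \<le> k \<and> k < b + n)" for k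
    using that bl n0 by (auto simp: box_outer_def N_def)
  have fi: "f i \<in> insert 0 A\<^sub>1" if "i < n" for i
    using F(6) that bij_betwE by blast
  have gi: "g i \<in> A\<^sub>2" if "i < l" "i \<noteq> b" for i
  proof -
    have "g i \<noteq> g b" using G(6) that bl by (auto simp: bij_betw_def inj_on_def)
    moreover have "g i \<in> insert 0 A\<^sub>2" using G(6) that bij_betwE by blast
    ultimately show ?thesis using G(5) by simp
  qed
  have gval: "fst \<tau> ! i \<noteq> m" if "i < l" "i \<noteq> b" for i
    using permsD(1)[OF G(3)] that bl by (simp add: m_def l_def b_def nth_eq_iff_index_eq)
  have sv: "fst \<sigma> ! i < n" if "i < n" for i
    using permsD(2)[OF F(3)] that nth_mem[of i "fst \<sigma>"] by (auto simp: n_def)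
  \<comment> \<open>Comparisons across the two summands reduce, by \<open>uncut\<close>, to
    comparisons of the outer entry with the origin of \<open>\<tau>\<close>.\<close>
  have io: "(fst (P (g j)) < fst (P (f i)) \<longleftrightarrow> j < b)" "(fst (P (f i)) < fst (P (g j)) \<longleftrightarrow> b < j)"
      "(snd (P (g j)) < snd (P (f i)) \<longleftrightarrow> fst \<tau> ! j < m)" "(snd (P (f i)) < snd (P (g j)) \<longleftrightarrow> m < fst \<tau> ! j)"
    if "i < n" "j < l" "j \<noteq> b" for i j
  proof -
    have gj: "g j \<in> A\<^sub>2" using gi that by blast
    have fg: "f i \<noteq> g j" "g j \<noteq> 0" using gj fi[OF that(1)] dis by auto
    have in': "f i \<in> insert 0 (A\<^sub>1 \<union> A\<^sub>2)" "g j \<in> insert 0 (A\<^sub>1 \<union> A\<^sub>2)" "0 \<in> insert 0 (A\<^sub>1 \<union> A\<^sub>2)"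
      using gj fi[OF that(1)] by auto
    have inj: "inj_on (fst \<circ> P) (insert 0 (A\<^sub>1 \<union> A\<^sub>2))" "inj_on (snd \<circ> P) (insert 0 (A\<^sub>1 \<union> A\<^sub>2))"
      using gp by (simp_all add: general_position_def)
    have ne: "fst (P (g j)) \<noteq> fst (P (f i))" "snd (P (g j)) \<noteq> snd (P (f i))"
      "fst (P (g j)) \<noteq> fst (P 0)" "snd (P (g j)) \<noteq> snd (P 0)"
      using inj_onD[OF inj(1) _ in'(2,1)] inj_onD[OF inj(2) _ in'(2,1)]
        inj_onD[OF inj(1) _ in'(2,3)] inj_onD[OF inj(2) _ in'(2,3)] fg by auto
    have lt: "fst (P (g j)) < fst (P (f i)) \<longleftrightarrow> fst (P (g j)) < fst (P 0)"
      "snd (P (g j)) < snd (P (f i)) \<longleftrightarrow> snd (P (g j)) < snd (P 0)"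
      using u fi[OF that(1)] gj unfolding uncut_def by auto
    have j0: "j < b \<longleftrightarrow> fst (P (g j)) < fst (P 0)" "fst \<tau> ! j < m \<longleftrightarrow> snd (P (g j)) < snd (P 0)"
      using G(1)[OF that(2) bl] G(2)[OF that(2) bl] G(5) by (simp_all add: m_def b_def)
    show "(fst (P (g j)) < fst (P (f i)) \<longleftrightarrow> j < b)" "(fst (P (f i)) < fst (P (g j)) \<longleftrightarrow> b < j)"
      "(snd (P (g j)) < snd (P (f i)) \<longleftrightarrow> fst \<tau> ! j < m)" "(snd (P (f i)) < snd (P (g j)) \<longleftrightarrow> m < fst \<tau> ! j)"
      using ne lt j0 gval[OF that(2,3)] that(3) by linarith+
  qed
  have hI: "h k = f (k - b)" if "b \<le> k \<and> k < b + n" for k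
    using that by (simp add: h_def)
  have hO: "h k = g (box_outer b n k)" if "\<not> (b \<le> k \<and> k < b + n)" for k
    using that by (auto simp: h_def)
  have hx: "k < k' \<longleftrightarrow> fst (P (h k)) < fst (P (h k'))" if k: "k < N" "k' < N" for k k'
  proof -
    consider "b \<le> k \<and> k < b + n" "b \<le> k' \<and> k' < b + n"
      | "b \<le> k \<and> k < b + n" "\<not> (b \<le> k' \<and> k' < b + n)"
      | "\<not> (b \<le> k \<and> k < b + n)" "b \<le> k' \<and> k' < b + n"
      | "\<not> (b \<le> k \<and> k < b + n)" "\<not> (b \<le> k' \<and> k' < b + n)" by blast
    then show ?thesis
    proof cases
      case 1
      then show ?thesis using F(1)[of "k - b" "k' - b"] unfolding hI[OF 1(1)] hI[OF 1(2)] by linarith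
    next
      case 2
      then have "k < k' \<longleftrightarrow> b < box_outer b n k'" by (auto simp: box_outer_def)
      moreover have "k - b < n" using 2 by linarith
      ultimately show ?thesis using io(2)[OF _ tl[OF k(2) 2(2)]]
        unfolding hI[OF 2(1)] hO[OF 2(2)] by simp
    next
      case 3
      then have "k < k' \<longleftrightarrow> box_outer b n k < b" by (auto simp: box_outer_def)
      moreover have "k' - b < n" using 3 by linarith
      ultimately show ?thesis using io(1)[OF _ tl[OF k(1) 3(1)]]
        unfolding hI[OF 3(2)] hO[OF 3(1)] by simp
    next
      case 4
      then have "k < k' \<longleftrightarrow> box_outer b n k < box_outer b n k'" using n0 by (auto simp: box_outer_def)
      then show ?thesis using G(1)[OF tl(1)[OF k(1) 4(1)] tl(1)[OF k(2) 4(2)]]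
        unfolding hO[OF 4(1)] hO[OF 4(2)] by simp
    qed
  qed
  have hy: "zs ! k < zs ! k' \<longleftrightarrow> snd (P (h k)) < snd (P (h k'))" if k: "k < N" "k' < N" for k k'
  proof -
    have bsi: "m + s < box_shift m n y \<longleftrightarrow> m < y" if "s < n" "y \<noteq> m" for s y
      using that by (auto simp: box_shift_def)
    have bso: "box_shift m n y < m + s \<longleftrightarrow> y < m" if "s < n" "y \<noteq> m" for s y
      using that by (auto simp: box_shift_def)
    consider "b \<le> k \<and> k < b + n" "b \<le> k' \<and> k' < b + n"
      | "b \<le> k \<and> k < b + n" "\<not> (b \<le> k' \<and> k' < b + n)"
      | "\<not> (b \<le> k \<and> k < b + n)" "b \<le> k' \<and> k' < b + n"
      | "\<not> (b \<le> k \<and> k < b + n)" "\<not> (b \<le> k' \<and> k' < b + n)" by blast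
    then show ?thesis
    proof cases
      case 1
      moreover have "k - b < n" "k' - b < n" using 1 by linarith+
      ultimately show ?thesis using F(2)[of "k - b" "k' - b"] znth[OF k(1)] znth[OF k(2)]
        unfolding hI[OF 1(1)] hI[OF 1(2)] by simp
    next
      case 2
      then have *: "k - b < n" by linarith
      note t = tl[OF k(2) 2(2)]
      show ?thesis using 2 io(4)[OF * t] bsi[OF sv[OF *] gval[OF t]]
        unfolding hI[OF 2(1)] hO[OF 2(2)] znth[OF k(1)] znth[OF k(2)] if_P[OF 2(1)] if_not_P[OF 2(2)] by simp
    next
      case 3
      then have *: "k' - b < n" by linarith
      note t = tl[OF k(1) 3(1)]
      show ?thesis using 3 io(3)[OF * t] bso[OF sv[OF *] gval[OF t]]
        unfolding hI[OF 3(2)] hO[OF 3(1)] znth[OF k(1)] znth[OF k(2)] if_P[OF 3(2)] if_not_P[OF 3(1)] by simp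
    next
      case 4
      have "box_shift m n y < box_shift m n y' \<longleftrightarrow> y < y'" if "y \<noteq> m" "y' \<noteq> m" for y y'
        using that by (auto simp: box_shift_def)
      then show ?thesis
        using 4 G(2)[OF tl(1)[OF k(1) 4(1)] tl(1)[OF k(2) 4(2)]]
          gval[OF tl[OF k(1) 4(1)]] gval[OF tl[OF k(2) 4(2)]]
        unfolding hO[OF 4(1)] hO[OF 4(2)] znth[OF k(1)] znth[OF k(2)] if_not_P[OF 4(1)] if_not_P[OF 4(2)] by simp
    qed
  qed
  have hi: "h k \<in> insert 0 (A\<^sub>1 \<union> A\<^sub>2)" if "k < N" for k
    using that fi[of "k - b"] gi[OF tl, of k] by (auto simp: h_def)
  have hinj: "inj_on h {..<N}"
    using hx by (intro inj_onI) (metis lessThan_iff linorder_neqE_nat order_less_irrefl)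
  have card1: "card (insert 0 A\<^sub>1) = n" "card (insert 0 A\<^sub>2) = l"
    using bij_betw_same_card[OF F(6)] bij_betw_same_card[OF G(6)] by simp_all
  then have fin: "finite A\<^sub>1" "finite A\<^sub>2"
    using n0 bl by (metis card.infinite finite_insert less_irrefl not_less_zero)+
  \<comment> \<open>Order preservation makes \<open>h\<close> injective; equal cardinalities then
    make it surjective.\<close>
  then have "card (insert 0 (A\<^sub>1 \<union> A\<^sub>2)) = N"
    using card1 dis by (auto simp: N_def card_Un_disjoint)
  then have hb: "bij_betw h {..<N} (insert 0 (A\<^sub>1 \<union> A\<^sub>2))"
    using hi hinj fin unfolding bij_betw_def
    by (metis card_image card_lessThan card_subset_eq finite_UnI finite_insert image_subsetI lessThan_iff)
  have "distinct zs"
    unfolding distinct_conv_nth zl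
  proof (intro allI impI)
    fix i j assume ij: "i < N" "j < N" "i \<noteq> j"
    have "h i \<noteq> h j" using hinj ij by (auto simp: inj_on_def)
    then have "snd (P (h i)) \<noteq> snd (P (h j))"
      using gp hi[OF ij(1)] hi[OF ij(2)] by (auto simp: general_position_def inj_on_def)
    then show "zs ! i \<noteq> zs ! j" using hy[OF ij(1,2)] hy[OF ij(2,1)] by linarith
  qed
  moreover have "zs ! k < length zs" if "k < length zs" for k
  proof -
    have "m < l" using permsD(2)[OF G(3)] nth_mem[of b "fst \<tau>"] bl by (auto simp: m_def l_def b_def)
    moreover have "fst \<tau> ! j < l" if "j < l" for j
      using permsD(2)[OF G(3)] nth_mem[of j "fst \<tau>"] that by (auto simp: l_def)
    ultimately show ?thesis
      using that znth[of k] zl sv[of "k - b"] tl[of k] n0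
      by (fastforce simp: box_shift_def N_def split: if_splits)
  qed
  ultimately have zp: "zs \<in> perms" by (rule distinct_bounded_perms)
  have sn: "snd (\<sigma> \<boxplus> \<tau>) = b + snd \<sigma>" by (simp add: box_sum_eq b_def)
  have "b + snd \<sigma> < N" "h (b + snd \<sigma>) = 0" using F(4,5) bl by (auto simp: N_def h_def)
  then have "represents h (\<sigma> \<boxplus> \<tau>) P (A\<^sub>1 \<union> A\<^sub>2)"
    unfolding represents_def zs_def[symmetric] zl sn cperms_def using zp hb hx hy sn zl
    by (simp add: case_prod_beta zs_def)
  then show thesis using that by blast
qed

text \<open>Converse of \<open>represents_box_sum\<close>: \<open>A\<^sub>1\<close> collects the
  points in the inflated block and \<open>A\<^sub>2\<close> the remaining ones. Lengths add under
  box sums, so two summands that are both shorter than the whole are both non-empty.\<close>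

lemma represents_box_sum_split:
  assumes f: "represents f (\<sigma> \<boxplus> \<tau>) P A" and c: "\<sigma> \<in> cperms" "\<tau> \<in> cperms" and A: "0 \<notin> A"
    and n: "clength \<sigma> < card A" "clength \<tau> < card A"
  obtains A\<^sub>1 A\<^sub>2 where "A = A\<^sub>1 \<union> A\<^sub>2" "A\<^sub>1 \<inter> A\<^sub>2 = {}" "A\<^sub>1 \<noteq> {}" "A\<^sub>2 \<noteq> {}" "uncut P A\<^sub>1 A\<^sub>2"
proof -
  define b where "b = snd \<tau>"
  define n where "n = length (fst \<sigma>)"
  define l where "l = length (fst \<tau>)"
  define m where "m = fst \<tau> ! snd \<tau>"
  define N where "N = n + l - 1"
  define zs where "zs = fst (\<sigma> \<boxplus> \<tau>)"
  have zl: "length zs = N"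
    using box_sum_length[OF c] by (simp add: zs_def N_def n_def l_def)
  note F = representsD[OF f, folded zs_def, unfolded zl]
  have n0: "snd \<sigma> < n" and bl: "b < l"
    using cpermsD(2)[OF c(1)] cpermsD(2)[OF c(2)] by (simp_all add: n_def l_def b_def)
  have znth: "zs ! k = (if b \<le> k \<and> k < b + n then m + fst \<sigma> ! (k - b) else box_shift m n (fst \<tau> ! box_outer b n k))"
    if "k < N" for k
    using box_sum_nth[OF c, of k] that zl by (simp add: zs_def b_def n_def m_def)
  define a where "a = snd (\<sigma> \<boxplus> \<tau>)"
  have a: "a = b + snd \<sigma>" "a < N" "f a = 0" "b \<le> a \<and> a < b + n"
    using n0 bl F(5) by (simp_all add: a_def box_sum_eq b_def N_def)
  define I where "I = {b..<b + n} - {a}"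
  define J where "J = {..<N} - {b..<b + n}"
  have IJ: "{..<N} = insert a (I \<union> J)" "a \<notin> I \<union> J" "I \<inter> J = {}"
    using a bl by (auto simp: I_def J_def N_def)
  have finj: "inj_on f {..<N}" using F(6) by (simp add: bij_betw_def)
  have "insert 0 A = insert 0 (f ` I \<union> f ` J)"
    using bij_betw_imp_surj_on[OF F(6)] a(3) unfolding IJ(1) by (simp add: image_Un)
  moreover have "0 \<notin> f ` I \<union> f ` J"
    using finj a(3) IJ unfolding inj_on_def by (metis (no_types, lifting) Un_iff imageE insertCI)
  ultimately have AIJ: "A = f ` I \<union> f ` J" using A insert_ident by metis
  have card: "card A = N - 1"
    using bij_betw_same_card[OF F(6)] A a(2) by (metis card_lessThan card_insert_disjoint card_gt_0_iff diff_Suc_1 finite_insert gr_implies_not0 not_gr_zero)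
  have "n - 1 < N - 1" "l - 1 < N - 1" using n card by (simp_all add: clength_def n_def l_def)
  then have nn: "n > 1" "l > 1" using bl n0 by (auto simp: N_def)
  have "card I = n - 1" using a by (simp add: I_def)
  then have I0: "I \<noteq> {}" using nn by auto
  have "J \<noteq> {}"
  proof
    assume "J = {}"
    then have "{..<N} \<subseteq> {b..<b + n}" by (auto simp: J_def)
    then have "N \<le> n" using card_mono[of "{b..<b+n}" "{..<N}"] by simp
    then show False using nn by (simp add: N_def)
  qed
  moreover have "f ` I \<inter> f ` J = {}"
  proof -
    have "I \<subseteq> {..<N}" "J \<subseteq> {..<N}" using IJ(1) by blast+
    then show ?thesis using IJ(3) inj_on_image_Int[OF finj] by (metis image_empty)
  qed
  moreover have "uncut P (f ` I) (f ` J)"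
    unfolding uncut_def
  proof (intro ballI)
    fix i' j' assume "i' \<in> f ` I" "j' \<in> f ` J"
    then obtain i j where ij: "i' = f i" "j' = f j" "i \<in> I" "j \<in> J" by blast
    have iN: "i < N" "j < N" using ij IJ(1) by auto
    have i: "b \<le> i \<and> i < b + n" and j: "\<not> (b \<le> j \<and> j < b + n)" using ij by (auto simp: I_def J_def)
    have "j < i \<longleftrightarrow> j < a" using i j a(4) by linarith
    then have x: "fst (P j') < fst (P i') \<longleftrightarrow> fst (P j') < fst (P 0)"
      using F(1)[OF iN(2,1)] F(1)[OF iN(2) a(2)] a(3) ij by simp
    have sv: "fst \<sigma> ! k < n" if "k < n" for k
      using permsD(2)[OF cpermsD(1)[OF c(1)]] that nth_mem[of k "fst \<sigma>"] by (auto simp: n_def)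
    have ol: "box_outer b n j < l" "box_outer b n j \<noteq> b"
      using j iN(2) bl by (auto simp: box_outer_def N_def)
    then have "fst \<tau> ! box_outer b n j \<noteq> m"
      using permsD(1)[OF cpermsD(1)[OF c(2)]] bl by (simp add: m_def l_def b_def nth_eq_iff_index_eq)
    then have bso: "box_shift m n (fst \<tau> ! box_outer b n j) < m + s \<longleftrightarrow> fst \<tau> ! box_outer b n j < m" if "s < n" for s
      using that by (auto simp: box_shift_def)
    have "i - b < n" "a - b < n" using i a(4) by linarith+
    then have "zs ! j < zs ! i \<longleftrightarrow> zs ! j < zs ! a"
      using znth[OF iN(1)] znth[OF iN(2)] znth[OF a(2)] i j a(4) bso sv[of "i - b"] sv[of "a - b"]
      by simp
    then have y: "snd (P j') < snd (P i') \<longleftrightarrow> snd (P j') < snd (P 0)"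
      using F(2)[OF iN(2,1)] F(2)[OF iN(2) a(2)] a(3) ij by simp
    show "(fst (P j') < fst (P i') \<longleftrightarrow> fst (P j') < fst (P 0)) \<and>
        (snd (P j') < snd (P i') \<longleftrightarrow> snd (P j') < snd (P 0))"
      using x y by blast
  qed
  ultimately show thesis
    using that[of "f ` I" "f ` J"] AIJ I0 by blast
qed

section \<open>Centred permutations indexed by finite sets\<close>

definition cpt :: "(nat \<Rightarrow> point) \<Rightarrow> nat set \<Rightarrow> cperm" where
  "cpt P A = cperm_of_points (P 0) (map P (sorted_list_of_set (insert 0 A)))"

lemma general_position_mono: "general_position P A \<Longrightarrow> B \<subseteq> A \<Longrightarrow> general_position P B"
  unfolding general_position_def by (meson inj_on_subset insert_mono)

lemma represents_cpt:
  assumes "finite A" "general_position P A"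
  obtains f where "represents f (cpt P A) P A"
proof -
  have "set (sorted_list_of_set (insert 0 A)) = insert 0 A" 
    using assms(1) by (intro set_sorted_list_of_set) simp
  then show thesis
    using represents_cperm_of_points[OF assms(2) _ distinct_sorted_list_of_set] that unfolding cpt_def by metis
qed

lemma represents_imp_eq_cpt:
  assumes "represents f \<pi> P A" "finite A" "general_position P A"
  shows "\<pi> = cpt P A"
  using represents_cpt[OF assms(2,3)] represents_unique[OF assms(1)] by blast

lemma cpt_in_cperms: "finite A \<Longrightarrow> general_position P A \<Longrightarrow> cpt P A \<in> cperms"
  using represents_cpt representsD(7) by metis

lemma clength_represents:
  assumes "represents f \<pi> P A" "0 \<notin> A" "finite A"
  shows "clength \<pi> = card A"
  using bij_betw_same_card[OF representsD(6)[OF assms(1)]] assms(2,3) by (simp add: clength_def)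

lemma clength_cpt: "finite A \<Longrightarrow> general_position P A \<Longrightarrow> 0 \<notin> A \<Longrightarrow> clength (cpt P A) = card A"
  using represents_cpt clength_represents by metis

lemma cpt_order_iso:
  assumes "order_iso \<phi> P A Q B" "finite A" "general_position P A" "finite B" "general_position Q B"
  shows "cpt P A = cpt Q B"
  using represents_cpt[OF assms(2,3)] represents_cpt[OF assms(4,5)] represents_order_iso_eq assms(1)
  by metis

lemma cpt_Un:
  assumes "finite A\<^sub>1" "finite A\<^sub>2" "general_position P (A\<^sub>1 \<union> A\<^sub>2)" "uncut P A\<^sub>1 A\<^sub>2"
    and "A\<^sub>1 \<inter> A\<^sub>2 = {}" "0 \<notin> A\<^sub>1" "0 \<notin> A\<^sub>2"
  shows "cpt P (A\<^sub>1 \<union> A\<^sub>2) = cpt P A\<^sub>1 \<boxplus> cpt P A\<^sub>2"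
proof -
  obtain f g where "represents f (cpt P A\<^sub>1) P A\<^sub>1" "represents g (cpt P A\<^sub>2) P A\<^sub>2"
    using assms represents_cpt general_position_mono by (metis Un_upper1 Un_upper2)
  then obtain h where "represents h (cpt P A\<^sub>1 \<boxplus> cpt P A\<^sub>2) P (A\<^sub>1 \<union> A\<^sub>2)"
    using represents_box_sum[OF _ _ assms(3-7)] by metis
  then show ?thesis
    using represents_imp_eq_cpt assms(1-3) by (metis finite_UnI)
qed

lemma cpt_contained_iff:
  assumes "finite A" "general_position P A" "0 \<notin> A" "\<pi> \<in> cperms"
  shows "ccontained \<pi> (cpt P A) \<longleftrightarrow> (\<exists>B\<subseteq>A. \<pi> = cpt P B)"
proof
  obtain f where f: "represents f (cpt P A) P A"
    using represents_cpt[OF assms(1,2)] by blast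
  show "\<exists>B\<subseteq>A. \<pi> = cpt P B" if "ccontained \<pi> (cpt P A)"
    using represents_contained[OF f assms(4) that] represents_imp_eq_cpt general_position_mono assms(1,2)
    by (metis finite_subset)
  show "ccontained \<pi> (cpt P A)" if "\<exists>B\<subseteq>A. \<pi> = cpt P B"
    using that represents_subset_contained[OF f] represents_cpt general_position_mono assms(1,2)
    by (metis finite_subset)
qed

section \<open>Finite pin words\<close>

lemma pin_sequence_pin_points:
  assumes "pin_word v"
  shows "pin_sequence v (pin_points v)"
  unfolding pin_points_def using pin_sequence_exists[OF assms] by (rule someI_ex)

lemma pin_sequence_general_position:
  assumes "pin_sequence v p"
  shows "general_position p {1..length v}"
proof -
  have "insert 0 {1..length v} = {..length v}" by auto
  then show ?thesis
    using pin_sequence_unique[OF assms assms] unfolding general_position_def same_order_def inj_on_def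
    by auto
qed

text \<open>Any two pin sequences of a word have the same order type, so the arbitrary choice in
  \<open>pin_points\<close> can be exchanged for whichever realisation is convenient.\<close>

lemma pin_cperm_eq_cpt:
  assumes v: "pin_sequence v p"
  shows "pin_cperm v = cpt p {1..length v}"
proof -
  have q: "pin_sequence v (pin_points v)"
    using v pin_sequence_pin_points by (auto simp: pin_sequence_def)
  have e: "insert 0 {1..length v} = {..length v}" by auto
  have "set [0..<Suc (length v)] = insert 0 {1..length v}" by (auto simp del: upt_Suc)
  then obtain f where f: "represents f (pin_cperm v) (pin_points v) {1..length v}"
    using represents_cperm_of_points[OF pin_sequence_general_position[OF q]] unfolding pin_cperm_def
    by (metis distinct_upt)
  obtain g where g: "represents g (cpt p {1..length v}) p {1..length v}"
    using represents_cpt[OF _ pin_sequence_general_position[OF v]] by blast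
  have "order_iso id (pin_points v) {1..length v} p {1..length v}"
    using pin_sequence_unique[OF q v] unfolding order_iso_def e same_order_def by simp
  then show ?thesis using represents_order_iso_eq[OF f g] by blast
qed

text \<open>The indices are shifted so that \<open>v ! k\<close> is the letter that places point
  \<open>Suc k\<close>, in line with the 0-based words.\<close>

lemma pin_sequenceD:
  assumes "pin_sequence v p"
  shows "v ! 0 = Numeral q \<Longrightarrow> in_quadrant q (p 0) (p 1)"
    and "1 \<le> k \<Longrightarrow> k < length v \<Longrightarrow> v ! k = Dir d \<Longrightarrow> j \<le> k \<Longrightarrow> beyond d (p (Suc k)) (p j)"
    and "1 \<le> k \<Longrightarrow> k < length v \<Longrightarrow> v ! k = Dir d \<Longrightarrow>
      separates (other_coord d (p (Suc k))) (other_coord d (p k)) ((\<lambda>j. other_coord d (p j)) ` {..<k})"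
proof -
  have *: "\<forall>k\<in>{2..length v}. \<forall>d. v ! (k - 1) = Dir d \<longrightarrow>
        (\<forall>j<k. beyond d (p k) (p j)) \<and>
        separates (other_coord d (p k)) (other_coord d (p (k - 1)))
          ((\<lambda>j. other_coord d (p j)) ` {..k - 2})"
    using assms unfolding pin_sequence_def by blast
  show "v ! 0 = Numeral q \<Longrightarrow> in_quadrant q (p 0) (p 1)"
    using assms unfolding pin_sequence_def by blast
  assume k: "1 \<le> k" "k < length v" "v ! k = Dir d"
  then have "Suc k \<in> {2..length v}" "{..Suc k - 2} = {..<k}" by auto
  then show "separates (other_coord d (p (Suc k))) (other_coord d (p k)) ((\<lambda>j. other_coord d (p j)) ` {..<k})"
    using *[rule_format, of "Suc k" d] k(3) by simp
  show "j \<le> k \<Longrightarrow> beyond d (p (Suc k)) (p j)"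
    using *[rule_format, of "Suc k" d] k \<open>Suc k \<in> _\<close> by simp
qed

lemma pin_wordD:
  assumes "pin_word v"
  shows "\<exists>q. v ! 0 = Numeral q" and "v \<noteq> []"
    and "1 \<le> k \<Longrightarrow> k < length v \<Longrightarrow> \<exists>d. v ! k = Dir d"
    and "Suc k < length v \<Longrightarrow> v ! k = Dir d \<Longrightarrow> v ! Suc k = Dir e \<Longrightarrow> vertical d \<noteq> vertical e"
proof -
  assume k: "1 \<le> k" "k < length v"
  then have "v ! k \<in> range Dir" using assms unfolding pin_word_def by simp
  then show "\<exists>d. v ! k = Dir d" by blast
qed (use assms in \<open>unfold pin_word_def, blast+\<close>)

lemma order_iso_beyond:
  assumes "order_iso \<phi> P A Q B" "i \<in> insert 0 A" "j \<in> insert 0 A"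
  shows "beyond d (P i) (P j) \<longleftrightarrow> beyond d (Q (\<phi> i)) (Q (\<phi> j))"
  using order_isoD[OF assms] order_isoD[OF assms(1,3,2)] by (cases d) auto

lemma order_iso_other_coord:
  assumes "order_iso \<phi> P A Q B" "i \<in> insert 0 A" "j \<in> insert 0 A"
  shows "other_coord d (P i) < other_coord d (P j) \<longleftrightarrow> other_coord d (Q (\<phi> i)) < other_coord d (Q (\<phi> j))"
  using order_isoD[OF assms] by (auto simp: other_coord_def)

lemma order_iso_in_quadrant:
  assumes "order_iso \<phi> P A Q B" "i \<in> A"
  shows "in_quadrant q (P 0) (P i) \<longleftrightarrow> in_quadrant q (Q 0) (Q (\<phi> i))"
proof -
  have "\<phi> 0 = 0" using assms(1) by (simp add: order_iso_def)
  then show ?thesis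
    using order_isoD[OF assms(1), of 0 i] order_isoD[OF assms(1), of i 0] assms(2) by (cases q) auto
qed

lemma in_quadrant_unique: "in_quadrant q c p \<Longrightarrow> in_quadrant q' c p \<Longrightarrow> q = q'"
  by (cases q; cases q') auto

lemma beyond_asym: "beyond d p q \<Longrightarrow> \<not> beyond d q p"
  by (cases d) auto

text \<open>
  The last letter and the order type locate the last point, and \<open>p\<^sub>k\<close> is the only point among
  \<open>p\<^sub>0, \<dots>, p\<^sub>k\<close> that \<open>p\<^sub>k\<^sub>+\<^sub>1\<close> separates from the origin; so the word can be read off backwards.
\<close>

lemma pin_word_eqI:
  assumes v: "pin_word v" and v': "pin_word v'" and len: "length v = length v'"
    and eq: "pin_cperm v = pin_cperm v'" and last: "last v = last v'"
  shows "v = v'"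
proof -
  define n where "n = length v"
  define p where "p = pin_points v"
  define p' where "p' = pin_points v'"
  obtain q where q: "v ! 0 = Numeral q" using pin_wordD(1)[OF v] ..
  note V = q pin_wordD(2-4)[OF v, folded n_def]
  obtain q' where q': "v' ! 0 = Numeral q'" using pin_wordD(1)[OF v'] ..
  note V' = q' pin_wordD(2-4)[OF v', folded len n_def]
  have n0: "n > 0" using V(2) by (simp add: n_def)
  have ps: "pin_sequence v p" "pin_sequence v' p'"
    using v v' pin_sequence_pin_points by (simp_all add: p_def p'_def)
  note D = pin_sequenceD[OF ps(1), folded n_def] and D' = pin_sequenceD[OF ps(2), folded len n_def]
  obtain f where f: "represents f (pin_cperm v) p {1..n}"
    using represents_cpt[OF finite_atLeastAtMost pin_sequence_general_position[OF ps(1)]]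
    unfolding pin_cperm_eq_cpt[OF ps(1)] n_def by blast
  obtain g where g: "represents g (pin_cperm v) p' {1..n}"
    using represents_cpt[OF finite_atLeastAtMost pin_sequence_general_position[OF ps(2)]]
    unfolding eq pin_cperm_eq_cpt[OF ps(2)] n_def len by blast
  obtain \<phi> where \<phi>: "order_iso \<phi> p {1..n} p' {1..n}"
    using represents_imp_order_iso[OF f g] .
  have S: "insert 0 {1..n} = {..n}" by auto
  note O = order_iso_beyond[OF \<phi>, unfolded S] order_iso_other_coord[OF \<phi>, unfolded S]
  have \<phi>0: "\<phi> 0 = 0" and \<phi>b: "bij_betw \<phi> {..n} {..n}"
    using \<phi> unfolding order_iso_def S by auto
  have inv: "\<exists>i\<le>k. \<phi> i = j" if fixed: "\<And>i. k < i \<Longrightarrow> i \<le> n \<Longrightarrow> \<phi> i = i" and jk: "j \<le> k" "k \<le> n" for j k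
  proof -
    obtain i where "i \<le> n" "\<phi> i = j"
      using \<phi>b jk by (metis (no_types, lifting) atMost_iff bij_betw_def image_iff le_trans)
    then show ?thesis using fixed[of i] jk by (metis leI leD)
  qed
  \<comment> \<open>Descending induction: once \<open>\<phi>\<close> fixes all indices above
    \<open>k\<close>, it permutes the indices up to \<open>k\<close>, and the point with the largest
    of these has to be recognised.\<close>
  have main: "\<phi> k = k \<and> v ! (k - 1) = v' ! (k - 1)" if "1 \<le> k" "k \<le> n" for k
    using that
  proof (induction "n - k" arbitrary: k rule: less_induct)
    case less
    have fixed: "\<phi> i = i" if "k < i" "i \<le> n" for i
      using less.hyps[of i] that less.prems by simp
    have \<phi>le: "\<phi> k \<le> k"
    proof (rule ccontr)
      assume *: "\<not> \<phi> k \<le> k"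
      have "\<phi> k \<le> n" using \<phi>b less.prems bij_betwE by blast
      then have "\<phi> (\<phi> k) = \<phi> k" using fixed[of "\<phi> k"] * by simp
      then show False
        using \<phi>b * \<open>\<phi> k \<le> n\<close> less.prems unfolding bij_betw_def inj_on_def by (metis atMost_iff le_refl)
    qed
    obtain i where i: "i \<le> k" "\<phi> i = k" using inv[of k k] fixed less.prems by blast
    show ?case
    proof (cases "k = n")
      case True
      have l: "v ! (n - 1) = v' ! (n - 1)"
        using last V(2) V'(2) len by (simp add: last_conv_nth n_def)
      show ?thesis
      proof (cases "n = 1")
        case True
        then have "\<phi> 1 \<noteq> 0" "\<phi> 1 \<le> 1"
          using \<phi>0 \<phi>le \<open>k = n\<close> inj_onD[OF bij_betw_imp_inj_on[OF \<phi>b], of 1 0] by auto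
        then show ?thesis using l True \<open>k = n\<close> by simp
      next
        case False
        then have n2: "1 \<le> n - 1" "n - 1 < n" "Suc (n - 1) = n" using n0 by auto
        obtain d where d: "v ! (n - 1) = Dir d" using V(3) n2 by blast
        \<comment> \<open>The last letter is common to both words, so both last points are the
          extreme ones in the same direction \<open>d\<close>.\<close>
        have "\<phi> n = n"
        proof (rule ccontr)
          assume ne: "\<phi> n \<noteq> n"
          then have "\<phi> n \<le> n - 1" using \<phi>le True by simp
          then have "beyond d (p' n) (p' (\<phi> n))"
            using D'(2)[of "n - 1" d "\<phi> n"] n2 d l by simp
          moreover have "i \<le> n - 1" using i ne True by (cases "i = n") auto
          then have "beyond d (p n) (p i)" using D(2)[of "n - 1" d i] n2 d by simp
          then have "beyond d (p' (\<phi> n)) (p' n)" using O(1)[of n i] i True by simp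
          ultimately show False using beyond_asym by blast
        qed
        then show ?thesis using l True by simp
      qed
    next
      case False
      then have kn: "k < n" using less.prems by simp
      obtain d where d: "v ! k = Dir d" using V(3)[OF less.prems(1) kn] by blast
      have d': "v' ! k = Dir d" using less.hyps[of "Suc k"] kn d by simp
      have fS: "\<phi> (Suc k) = Suc k" using fixed kn by simp
      let ?c = "\<lambda>j. other_coord d (p j)" and ?c' = "\<lambda>j. other_coord d (p' j)"
      have sep: "separates (?c (Suc k)) (?c k) (?c ` {..<k})" "separates (?c' (Suc k)) (?c' k) (?c' ` {..<k})"
        using D(3)[OF less.prems(1) kn d] D'(3)[OF less.prems(1) kn d'] .
      \<comment> \<open>Otherwise some \<open>i < k\<close> is sent to \<open>k\<close>. Point
        \<open>k + 1\<close> of the first sequence has \<open>i\<close> and the origin on the same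
        side, while point \<open>k + 1\<close> of the second one separates \<open>k\<close> from the
        origin.\<close>
      have \<phi>k: "\<phi> k = k"
      proof (rule ccontr)
        assume ne: "\<phi> k \<noteq> k"
        then have "i < k" using i by (cases "i = k") auto
        have "0 < k" using less.prems by simp
        have "(?c i < ?c (Suc k) \<longleftrightarrow> ?c 0 < ?c (Suc k)) \<and> (?c (Suc k) < ?c i \<longleftrightarrow> ?c (Suc k) < ?c 0)"
          using sep(1) \<open>i < k\<close> \<open>0 < k\<close> unfolding separates_def
          by (metis imageI lessThan_iff order_less_asym)
        then have "(?c' k < ?c' (Suc k) \<longleftrightarrow> ?c' 0 < ?c' (Suc k)) \<and> (?c' (Suc k) < ?c' k \<longleftrightarrow> ?c' (Suc k) < ?c' 0)"
          using O(2)[of i "Suc k" d] O(2)[of 0 "Suc k" d] O(2)[of "Suc k" i d] O(2)[of "Suc k" 0 d]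
            i kn \<phi>0 fS by simp
        then show False
          using sep(2) \<open>0 < k\<close> unfolding separates_def
          by (metis imageI lessThan_iff order_less_asym)
      qed
      moreover have "v ! (k - 1) = v' ! (k - 1)"
      proof (cases "k = 1")
        case True
        have "in_quadrant q (p' 0) (p' 1)"
          using D(1)[OF V(1)] order_iso_in_quadrant[OF \<phi>, of 1 q] \<phi>k True kn by simp
        then show ?thesis
          using in_quadrant_unique[OF _ D'(1)[OF V'(1)]] V(1) V'(1) True by simp
      next
        case False
        define m where "m = k - 1"
        have m: "1 \<le> m" "k = Suc m" "m < n" using False less.prems kn by (auto simp: m_def)
        obtain e where e: "v ! m = Dir e" using V(3) m by blast
        obtain e' where e': "v' ! m = Dir e'" using V'(3) m by blast
        \<comment> \<open>Both letters alternate with the common next letter \<open>d\<close>, so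
          they use the same axis. The side of the origin on which point \<open>k\<close> lies is
          preserved by \<open>\<phi>\<close> and decides between the two directions on that
          axis.\<close>
        have "vertical e = vertical e'"
          using V(4)[of m e d] V'(4)[of m e' d] e e' d d' m kn by auto
        moreover have "beyond e (p k) (p 0)" "beyond e' (p' k) (p' 0)"
          using D(2)[OF m(1,3) e] D'(2)[OF m(1,3) e'] m by simp_all
        moreover from this have "beyond e (p' k) (p' 0)"
          using O(1)[of k 0 e] kn \<phi>k \<phi>0 by simp
        ultimately have "e = e'" by (cases e; cases e') auto
        then show ?thesis using e e' m by simp
      qed
      ultimately show ?thesis by blast
    qed
  qed
  show ?thesis
  proof (rule nth_equalityI[OF len])
    fix i assume "i < length v"
    then show "v ! i = v' ! i" using main[of "Suc i"] by (simp add: n_def)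
  qed
qed

section \<open>The pin sequence of an infinite word\<close>

text \<open>The points chosen by \<open>pin_points\<close> for different prefixes need not be
  compatible. The explicit coordinates are: point \<open>k\<close> depends only on the first
  \<open>k\<close> letters, so they fit together to one infinite sequence that serves every
  prefix.\<close>

definition pin_path :: "(nat \<Rightarrow> pin_letter) \<Rightarrow> nat \<Rightarrow> point" where
  "pin_path w k = explicit_pins (prefix_word w (Suc k)) k"

lemma explicit_pins_cong:
  assumes "v ! 0 = v' ! 0" "\<And>i. i < k \<Longrightarrow> v ! i = v' ! i"
  shows "explicit_pins v k = explicit_pins v' k"
  using assms
proof (induction v k rule: explicit_pins.induct)
  case (3 v k)
  then have "explicit_pins v (Suc k) = explicit_pins v' (Suc k)" by simp
  then show ?case using 3(3)[of "Suc k"] by (simp add: Let_def)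
qed auto

lemma prefix_word_nth [simp]: "i < n \<Longrightarrow> prefix_word w n ! i = w i"
  by (simp add: prefix_word_def)

lemma prefix_word_length [simp]: "length (prefix_word w n) = n"
  by (simp add: prefix_word_def)

lemma pin_path_eq_explicit_pins:
  assumes "0 < n" "k \<le> n"
  shows "pin_path w k = explicit_pins (prefix_word w n) k"
  unfolding pin_path_def using assms by (intro explicit_pins_cong) auto

lemma pin_path_beyond_separates:
  assumes w: "infinite_pin_word w" and d: "w (Suc m) = Dir d"
  defines "p \<equiv> pin_path w"
  shows "(\<forall>j<Suc (Suc m). beyond d (p (Suc (Suc m))) (p j)) \<and>
    separates (other_coord d (p (Suc (Suc m)))) (other_coord d (p (Suc m))) ((\<lambda>j. other_coord d (p j)) ` {..m})"
proof -
  define v where "v = prefix_word w (Suc (Suc m))"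
  have v: "pin_word v" "v ! Suc m = Dir d"
    using w d by (auto simp: infinite_pin_word_def v_def)
  have p: "p j = explicit_pins v j" if "j \<le> Suc (Suc m)" for j
    using pin_path_eq_explicit_pins[of "Suc (Suc m)" j w] that by (simp add: p_def v_def)
  have bnd: "\<bar>fst (p j)\<bar> \<le> 2 * real j" "\<bar>snd (p j)\<bar> \<le> 2 * real j" for j
    using explicit_pins_bound[of _ j] by (auto simp: p_def pin_path_def)
  have step: "p (Suc (Suc m)) =
      (case d of U \<Rightarrow> (sgn (fst (p (Suc m))) * (2 * real m + 1), 2 * real m + 4)
         | D \<Rightarrow> (sgn (fst (p (Suc m))) * (2 * real m + 1), - (2 * real m + 4))
         | L \<Rightarrow> (- (2 * real m + 4), sgn (snd (p (Suc m))) * (2 * real m + 1))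
         | R \<Rightarrow> (2 * real m + 4, sgn (snd (p (Suc m))) * (2 * real m + 1)))"
    using p[of "Suc m"] p[of "Suc (Suc m)"] v(2) by (cases d) (simp_all add: Let_def)
  have "beyond d (p (Suc (Suc m))) (p j)" if "j < Suc (Suc m)" for j
  proof -
    have "\<bar>fst (p j)\<bar> < 2 * real m + 4" "\<bar>snd (p j)\<bar> < 2 * real m + 4"
      using bnd[of j] that by linarith+
    then show ?thesis unfolding step by (cases d) (auto simp: abs_less_iff)
  qed
  moreover have "separates (other_coord d (p (Suc (Suc m)))) (other_coord d (p (Suc m)))
      ((\<lambda>j. other_coord d (p j)) ` {..m})"
  proof -
    define c where "c = other_coord d (p (Suc m))"
    have "\<bar>c\<bar> = 2 * real m + 2"
      using explicit_pins_extreme[OF v(1), of "Suc m" d] v(2) p[of "Suc m"] by (simp add: c_def v_def)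
    moreover have "other_coord d (p (Suc (Suc m))) = sgn c * (2 * real m + 1)"
      unfolding step by (cases d) (simp_all add: other_coord_def c_def)
    moreover have "- (2 * real m + 1) < other_coord d (p j) \<and> other_coord d (p j) < 2 * real m + 1"
      if "j \<le> m" for j
      using bnd[of j] that by (auto simp: other_coord_def abs_le_iff)
    ultimately show ?thesis
      unfolding c_def[symmetric] separates_def by (cases "c > 0"; cases "c < 0") auto
  qed
  ultimately show ?thesis by blast
qed

lemma pin_sequence_pin_path:
  assumes w: "infinite_pin_word w" and n: "0 < n"
  shows "pin_sequence (prefix_word w n) (pin_path w)"
  unfolding pin_sequence_def
proof (intro conjI allI ballI impI)
  show "pin_word (prefix_word w n)" using w n by (simp add: infinite_pin_word_def)
  fix q assume "prefix_word w n ! 0 = Numeral q"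
  then show "in_quadrant q (pin_path w 0) (pin_path w 1)"
    using n by (cases q) (auto simp: pin_path_def)
next
  fix k d j assume k: "k \<in> {2..length (prefix_word w n)}" "prefix_word w n ! (k - 1) = Dir d"
  then obtain m where m: "k = Suc (Suc m)"
    by (metis Suc_le_D atLeastAtMost_iff numeral_2_eq_2 Suc_le_mono)
  have "w (Suc m) = Dir d" using k m by simp
  note * = pin_path_beyond_separates[OF w this]
  show "beyond d (pin_path w k) (pin_path w j)" if "j < k" using * that m by blast
  show "separates (other_coord d (pin_path w k)) (other_coord d (pin_path w (k - 1)))
      ((\<lambda>j. other_coord d (pin_path w j)) ` {..k - 2})"
    using * m by simp
qed

section \<open>Growth of sequences\<close>

lemma root_Suc_tendsto: "(\<lambda>n. root n (real (Suc n))) \<longlonglongrightarrow> 1"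
proof (rule tendsto_sandwich[of "\<lambda>_. 1" _ _ "\<lambda>n. root n 2 * root n (real n)"])
  show "\<forall>\<^sub>F n in sequentially. 1 \<le> root n (real (Suc n))"
    using eventually_gt_at_top[of 0] by eventually_elim simp
  show "\<forall>\<^sub>F n in sequentially. root n (real (Suc n)) \<le> root n 2 * root n (real n)"
    using eventually_gt_at_top[of 0]
    by eventually_elim (simp add: real_root_mult[symmetric] real_root_le_iff)
  show "(\<lambda>n. root n 2 * root n (real n)) \<longlonglongrightarrow> 1"
    using tendsto_mult[OF LIMSEQ_root_const[of 2] LIMSEQ_root] by simp
qed simp

text \<open>Blocks of length \<open>k\<close> are split off one at a time. The penalty in
  \<open>mult\<close> depends on the first argument only, so each block costs \<open>k + 1\<close>,
  however long the remainder is.\<close>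

lemma Fekete_lower_bound:
  fixes b :: "nat \<Rightarrow> real"
  assumes b1: "\<And>n. 1 \<le> b n" and mult: "\<And>n m. b n * b m \<le> (real n + 1) * b (n + m)"
  shows "(b k / (real k + 1)) ^ q \<le> b (k * q + r)"
proof (induction q)
  case 0
  then show ?case using b1 by simp
next
  case (Suc q)
  have "(b k / (real k + 1)) ^ Suc q \<le> b k / (real k + 1) * b (k * q + r)"
    using Suc b1[of k] by (simp add: mult_left_mono del: times_divide_eq_left)
  also have "\<dots> \<le> b (k + (k * q + r))"
    using mult[of k "k * q + r"] by (simp add: field_simps)
  finally show ?case by (simp add: algebra_simps)
qed

lemma Fekete_root_tendsto:
  fixes b :: "nat \<Rightarrow> real"
  assumes b1: "\<And>n. 1 \<le> b n" and C: "\<And>n. b n \<le> C ^ n" "1 \<le> C"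
    and mult: "\<And>n m. b n * b m \<le> (real n + 1) * b (n + m)"
  obtains g where "1 \<le> g" "(\<lambda>n. root n (b n)) \<longlonglongrightarrow> g"
proof -
  \<comment> \<open>Dividing by \<open>k + 1\<close> pays in advance for joining a block of length
    \<open>k\<close>; the limit is the supremum of these roots.\<close>
  define s where "s = (\<lambda>k. root k (b k / (real k + 1)))"
  have b0: "0 < b n" for n using b1[of n] by linarith
  have s0: "0 < s k" if "0 < k" for k
    using that b0[of k] by (simp add: s_def)
  have sC: "s k \<le> C" if "0 < k" for k
  proof -
    have "b k / (real k + 1) \<le> b k / 1" using b0[of k] by (intro divide_left_mono) auto
    then have "b k / (real k + 1) \<le> C ^ k" using C(1)[of k] by simp
    then have "s k \<le> root k (C ^ k)" using that by (simp add: s_def)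
    then show ?thesis using that C(2) by (simp add: real_root_power_cancel)
  qed
  define g where "g = Sup (s ` {0<..})"
  have bdd: "bdd_above (s ` {0<..})" using sC by (intro bdd_aboveI[of _ C]) auto
  have sg: "s k \<le> g" if "0 < k" for k unfolding g_def using that by (intro cSup_upper bdd) auto
  have g0: "0 < g" using s0[of 1] sg[of 1] by simp
  have up: "root n (b n) \<le> g * root n (real (Suc n))" if "0 < n" for n
  proof -
    have "root n (b n) = s n * root n (real (Suc n))"
      using that unfolding s_def real_root_mult[symmetric] by (simp add: add.commute)
    also have "\<dots> \<le> g * root n (real (Suc n))" using sg[OF that] that by (intro mult_right_mono) auto
    finally show ?thesis .
  qed
  have lim: "(\<lambda>n. root n (b n)) \<longlonglongrightarrow> g"
  proof (rule order_tendstoI)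
    fix y assume "g < y"
    have "(\<lambda>n. g * root n (real (Suc n))) \<longlonglongrightarrow> g * 1"
      by (intro tendsto_intros root_Suc_tendsto)
    then have "\<forall>\<^sub>F n in sequentially. g * root n (real (Suc n)) < y"
      using \<open>g < y\<close> by (auto dest: order_tendstoD(2))
    then show "\<forall>\<^sub>F n in sequentially. root n (b n) < y"
      using eventually_gt_at_top[of 0] by eventually_elim (metis up order.strict_trans1)
  next
    fix y assume "y < g"
    then obtain k where k: "0 < k" "y < s k"
      unfolding g_def using less_cSup_iff[OF _ bdd, of y] by auto
    have ge1: "1 \<le> root n (b n)" if "0 < n" for n using that b1 by simp
    \<comment> \<open>If \<open>s k \<le> 1\<close> then \<open>y < 1\<close> and
      \<open>1 \<le> b n\<close> suffices. Otherwise the powers of \<open>s k\<close> increase,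
      which the rounding of \<open>n\<close> below relies on.\<close>
    show "\<forall>\<^sub>F n in sequentially. y < root n (b n)"
    proof (cases "s k \<le> 1")
      case False
      have low: "s k * root n (inverse (s k ^ k)) \<le> root n (b n)" if n: "0 < n" for n
      proof -
        have "s k ^ k = b k / (real k + 1)"
          using k(1) b0[of k] by (simp add: s_def)
        then have "(s k ^ k) ^ (n div k) \<le> b n"
          using Fekete_lower_bound[OF b1 mult, of k "n div k" "n mod k"] by simp
        \<comment> \<open>Rounding \<open>n\<close> up to a multiple of \<open>k\<close> costs at
          most one extra factor \<open>s k ^ k\<close>, a constant whose \<open>n\<close>-th root
          tends to 1.\<close>
        moreover have "s k ^ n \<le> (s k ^ k) ^ (n div k) * s k ^ k"
        proof -
          have "n \<le> k * (n div k) + k"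
            using k(1) by (metis add.commute add_le_cancel_right mult_div_mod_eq less_imp_le mod_less_divisor add_le_cancel_left)
          then have "s k ^ n \<le> s k ^ (k * (n div k) + k)" using False by (intro power_increasing) auto
          then show ?thesis by (simp add: power_add power_mult)
        qed
        ultimately have "s k ^ n \<le> b n * s k ^ k"
          using s0[OF k(1)] by (meson mult_right_mono order_trans zero_le_power less_imp_le)
        then have "s k ^ n * inverse (s k ^ k) \<le> b n"
          using s0[OF k(1)] by (simp add: field_simps)
        then have "root n (s k ^ n * inverse (s k ^ k)) \<le> root n (b n)" using n by simp
        then show ?thesis using n s0[OF k(1)] by (simp add: real_root_mult real_root_power_cancel)
      qed
      have "(\<lambda>n. s k * root n (inverse (s k ^ k))) \<longlonglongrightarrow> s k * 1"
        using s0[OF k(1)] by (intro tendsto_intros LIMSEQ_root_const) simp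
      then have "\<forall>\<^sub>F n in sequentially. y < s k * root n (inverse (s k ^ k))"
        using k(2) by (auto dest: order_tendstoD(1))
      then show ?thesis using eventually_gt_at_top[of 0] by eventually_elim (metis low order.strict_trans2)
    next
      case True
      show ?thesis using eventually_gt_at_top[of 0]
        by eventually_elim (metis True k(2) ge1 order.strict_trans2 order.trans)
    qed
  qed
  have "1 \<le> g"
    by (rule tendsto_lowerbound[OF lim]) (use b1 in \<open>auto intro!: eventually_sequentiallyI[of 1]\<close>)
  then show thesis using lim that by blast
qed

lemma root_tendsto_imp_bound:
  fixes b :: "nat \<Rightarrow> real"
  assumes "(\<lambda>n. root n (b n)) \<longlonglongrightarrow> g" "g < y" "1 \<le> y" "\<And>n. 0 \<le> b n"
  obtains K where "1 \<le> K" "\<And>n. b n \<le> K * y ^ n"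
proof -
  have "\<forall>\<^sub>F n in sequentially. 0 < n \<and> root n (b n) < y"
    using order_tendstoD(2)[OF assms(1,2)] eventually_gt_at_top[of 0] by eventually_elim simp
  then obtain n0 where n0: "\<And>n. n0 \<le> n \<Longrightarrow> 0 < n \<and> root n (b n) < y"
    by (auto simp: eventually_sequentially)
  \<comment> \<open>The sum absorbs the finitely many indices before \<open>n0\<close>, and the
    summand 1 ensures \<open>1 \<le> K\<close>.\<close>
  define K where "K = 1 + (\<Sum>i<n0. b i)"
  have K1: "1 \<le> K" using assms(4) by (simp add: K_def sum_nonneg)
  have "b n \<le> K * y ^ n" for n
  proof (cases "n < n0")
    case True
    then have "b n \<le> K" using assms(4) member_le_sum[of n "{..<n0}" b] by (simp add: K_def)
    also have "\<dots> \<le> K * y ^ n" using K1 assms(3) mult_left_mono[of 1 "y ^ n" K] by simp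
    finally show ?thesis .
  next
    case False
    then have n: "0 < n" "root n (b n) < y" using n0 by auto
    then have "root n (b n) ^ n \<le> y ^ n" using assms(4) by (intro power_mono) auto
    then have "b n \<le> y ^ n" using n(1) assms(4) by simp
    also have "\<dots> \<le> K * y ^ n" using K1 assms(3) mult_right_mono[of 1 K "y ^ n"] by simp
    finally show ?thesis .
  qed
  then show thesis using K1 that by blast
qed

text \<open>Factors polynomial in \<open>n\<close> disappear under the \<open>n\<close>-th root. The
  square in \<open>low\<close> allows for the passage from centred to underlying permutations, so
  the lemma serves both classes.\<close>

lemma root_tendsto_sandwich:
  fixes b f :: "nat \<Rightarrow> real"
  assumes lim: "(\<lambda>n. root n (b n)) \<longlonglongrightarrow> g" and g: "1 \<le> g"
    and low: "\<And>n. b n \<le> real (Suc n) ^ 2 * f n"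
    and up: "\<And>x. g < x \<Longrightarrow> \<exists>M>0. \<forall>n. f n \<le> M * real (Suc n) * x ^ n"
  shows "(\<lambda>n. root n (f n)) \<longlonglongrightarrow> g"
proof (rule order_tendstoI)
  fix y assume "y < g"
  have "(\<lambda>n. root n (b n) / root n (real (Suc n)) ^ 2) \<longlonglongrightarrow> g / 1 ^ 2"
    by (intro tendsto_intros lim root_Suc_tendsto) simp
  then have "\<forall>\<^sub>F n in sequentially. y < root n (b n) / root n (real (Suc n)) ^ 2"
    using \<open>y < g\<close> by (auto dest: order_tendstoD(1))
  then show "\<forall>\<^sub>F n in sequentially. y < root n (f n)"
    using eventually_gt_at_top[of 0]
  proof eventually_elim
    case (elim n)
    have "root n (b n) \<le> root n (real (Suc n) ^ 2 * f n)" using low elim(2) by simp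
    also have "\<dots> = root n (real (Suc n)) ^ 2 * root n (f n)"
      using elim(2) by (simp add: real_root_mult real_root_power)
    finally have "root n (b n) / root n (real (Suc n)) ^ 2 \<le> root n (f n)"
      using elim(2) by (subst pos_divide_le_eq) (auto simp: mult.commute)
    then show ?case using elim(1) by linarith
  qed
next
  fix y assume y: "g < y"
  define x where "x = (g + y) / 2"
  have x: "g < x" "x < y" "0 < x" using y g by (simp_all add: x_def)
  obtain M where M: "0 < M" "\<And>n. f n \<le> M * real (Suc n) * x ^ n" using up[OF x(1)] by blast
  have "(\<lambda>n. root n M * root n (real (Suc n)) * x) \<longlonglongrightarrow> 1 * 1 * x"
    by (intro tendsto_intros LIMSEQ_root_const root_Suc_tendsto M(1))
  then have "\<forall>\<^sub>F n in sequentially. root n M * root n (real (Suc n)) * x < y"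
    using x(2) by (auto dest: order_tendstoD(2))
  then show "\<forall>\<^sub>F n in sequentially. root n (f n) < y"
    using eventually_gt_at_top[of 0]
  proof eventually_elim
    case (elim n)
    have "root n (f n) \<le> root n (M * real (Suc n) * x ^ n)" using M(2) elim(2) by simp
    also have "\<dots> = root n M * root n (real (Suc n)) * x"
      using elim(2) x(3) by (simp add: real_root_mult real_root_power_cancel)
    finally show ?case using elim(1) by linarith
  qed
qed

lemma root_tendsto_imp_has_growth_rate:
  assumes "(\<lambda>n. root n (real (card {\<pi> \<in> C. len \<pi> = n}))) \<longlonglongrightarrow> g"
  shows "has_growth_rate len C g"
  unfolding has_growth_rate_def upper_growth_rate_def lower_growth_rate_def
  using lim_imp_Limsup[OF sequentially_bot tendsto_ereal[OF assms]]
    lim_imp_Liminf[OF sequentially_bot tendsto_ereal[OF assms]] by simp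

section \<open>Renewal and concatenation inequalities\<close>

lemma sum_power_atMost_le:
  fixes q :: real
  assumes "0 \<le> q" "q < 1"
  shows "(\<Sum>i\<le>n. q ^ i) \<le> 1 / (1 - q)"
proof -
  have "(\<Sum>i<Suc n. q ^ i) \<le> (\<Sum>i. q ^ i)"
    using assms by (intro sum_le_suminf) auto
  then show ?thesis using assms by (simp add: suminf_geometric lessThan_Suc_atMost)
qed

text \<open>With \<open>q = z / x\<close> and the bound assumed for smaller arguments, each summand
  is at most \<open>2 * K * x ^ n\<close> times \<open>K * K' * q ^ (i + m)\<close>. Summing over
  \<open>i\<close> and over \<open>m > l\<close> gives two geometric series and the small factor
  \<open>q ^ l\<close>. By \<open>l\<close> the double sum takes up half of
  \<open>2 * K * x ^ n\<close>; the term \<open>b n\<close> takes up at most the other half.\<close>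

lemma renewal_bound:
  fixes b W e :: "nat \<Rightarrow> real"
  assumes b: "\<And>n. b n \<le> K * z ^ n" and W: "\<And>m. 1 \<le> m \<Longrightarrow> W m \<le> K' * z ^ m"
    and e: "\<And>n. e n \<le> b n + (\<Sum>i\<le>n. \<Sum>m\<in>{l<..n - i}. b i * W m * e (n - i - m))"
    and nonneg: "\<And>n. 0 \<le> b n" "\<And>n. 0 \<le> W n" "\<And>n. 0 \<le> e n" "0 \<le> K" "0 \<le> K'"
    and zx: "0 \<le> z" "z < x" and l: "K * K' * (z / x) ^ l / (1 - z / x) ^ 2 \<le> 1 / 2"
  shows "e n \<le> 2 * K * x ^ n"
proof (induction n rule: less_induct)
  case (less n)
  define q where "q = z / x"
  have x: "0 < x" using zx by simp
  have q: "0 \<le> q" "q < 1" using zx x by (simp_all add: q_def)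
  have zq: "z ^ k = q ^ k * x ^ k" for k using x by (simp add: q_def power_divide)
  have summand: "b i * W m * e (n - i - m) \<le> 2 * K * x ^ n * (K * K' * (q ^ i * q ^ m))"
    if "i \<le> n" "m \<in> {l<..n - i}" for i m
  proof -
    have m: "1 \<le> m" "n - i - m < n" "i + (m + (n - i - m)) = n" using that by auto
    have "b i * W m * e (n - i - m) \<le> (K * z ^ i) * (K' * z ^ m) * (2 * K * x ^ (n - i - m))"
      using b[of i] W[OF m(1)] less[OF m(2)] nonneg zx by (intro mult_mono) auto
    also have "\<dots> = 2 * K * (x ^ i * (x ^ m * x ^ (n - i - m))) * (K * K' * (q ^ i * q ^ m))"
      unfolding zq by (simp add: algebra_simps)
    also have "x ^ i * (x ^ m * x ^ (n - i - m)) = x ^ n"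
      unfolding power_add[symmetric] m(3) ..
    finally show ?thesis .
  qed
  have inner: "(\<Sum>m\<in>{l<..k}. q ^ m) \<le> q ^ l * (1 / (1 - q))" for k
  proof (cases "l \<le> k")
    case True
    have "(\<Sum>m\<in>{l<..k}. q ^ m) \<le> (\<Sum>m\<in>{l..k}. q ^ m)" using q by (intro sum_mono2) auto
    also have "\<dots> = (\<Sum>m\<le>k - l. q ^ (m + l))"
      using sum.shift_bounds_cl_nat_ivl[of "\<lambda>m. q ^ m" 0 l "k - l"] True by (simp add: atMost_atLeast0)
    also have "\<dots> = q ^ l * (\<Sum>m\<le>k - l. q ^ m)" by (simp add: power_add sum_distrib_left mult.commute)
    also have "\<dots> \<le> q ^ l * (1 / (1 - q))" using q sum_power_atMost_le[OF q] by (intro mult_left_mono) auto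
    finally show ?thesis .
  qed (use q in auto)
  have "(\<Sum>i\<le>n. \<Sum>m\<in>{l<..n - i}. b i * W m * e (n - i - m))
      \<le> (\<Sum>i\<le>n. \<Sum>m\<in>{l<..n - i}. 2 * K * x ^ n * (K * K' * (q ^ i * q ^ m)))"
    using summand by (intro sum_mono) auto
  also have "\<dots> = 2 * K * x ^ n * (K * K' * (\<Sum>i\<le>n. q ^ i * (\<Sum>m\<in>{l<..n - i}. q ^ m)))"
    by (simp add: sum_distrib_left mult.assoc)
  also have "\<dots> \<le> 2 * K * x ^ n * (K * K' * (\<Sum>i\<le>n. q ^ i * (q ^ l * (1 / (1 - q)))))"
    using inner q nonneg x by (intro mult_left_mono sum_mono) auto
  also have "\<dots> = 2 * K * x ^ n * (K * K' * ((\<Sum>i\<le>n. q ^ i) * (q ^ l * (1 / (1 - q)))))"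
    by (simp only: sum_distrib_right)
  also have "\<dots> \<le> 2 * K * x ^ n * (K * K' * (1 / (1 - q) * (q ^ l * (1 / (1 - q)))))"
    using sum_power_atMost_le[OF q, of n] q nonneg x by (intro mult_left_mono mult_right_mono) auto
  also have "\<dots> = 2 * K * x ^ n * (K * K' * q ^ l / (1 - q) ^ 2)"
    by (simp add: power2_eq_square)
  also have "\<dots> \<le> 2 * K * x ^ n * (1 / 2)"
    using l x nonneg unfolding q_def by (intro mult_left_mono) auto
  finally have "(\<Sum>i\<le>n. \<Sum>m\<in>{l<..n - i}. b i * W m * e (n - i - m)) \<le> K * x ^ n" by simp
  moreover have "b n \<le> K * x ^ n"
    using b[of n] zx nonneg(4) power_mono[of z x n] by (meson mult_left_mono less_imp_le order_trans)
  ultimately show ?case using e[of n] by linarith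
qed

text \<open>Induction in steps of \<open>l\<close>. Each step multiplies by at most
  \<open>64 * K * y ^ l\<close>, which the slack between \<open>y\<close> and \<open>z\<close>
  absorbs; the last piece, of length at most \<open>l\<close>, leaves the leading constant
  \<open>8 * K\<close>.\<close>

lemma concatenation_bound:
  fixes b W :: "nat \<Rightarrow> real"
  assumes b: "\<And>n. b n \<le> K * y ^ n" and short: "\<And>m. 1 \<le> m \<Longrightarrow> m \<le> l \<Longrightarrow> W m \<le> 8 * b m"
    and long: "\<And>m. 1 \<le> m \<Longrightarrow> W (l + m) \<le> 64 * b l * W m"
    and y: "0 \<le> y" "y \<le> z" and l: "1 \<le> l" "64 * K * y ^ l \<le> z ^ l" and K: "0 \<le> K"
    and W0: "\<And>m. 0 \<le> W m" and m: "1 \<le> m"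
  shows "W m \<le> 8 * K * z ^ m"
  using m
proof (induction m rule: less_induct)
  case (less m)
  show ?case
  proof (cases "m \<le> l")
    case True
    have "8 * b m \<le> 8 * (K * y ^ m)" using b[of m] by simp
    also have "\<dots> \<le> 8 * (K * z ^ m)" using y K power_mono[of y z m] by (simp add: mult_left_mono)
    finally show ?thesis using short[OF less.prems True] by simp
  next
    case False
    then have m: "1 \<le> m - l" "m - l < m" "l + (m - l) = m" using l by auto
    have "W m \<le> 64 * b l * W (m - l)" using long[OF m(1)] m(3) by simp
    also have "\<dots> \<le> 64 * (K * y ^ l) * W (m - l)" using b[of l] W0 by (intro mult_right_mono) auto
    also have "\<dots> \<le> z ^ l * W (m - l)" using l(2) W0 by (intro mult_right_mono) auto
    also have "\<dots> \<le> z ^ l * (8 * K * z ^ (m - l))" using less.IH[OF m(2,1)] y by (intro mult_left_mono) auto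
    also have "\<dots> = 8 * K * z ^ m" using m(3) by (metis mult.assoc mult.left_commute power_add)
    finally show ?thesis .
  qed
qed

section \<open>Counting by length\<close>

definition level :: "cperm set \<Rightarrow> nat \<Rightarrow> cperm set" where
  "level C n = {\<pi> \<in> C. clength \<pi> = n}"

lemma finite_level: "C \<subseteq> cperms \<Longrightarrow> finite (level C n)"
  using finite_cperms_clength[of n] by (rule rev_finite_subset) (auto simp: level_def)

lemma card_level_mult_le:
  assumes C: "C \<subseteq> cperms" "box_closed C"
  shows "card (level C n) * card (level C m) \<le> (n + 1) * card (level C (n + m))"
proof -
  let ?f = "\<lambda>(\<sigma>, \<tau>). (snd \<sigma>, \<sigma> \<boxplus> \<tau>)"
  have "inj_on ?f (level C n \<times> level C m)"
  proof (rule inj_onI, clarify)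
    fix \<sigma> \<tau> \<sigma>' \<tau>' :: cperm
    assume *: "\<sigma> \<in> level C n" "\<tau> \<in> level C m" "\<sigma>' \<in> level C n" "\<tau>' \<in> level C m"
      "snd \<sigma> = snd \<sigma>'" "\<sigma> \<boxplus> \<tau> = \<sigma>' \<boxplus> \<tau>'"
    then have "\<sigma> \<in> cperms" "\<tau> \<in> cperms" "\<sigma>' \<in> cperms" "\<tau>' \<in> cperms" "clength \<sigma> = clength \<sigma>'"
      using C(1) by (auto simp: level_def)
    then show "\<sigma> = \<sigma>' \<and> \<tau> = \<tau>'" using box_sum_inject *(5,6) by blast
  qed
  moreover have "?f ` (level C n \<times> level C m) \<subseteq> {..<n + 1} \<times> level C (n + m)"
  proof (rule image_subsetI)
    fix x assume "x \<in> level C n \<times> level C m"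
    then obtain \<sigma> \<tau> where x: "x = (\<sigma>, \<tau>)" and "\<sigma> \<in> level C n" "\<tau> \<in> level C m" by blast
    then have c: "\<sigma> \<in> cperms" "\<tau> \<in> cperms" "\<sigma> \<in> C" "\<tau> \<in> C" "clength \<sigma> = n" "clength \<tau> = m"
      using C(1) by (auto simp: level_def)
    then have "snd \<sigma> \<in> {..<n + 1}" using cpermsD(2)[OF c(1)] by (simp add: clength_def)
    moreover have "\<sigma> \<boxplus> \<tau> \<in> level C (n + m)"
      using c C(2) clength_box_sum[OF c(1,2)] by (simp add: level_def box_closed_def)
    ultimately show "?f x \<in> {..<n + 1} \<times> level C (n + m)" by (simp add: x)
  qed
  moreover have "finite ({..<n + 1} \<times> level C (n + m))" using finite_level[OF C(1)] by simp
  ultimately have "card (level C n \<times> level C m) \<le> card ({..<n + 1} \<times> level C (n + m))"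
    by (rule card_inj_on_le)
  then show ?thesis by (simp add: card_cartesian_product)
qed

lemma underlying_length:
  assumes "\<pi> \<in> cperms"
  shows "length (underlying \<pi>) = clength \<pi>"
  using cpermsD(2)[OF assms] by (simp add: underlying_def clength_def)

text \<open>Once the value of the origin is known, so is the set of the remaining values, and
  standardisation is the rank function on that set, hence injective there. The position of the
  origin says where to reinsert it.\<close>

lemma underlying_inject:
  assumes c: "\<pi> \<in> cperms" "\<sigma> \<in> cperms" and l: "clength \<pi> = clength \<sigma>" and u: "underlying \<pi> = underlying \<sigma>"
    and s: "snd \<pi> = snd \<sigma>" and v: "fst \<pi> ! snd \<pi> = fst \<sigma> ! snd \<sigma>"
  shows "\<pi> = \<sigma>"
proof -
  define a where "a = snd \<pi>"
  define m where "m = fst \<pi> ! a"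
  define N where "N = length (fst \<pi>)"
  define rest where "rest = (\<lambda>xs :: nat list. take a xs @ drop (Suc a) xs)"
  have N: "length (fst \<sigma>) = N"
    using l cpermsD(2)[OF c(1)] cpermsD(2)[OF c(2)] by (simp add: clength_def N_def)
  have aN: "a < N" using cpermsD(2)[OF c(1)] by (simp add: a_def N_def)
  have split: "xs = take a xs @ xs ! a # drop (Suc a) xs" if "a < length xs" for xs :: "nat list"
    using that by (rule id_take_nth_drop)
  have set_rest: "set (rest xs) = {..<N} - {m}" if "xs \<in> perms" "length xs = N" "xs ! a = m" for xs
  proof -
    have "set xs = insert m (set (rest xs))" "m \<notin> set (rest xs)"
      using arg_cong[OF split[of xs], of set] arg_cong[OF split[of xs], of distinct] permsD(1)[OF that(1)] aN that
      by (auto simp: rest_def)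
    then show ?thesis using permsD(2)[OF that(1)] that(2) by auto
  qed
  have sets: "set (rest (fst \<pi>)) = {..<N} - {m}" "set (rest (fst \<sigma>)) = {..<N} - {m}"
    using set_rest cpermsD(1)[OF c(1)] cpermsD(1)[OF c(2)] N s v by (simp_all add: N_def m_def a_def)
  let ?F = "\<lambda>x. card {y \<in> {..<N} - {m}. y < x}"
  have "standardise (rest (fst \<pi>)) = standardise (rest (fst \<sigma>))"
    using u s by (simp add: underlying_def rest_def a_def)
  then have "map ?F (rest (fst \<pi>)) = map ?F (rest (fst \<sigma>))"
    unfolding standardise_def sets .
  moreover have "?F x < ?F y" if "x < y" "x \<in> {..<N} - {m}" for x y
    using that by (intro psubset_card_mono psubsetI) auto
  then have "inj_on ?F ({..<N} - {m})"
    by (intro linorder_inj_onI) (auto simp: neq_iff)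
  ultimately have "rest (fst \<pi>) = rest (fst \<sigma>)"
    using map_inj_on[of ?F "rest (fst \<pi>)" "rest (fst \<sigma>)"] unfolding sets Un_absorb by blast
  then have "take a (fst \<pi>) = take a (fst \<sigma>)" "drop (Suc a) (fst \<pi>) = drop (Suc a) (fst \<sigma>)"
    using N aN by (simp_all add: rest_def N_def append_eq_append_conv)
  moreover have "fst \<pi> ! a = fst \<sigma> ! a" using v s by (simp add: a_def)
  ultimately have "fst \<pi> = fst \<sigma>"
    using split[OF aN[unfolded N_def]] split[OF aN[folded N]] by metis
  then show ?thesis using s by (simp add: prod_eq_iff)
qed

text \<open>The two factors \<open>n + 1\<close> stand for the position and the value of the deleted
  origin.\<close>

lemma card_level_underlying:
  assumes C: "C \<subseteq> cperms"
  shows "card {xs \<in> underlying_class C. length xs = n} \<le> card (level C n)"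
    and "card (level C n) \<le> (n + 1) ^ 2 * card {xs \<in> underlying_class C. length xs = n}"
proof -
  let ?U = "{xs \<in> underlying_class C. length xs = n}"
  have U: "?U = underlying ` level C n"
    using underlying_length C by (fastforce simp: underlying_class_def level_def)
  then show "card ?U \<le> card (level C n)" using card_image_le[OF finite_level[OF C]] by metis
  let ?f = "\<lambda>\<pi>. (snd \<pi>, fst \<pi> ! snd \<pi>, underlying \<pi>)"
  have fin: "finite ?U" unfolding U using finite_level[OF C] by simp
  have "inj_on ?f (level C n)"
  proof (rule inj_onI)
    fix \<pi> \<sigma> assume *: "\<pi> \<in> level C n" "\<sigma> \<in> level C n" "?f \<pi> = ?f \<sigma>"
    then have "\<pi> \<in> cperms" "\<sigma> \<in> cperms" "clength \<pi> = clength \<sigma>" using C by (auto simp: level_def)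
    then show "\<pi> = \<sigma>" using *(3) by (intro underlying_inject) auto
  qed
  moreover have "?f ` level C n \<subseteq> {..<n + 1} \<times> {..<n + 1} \<times> ?U"
  proof (rule image_subsetI)
    fix \<pi> assume \<pi>: "\<pi> \<in> level C n"
    then have c: "\<pi> \<in> cperms" "clength \<pi> = n" using C by (auto simp: level_def)
    then have l: "length (fst \<pi>) = n + 1" "snd \<pi> < n + 1" using cpermsD(2)[OF c(1)] by (auto simp: clength_def)
    moreover have "fst \<pi> ! snd \<pi> < n + 1"
      using permsD(2)[OF cpermsD(1)[OF c(1)]] nth_mem[of "snd \<pi>" "fst \<pi>"] l by auto
    ultimately show "?f \<pi> \<in> {..<n + 1} \<times> {..<n + 1} \<times> ?U" using \<pi> U by auto
  qed
  ultimately have "card (level C n) \<le> card ({..<n + 1} \<times> {..<n + 1} \<times> ?U)"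
    using fin by (intro card_inj_on_le) auto
  then show "card (level C n) \<le> (n + 1) ^ 2 * card ?U"
    by (simp add: card_cartesian_product power2_eq_square algebra_simps)
qed

section \<open>Runs of indices and the box-interior\<close>

lemma UNIV_pin_letter:
  "UNIV = set [Numeral Q1, Numeral Q2, Numeral Q3, Numeral Q4, Dir U, Dir D, Dir L, Dir R]"
proof -
  have "x \<in> set [Numeral Q1, Numeral Q2, Numeral Q3, Numeral Q4, Dir U, Dir D, Dir L, Dir R]" for x
  proof (cases x)
    case (Numeral q)
    then show ?thesis by (cases q) auto
  next
    case (Dir d)
    then show ?thesis by (cases d) auto
  qed
  then show ?thesis by blast
qed

lemma finite_pin_letters: "finite (UNIV :: pin_letter set)"
  unfolding UNIV_pin_letter by (rule finite_set)

text \<open>The source of every factor 8 in the counts below: one recorded letter.\<close>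

lemma card_pin_letters: "card (UNIV :: pin_letter set) \<le> 8"
  unfolding UNIV_pin_letter by (rule order_trans[OF card_length]) simp

text \<open>The run stops just before the least index \<open>k > i\<close> outside \<open>A\<close>.
  With \<open>j = k - 1\<close> the rest starts at \<open>j + 2\<close> or later, which is exactly
  the gap that makes two sets of pins uncut.\<close>

lemma first_run:
  fixes A :: "nat set"
  assumes "finite A" "A \<noteq> {}"
  obtains i j A' where "i \<le> j" "A = {i..j} \<union> A'" "\<And>a. a \<in> A' \<Longrightarrow> j + 2 \<le> a" "i = Min A"
proof -
  define i where "i = Min A"
  have i: "i \<in> A" "\<And>a. a \<in> A \<Longrightarrow> i \<le> a" using assms by (auto simp: i_def)
  have "\<exists>k>i. k \<notin> A" 
  proof (intro exI conjI)
    show "i < Suc (Max A)" using Max_ge[OF assms(1) i(1)] by simp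
    show "Suc (Max A) \<notin> A" using Max_ge[OF assms(1), of "Suc (Max A)"] by auto
  qed
  define k where "k = (LEAST k. i < k \<and> k \<notin> A)"
  have k: "i < k" "k \<notin> A" using LeastI_ex[OF \<open>\<exists>k>i. k \<notin> A\<close>] by (auto simp: k_def)
  have kA: "a \<in> A" if "i \<le> a" "a < k" for a
    using not_less_Least[of a "\<lambda>k. i < k \<and> k \<notin> A"] that i(1) by (cases "a = i") (auto simp: k_def)
  show thesis
  proof
    show "i \<le> k - 1" using k by simp
    show "A = {i..k - 1} \<union> {a \<in> A. k < a}"
    proof (intro equalityI subsetI)
      fix a assume "a \<in> A"
      then show "a \<in> {i..k - 1} \<union> {a \<in> A. k < a}" using i(2)[of a] k by (cases "a = k") auto
    qed (use kA k in auto)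
    show "k - 1 + 2 \<le> a" if "a \<in> {a \<in> A. k < a}" for a using that k by simp
  qed (rule i_def)
qed

text \<open>The centred permutation of length 0 lies below every other one, hence in every centred
  class; this keeps intersections of classes non-empty.\<close>

lemma single_contained:
  assumes "\<sigma> \<in> cperms"
  shows "ccontained ([0], 0) \<sigma>"
  unfolding ccontained_def embedding_def using cpermsD(2)[OF assms]
  by (intro exI[of _ "\<lambda>_. snd \<sigma>"]) (auto simp: strict_mono_on_def)

lemma single_in_cperms: "([0], 0) \<in> cperms"
  by (auto simp: cperms_def perms_def)

text \<open>The class \<open>E\<close> shows that the family being intersected is non-empty; the
  intersection of an empty family would be the universal set. It also bounds the closure from
  above.\<close>

lemma box_closure_properties:
  assumes "centred_class E" "box_closed E" "S \<subseteq> E"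
  shows "centred_class (box_closure S)" "box_closed (box_closure S)" "S \<subseteq> box_closure S" "box_closure S \<subseteq> E"
proof -
  define F where "F = {C. centred_class C \<and> box_closed C \<and> S \<subseteq> C}"
  have F: "box_closure S = \<Inter> F" "E \<in> F" using assms by (simp_all add: box_closure_def F_def)
  have down: "\<pi> \<in> C" if "C \<in> F" "\<sigma> \<in> C" "\<pi> \<in> cperms" "ccontained \<pi> \<sigma>" for C \<sigma> \<pi>
    using that unfolding F_def centred_class_def by blast
  have "([0], 0) \<in> C" if C: "C \<in> F" for C
  proof -
    obtain \<sigma> where "\<sigma> \<in> C" "\<sigma> \<in> cperms" using C unfolding F_def centred_class_def by blast
    then show ?thesis using down[OF C] single_contained single_in_cperms by blast
  qed
  then have "\<Inter> F \<noteq> {}" by blast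
  moreover have "E \<subseteq> cperms" using assms(1) by (simp add: centred_class_def)
  then have "\<Inter> F \<subseteq> cperms" using F(2) by blast
  moreover have "\<pi> \<in> \<Inter> F" if "\<sigma> \<in> \<Inter> F" "\<pi> \<in> cperms" "ccontained \<pi> \<sigma>" for \<sigma> \<pi>
    using that down by (meson InterE InterI)
  ultimately show "centred_class (box_closure S)"
    unfolding F(1) centred_class_def by (intro conjI ballI impI)
  show "box_closed (box_closure S)" unfolding F(1) box_closed_def by (auto simp: F_def box_closed_def)
  show "S \<subseteq> box_closure S" unfolding F(1) by (auto simp: F_def)
  show "box_closure S \<subseteq> E" unfolding F(1) using F(2) by blast
qed

definition recurrent_beyond :: "(nat \<Rightarrow> pin_letter) \<Rightarrow> nat \<Rightarrow> nat \<Rightarrow> bool" where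
  "recurrent_beyond w N l \<longleftrightarrow>
     (\<forall>i j. N \<le> i \<longrightarrow> i \<le> j \<longrightarrow> j < i + l \<longrightarrow> recurrent_pin_factor w (pin_factor w i j))"

context
  fixes w :: "nat \<Rightarrow> pin_letter"
  assumes w: "infinite_pin_word w"
begin

private abbreviation P :: "nat \<Rightarrow> point" where "P \<equiv> pin_path w"

section \<open>Cuts in the pin sequence of an infinite word\<close>

lemma general_position_pin_path: "general_position P A"
proof -
  have "fst (P i) \<noteq> fst (P j) \<and> snd (P i) \<noteq> snd (P j)" if "i \<noteq> j" for i j
  proof -
    let ?n = "Suc (max i j)"
    have "pin_sequence (prefix_word w ?n) P" using pin_sequence_pin_path[OF w] by blast
    from pin_sequence_unique[OF this this] show ?thesis
      using that unfolding same_order_def by (simp add: le_SucI)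
  qed
  then show ?thesis unfolding general_position_def inj_on_def comp_def by blast
qed

lemma letter_dir: "1 \<le> k \<Longrightarrow> \<exists>d. w k = Dir d"
  using w pin_wordD(3)[of "prefix_word w (Suc k)" k] by (simp add: infinite_pin_word_def)

lemma pin_path_step:
  assumes "1 \<le> k" "w k = Dir d"
  shows "j \<le> k \<Longrightarrow> beyond d (P (Suc k)) (P j)"
    and "separates (other_coord d (P (Suc k))) (other_coord d (P k)) ((\<lambda>j. other_coord d (P j)) ` {..<k})"
  using pin_sequenceD(2,3)[OF pin_sequence_pin_path[OF w, of "Suc k"], of k d] assms by simp_all

text \<open>Point \<open>j\<close> separates point \<open>j - 1\<close> from all earlier ones. Since
  \<open>i \<le> j - 2\<close>, both the origin and point \<open>i\<close> are among the latter, so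
  they lie on the same side of point \<open>j\<close> in one coordinate; in the other, point
  \<open>j\<close> is beyond both.\<close>

lemma uncut_gap:
  assumes "\<And>i j. i \<in> A\<^sub>1 \<Longrightarrow> j \<in> A\<^sub>2 \<Longrightarrow> i + 2 \<le> j"
  shows "uncut P A\<^sub>1 A\<^sub>2"
  unfolding uncut_def
proof (intro ballI)
  fix i j assume "i \<in> A\<^sub>1" "j \<in> A\<^sub>2"
  then have ij: "i + 2 \<le> j" using assms by blast
  define k where "k = j - 1"
  have k: "1 \<le> k" "i < k" "j = Suc k" using ij by (auto simp: k_def)
  obtain d where d: "w k = Dir d" using letter_dir[OF k(1)] by blast
  have b: "beyond d (P j) (P i)" "beyond d (P j) (P 0)" using pin_path_step(1)[OF k(1) d] k by auto
  have "other_coord d (P j) < other_coord d (P i) \<longleftrightarrow> other_coord d (P j) < other_coord d (P 0)"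
  proof -
    have "i \<in> {..<k}" "0 \<in> {..<k}" using k by auto
    then have "(other_coord d (P j) < other_coord d (P i) \<and> other_coord d (P j) < other_coord d (P 0)) \<or>
        (other_coord d (P i) < other_coord d (P j) \<and> other_coord d (P 0) < other_coord d (P j))"
      using pin_path_step(2)[OF k(1) d] unfolding separates_def k(3) by blast
    then show ?thesis by linarith
  qed
  then show "(fst (P j) < fst (P i) \<longleftrightarrow> fst (P j) < fst (P 0)) \<and> (snd (P j) < snd (P i) \<longleftrightarrow> snd (P j) < snd (P 0))"
    using b by (cases d) (auto simp: other_coord_def)
qed

text \<open>Point \<open>i + 1\<close> separates point \<open>i\<close> from the origin, so it cuts
  their rectangle. For \<open>1 \<le> i\<close> the origin is indeed one of the points being
  separated from.\<close>

lemma cut_next: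
  assumes "1 \<le> i" "i \<in> A\<^sub>1" "uncut P A\<^sub>1 A\<^sub>2"
  shows "Suc i \<notin> A\<^sub>2"
proof
  assume "Suc i \<in> A\<^sub>2"
  obtain d where d: "w i = Dir d" using letter_dir[OF assms(1)] by blast
  have "other_coord d (P (Suc i)) < other_coord d (P i) \<longleftrightarrow> other_coord d (P (Suc i)) < other_coord d (P 0)"
    using assms(2,3) \<open>Suc i \<in> A\<^sub>2\<close> unfolding uncut_def other_coord_def by simp
  moreover have "0 \<in> {..<i}" using assms(1) by simp
  then have "(other_coord d (P i) < other_coord d (P (Suc i)) \<and> other_coord d (P (Suc i)) < other_coord d (P 0)) \<or>
      (other_coord d (P (Suc i)) < other_coord d (P i) \<and> other_coord d (P 0) < other_coord d (P (Suc i)))"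
    using pin_path_step(2)[OF assms(1) d] unfolding separates_def by blast
  ultimately show False by linarith
qed

text \<open>The lower indices form the inner summand: later pins leave the rectangles of the earlier
  ones uncut, not conversely.\<close>

lemma cpt_gap_sum:
  assumes "finite A\<^sub>1" "finite A\<^sub>2" "0 \<notin> A\<^sub>1" "\<And>i j. i \<in> A\<^sub>1 \<Longrightarrow> j \<in> A\<^sub>2 \<Longrightarrow> i + 2 \<le> j" "0 \<notin> A\<^sub>2"
  shows "cpt P (A\<^sub>1 \<union> A\<^sub>2) = cpt P A\<^sub>1 \<boxplus> cpt P A\<^sub>2"
proof (rule cpt_Un)
  show "A\<^sub>1 \<inter> A\<^sub>2 = {}" using assms(4) by fastforce
qed (use assms uncut_gap general_position_pin_path in auto)

section \<open>Pin factors as intervals of indices\<close>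

lemma in_quadrant_pin_quadrant:
  assumes "1 \<le> i"
  shows "in_quadrant (pin_quadrant w i) (P 0) (P i)"
proof -
  define p where "p = pin_points (prefix_word w i)"
  have ps: "pin_sequence (prefix_word w i) P" using pin_sequence_pin_path[OF w] assms by simp
  then have pp: "pin_sequence (prefix_word w i) p"
    using pin_sequence_pin_points by (auto simp: p_def pin_sequence_def)
  have iff: "in_quadrant q (p 0) (p i) \<longleftrightarrow> in_quadrant q (P 0) (P i)" for q
    using pin_sequence_unique[OF pp ps] unfolding same_order_def by (cases q) auto
  have "fst (P i) \<noteq> fst (P 0)" "snd (P i) \<noteq> snd (P 0)"
    using general_position_pin_path[of "{i}"] assms by (auto simp: general_position_def inj_on_def)
  then have "\<exists>q. in_quadrant q (P 0) (P i)"
    by (metis in_quadrant.simps linorder_neqE)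
  then have "\<exists>!q. in_quadrant q (p 0) (p i)" using iff in_quadrant_unique by blast
  then have "in_quadrant (THE q. in_quadrant q (p 0) (p i)) (p 0) (p i)" by (rule theI')
  then show ?thesis by (simp add: pin_quadrant_def p_def[symmetric] iff)
qed

lemma pin_factor_length:
  assumes "1 \<le> i" "i \<le> j"
  shows "length (pin_factor w i j) = Suc j - i"
  using assms by (auto simp: pin_factor_def)

lemma pin_factor_nth:
  assumes "1 \<le> i" "1 \<le> k" "i + k \<le> j"
  shows "pin_factor w i j ! k = w (i + k - 1)"
proof -
  obtain k' where "k = Suc k'" using assms(2) by (cases k) auto
  then show ?thesis using assms by (cases "i = 1") (auto simp: pin_factor_def)
qed

lemma pin_factor_hd:
  assumes "1 \<le> i" "i \<le> j"
  obtains q where "pin_factor w i j ! 0 = Numeral q" "in_quadrant q (P 0) (P i)"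
proof (cases "i = 1")
  case True
  obtain q where q: "w 0 = Numeral q"
    using w pin_wordD(1)[of "prefix_word w 1"] by (auto simp: infinite_pin_word_def)
  then have "in_quadrant q (P 0) (P 1)"
    using pin_sequenceD(1)[OF pin_sequence_pin_path[OF w, of 1], of q] by simp
  then show thesis using that q True assms by (simp add: pin_factor_def)
next
  case False
  then show thesis using that in_quadrant_pin_quadrant[OF assms(1)] assms by (simp add: pin_factor_def)
qed

text \<open>Points 1 to \<open>i - 1\<close> are dropped and the origin is kept. The letter that
  placed point \<open>i\<close> referred to dropped points, and only the quadrant of point
  \<open>i\<close> survives from it; all later letters remain valid.\<close>

lemma pin_sequence_pin_factor:
  assumes ij: "1 \<le> i" "i \<le> j"
  shows "pin_sequence (pin_factor w i j) (\<lambda>k. if k = 0 then P 0 else P (i + k - 1))"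
    (is "pin_sequence ?v ?Q")
proof -
  obtain q where q: "?v ! 0 = Numeral q" "in_quadrant q (P 0) (P i)" using pin_factor_hd[OF ij] .
  have len: "length ?v = Suc j - i" using pin_factor_length[OF ij] .
  have nth: "?v ! k = w (i + k - 1)" if "1 \<le> k" "k < length ?v" for k
    using pin_factor_nth[OF ij(1) that(1)] that len by simp
  have "pin_word ?v"
    unfolding pin_word_def
  proof (intro conjI allI impI)
    show "?v \<noteq> []" using len ij by auto
    show "?v ! 0 \<in> range Numeral" using q by simp
    show "?v ! k \<in> range Dir" if "0 < k \<and> k < length ?v" for k
    proof -
      have "1 \<le> i + k - 1" using conjunct1[OF that] ij by linarith
      then obtain d where "w (i + k - 1) = Dir d" using letter_dir by blast
      then show ?thesis using nth[of k] that by simp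
    qed
    fix k d e assume k: "Suc k < length ?v \<and> ?v ! k = Dir d \<and> ?v ! Suc k = Dir e"
    then have "k \<noteq> 0" using q by (intro notI) simp
    then have "w (i + k - 1) = Dir d" "w (Suc (i + k - 1)) = Dir e"
      using nth[of k] nth[of "Suc k"] k ij by auto
    then show "vertical d \<noteq> vertical e"
      using w pin_wordD(4)[of "prefix_word w (i + k + 1)" "i + k - 1" d e] ij
      by (simp add: infinite_pin_word_def)
  qed
  moreover have "(\<forall>l<k. beyond d (?Q k) (?Q l)) \<and>
        separates (other_coord d (?Q k)) (other_coord d (?Q (k - 1))) ((\<lambda>l. other_coord d (?Q l)) ` {..k - 2})"
    if "k \<in> {2..length ?v}" and d: "?v ! (k - 1) = Dir d" for k d
  proof -
    obtain m where m: "k = Suc (Suc m)" using \<open>k \<in> _\<close> by (metis Suc_le_D atLeastAtMost_iff numeral_2_eq_2 Suc_le_mono)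
    have im: "1 \<le> i + m" and wd: "w (i + m) = Dir d"
      using ij nth[of "Suc m"] d that(1) m by auto
    have "beyond d (?Q k) (?Q l)" if "l < k" for l
      using pin_path_step(1)[OF im wd, of "if l = 0 then 0 else i + l - 1"] that m by auto
    \<comment> \<open>Dropping points only shrinks the set to be separated from, so separation is
      inherited from the whole path.\<close>
    moreover have "(\<lambda>l. other_coord d (?Q l)) ` {..k - 2} \<subseteq> (\<lambda>j. other_coord d (P j)) ` {..<i + m}"
    proof
      fix x assume "x \<in> (\<lambda>l. other_coord d (?Q l)) ` {..k - 2}"
      then obtain l where "l \<le> m" "x = other_coord d (?Q l)" using m by auto
      then have "x = other_coord d (P (if l = 0 then 0 else i + l - 1))" "(if l = 0 then 0 else i + l - 1) < i + m"
        using ij by auto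
      then show "x \<in> (\<lambda>j. other_coord d (P j)) ` {..<i + m}" by blast
    qed
    then have "separates (other_coord d (?Q k)) (other_coord d (?Q (k - 1))) ((\<lambda>l. other_coord d (?Q l)) ` {..k - 2})"
      using pin_path_step(2)[OF im wd] m unfolding separates_def by auto
    ultimately show ?thesis by blast
  qed
  moreover have "in_quadrant q' (?Q 0) (?Q 1)" if "?v ! 0 = Numeral q'" for q'
    using q that by simp
  ultimately show ?thesis unfolding pin_sequence_def by blast
qed

lemma pin_word_pin_factor: "1 \<le> i \<Longrightarrow> i \<le> j \<Longrightarrow> pin_word (pin_factor w i j)"
  using pin_sequence_pin_factor by (auto simp: pin_sequence_def)

lemma pin_cperm_pin_factor:
  assumes ij: "1 \<le> i" "i \<le> j"
  shows "pin_cperm (pin_factor w i j) = cpt P {i..j}"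
proof -
  let ?Q = "\<lambda>k. if k = 0 then P 0 else P (i + k - 1)" and ?\<phi> = "\<lambda>k. if k = 0 then 0 else i + k - 1"
  note ps = pin_sequence_pin_factor[OF ij] and len = pin_factor_length[OF ij]
  have "inj_on ?\<phi> (insert 0 {1..Suc j - i})" using ij by (auto simp: inj_on_def)
  moreover have "?\<phi> ` insert 0 {1..Suc j - i} = insert 0 {i..j}"
  proof (intro equalityI subsetI)
    fix x assume "x \<in> insert 0 {i..j}"
    then show "x \<in> ?\<phi> ` insert 0 {1..Suc j - i}"
    proof
      assume "x \<in> {i..j}"
      then have "x = ?\<phi> (Suc x - i)" "Suc x - i \<in> {1..Suc j - i}" by auto
      then show ?thesis by blast
    qed simp
  qed (use ij in auto)
  ultimately have "order_iso ?\<phi> ?Q {1..Suc j - i} P {i..j}"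
    unfolding order_iso_def bij_betw_def by auto
  then have "cpt ?Q {1..Suc j - i} = cpt P {i..j}"
    using cpt_order_iso[OF _ finite_atLeastAtMost pin_sequence_general_position[OF ps, unfolded len]
        finite_atLeastAtMost general_position_pin_path] by blast
  then show ?thesis using pin_cperm_eq_cpt[OF ps] len by simp
qed

section \<open>The pin class and the box-interior in terms of index sets\<close>

lemma pin_cperm_prefix_word: "0 < n \<Longrightarrow> pin_cperm (prefix_word w n) = cpt P {1..n}"
  using pin_cperm_eq_cpt[OF pin_sequence_pin_path[OF w]] by simp

lemma centred_pin_class_eq: "centred_pin_class w = cpt P ` {A. finite A \<and> 0 \<notin> A}"
proof (intro equalityI subsetI)
  fix \<pi> assume "\<pi> \<in> centred_pin_class w"
  then obtain n where n: "\<pi> \<in> cperms" "0 < n" "ccontained \<pi> (cpt P {1..n})"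
    by (auto simp: centred_pin_class_def pin_cperm_prefix_word)
  then obtain B where "B \<subseteq> {1..n}" "\<pi> = cpt P B"
    using cpt_contained_iff[OF _ general_position_pin_path] by auto
  then show "\<pi> \<in> cpt P ` {A. finite A \<and> 0 \<notin> A}"
    using finite_subset[of B "{1..n}"] by force
next
  fix \<pi> assume "\<pi> \<in> cpt P ` {A. finite A \<and> 0 \<notin> A}"
  then obtain A where A: "finite A" "0 \<notin> A" "\<pi> = cpt P A" by blast
  \<comment> \<open>\<open>Suc\<close> keeps the prefix length positive, also when \<open>A\<close>
    is empty.\<close>
  have "A \<subseteq> {1..Suc (Max A)}"
    using A Max_ge[of A] by (force simp: Suc_le_eq le_SucI intro: gr0I)
  then have "ccontained \<pi> (cpt P {1..Suc (Max A)})"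
    using cpt_contained_iff[OF _ general_position_pin_path, of "{1..Suc (Max A)}" \<pi>] A
      cpt_in_cperms[OF A(1) general_position_pin_path] by auto
  then show "\<pi> \<in> centred_pin_class w"
    using A cpt_in_cperms[OF A(1) general_position_pin_path] pin_cperm_prefix_word[of "Suc (Max A)"]
    unfolding centred_pin_class_def by (intro CollectI conjI exI[of _ "Suc (Max A)"]) simp_all
qed

text \<open>An upper bound for the box-interior, made of the centred permutations that occur
  arbitrarily far out. It is box-closed because a copy of the second summand can always be found
  beyond a copy of the first, and taking \<open>N = 1\<close> places it inside the centred pin
  class.\<close>

definition recurrent_class :: "cperm set" where
  "recurrent_class = {\<pi>. \<forall>N\<ge>1. \<exists>A. finite A \<and> A \<subseteq> {N..} \<and> \<pi> = cpt P A}"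

lemma centred_class_recurrent_class: "centred_class recurrent_class"
  unfolding centred_class_def
proof (intro conjI ballI impI)
  have "cpt P {} \<in> recurrent_class" unfolding recurrent_class_def by blast
  then show "recurrent_class \<noteq> {}" by blast
  show "recurrent_class \<subseteq> cperms"
    using cpt_in_cperms[OF _ general_position_pin_path] unfolding recurrent_class_def by blast
  fix \<sigma> \<pi> assume \<sigma>: "\<sigma> \<in> recurrent_class" and \<pi>: "\<pi> \<in> cperms" "ccontained \<pi> \<sigma>"
  show "\<pi> \<in> recurrent_class"
    unfolding recurrent_class_def
  proof (intro CollectI allI impI)
    fix N :: nat assume N: "1 \<le> N"
    then obtain A where A: "finite A" "A \<subseteq> {N..}" "\<sigma> = cpt P A"
      using \<sigma> unfolding recurrent_class_def by blast
    then have "0 \<notin> A" using N by auto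
    then obtain B where "B \<subseteq> A" "\<pi> = cpt P B"
      using cpt_contained_iff[OF A(1) general_position_pin_path _ \<pi>(1)] \<pi>(2) A(3) by blast
    then show "\<exists>A. finite A \<and> A \<subseteq> {N..} \<and> \<pi> = cpt P A"
      using A(1,2) finite_subset[of B A] by (intro exI[of _ B]) auto
  qed
qed

lemma box_closed_recurrent_class: "box_closed recurrent_class"
  unfolding box_closed_def
proof (intro ballI)
  fix \<sigma> \<tau> assume \<sigma>: "\<sigma> \<in> recurrent_class" and \<tau>: "\<tau> \<in> recurrent_class"
  show "\<sigma> \<boxplus> \<tau> \<in> recurrent_class"
    unfolding recurrent_class_def
  proof (intro CollectI allI impI)
    fix N :: nat assume N: "1 \<le> N"
    then obtain A where A: "finite A" "A \<subseteq> {N..}" "\<sigma> = cpt P A"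
      using \<sigma> unfolding recurrent_class_def by blast
    \<comment> \<open>Inserting \<open>N\<close> keeps the maximum defined when \<open>A\<close> is
      empty, and 2 is the gap needed for a box sum.\<close>
    define M where "M = Max (insert N A) + 2"
    have "1 \<le> M" by (simp add: M_def)
    then obtain B where B: "finite B" "B \<subseteq> {M..}" "\<tau> = cpt P B"
      using \<tau> unfolding recurrent_class_def by blast
    have "i + 2 \<le> M" if "i \<in> A" for i using A(1) that by (simp add: M_def)
    moreover have "N + 2 \<le> M" using A(1) by (simp add: M_def)
    ultimately have "cpt P (A \<union> B) = cpt P A \<boxplus> cpt P B"
      using A B N by (intro cpt_gap_sum) force+
    moreover have "A \<union> B \<subseteq> {N..}" using A(2) B(2) \<open>N + 2 \<le> M\<close> by force
    ultimately show "\<exists>C. finite C \<and> C \<subseteq> {N..} \<and> \<sigma> \<boxplus> \<tau> = cpt P C"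
      using A B by (intro exI[of _ "A \<union> B"]) simp
  qed
qed

lemma recurrent_indecomposables_subset: "recurrent_box_indecomposables w \<subseteq> recurrent_class"
proof
  fix \<pi> assume "\<pi> \<in> recurrent_box_indecomposables w"
  then obtain v where v: "\<pi> = pin_cperm v" "recurrent_pin_factor w v"
    by (auto simp: recurrent_box_indecomposables_def)
  show "\<pi> \<in> recurrent_class"
    unfolding recurrent_class_def
  proof (intro CollectI allI impI)
    fix N :: nat
    obtain i j where "N \<le> i" "1 \<le> i" "i \<le> j" "pin_factor w i j = v"
      using v(2) unfolding recurrent_pin_factor_def by blast
    then show "\<exists>A. finite A \<and> A \<subseteq> {N..} \<and> \<pi> = cpt P A"
      using pin_cperm_pin_factor v(1) by (intro exI[of _ "{i..j}"]) auto
  qed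
qed

lemmas box_interior_properties = box_closure_properties[OF centred_class_recurrent_class
    box_closed_recurrent_class recurrent_indecomposables_subset, folded box_interior_def]

lemma box_interior_subset_centred_pin_class: "box_interior w \<subseteq> centred_pin_class w"
proof
  fix \<pi> assume "\<pi> \<in> box_interior w"
  then obtain A where "finite A" "A \<subseteq> {1..}" "\<pi> = cpt P A"
    using box_interior_properties(4) unfolding recurrent_class_def by blast
  then show "\<pi> \<in> centred_pin_class w" unfolding centred_pin_class_eq by force
qed

text \<open>There are only finitely many words of length at most \<open>l\<close>, and the starting
  positions of each non-recurrent one are bounded; \<open>N\<close> is taken beyond all these
  bounds.\<close>

lemma eventually_recurrent:
  obtains N where "2 \<le> N" "recurrent_beyond w N l"
proof -
  define V where "V = {v. pin_word v \<and> length v \<le> l \<and> \<not> recurrent_pin_factor w v}"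
  have "finite {v :: pin_letter list. set v \<subseteq> UNIV \<and> length v \<le> l}"
    by (rule finite_lists_length_le[OF finite_pin_letters])
  then have finV: "finite V" by (rule rev_finite_subset) (auto simp: V_def)
  have "\<forall>v\<in>V. \<exists>n. \<forall>i j. n \<le> i \<longrightarrow> 1 \<le> i \<longrightarrow> i \<le> j \<longrightarrow> pin_factor w i j \<noteq> v"
    unfolding V_def recurrent_pin_factor_def by blast
  then obtain n where n: "\<And>v i j. v \<in> V \<Longrightarrow> n v \<le> i \<Longrightarrow> 1 \<le> i \<Longrightarrow> i \<le> j \<Longrightarrow> pin_factor w i j \<noteq> v"
    by metis
  \<comment> \<open>From 2 on, pin factors start with a quadrant numeral, as the cutting of words in
    \<open>card_factor_words_add\<close> requires.\<close>
  define N where "N = Max (insert 2 (n ` V))"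
  have nN: "n v \<le> N" if "v \<in> V" for v using finV that by (simp add: N_def)
  have N2: "2 \<le> N" using finV by (simp add: N_def)
  have "recurrent_pin_factor w (pin_factor w i j)" if ij: "N \<le> i" "i \<le> j" "j < i + l" for i j
  proof (rule ccontr)
    assume "\<not> ?thesis"
    then have V: "pin_factor w i j \<in> V"
      using ij pin_word_pin_factor pin_factor_length N2 by (simp add: V_def)
    show False using n[OF V order_trans[OF nN[OF V] ij(1)] _ ij(2)] N2 ij(1) by simp
  qed
  then show thesis using N2 that by (simp add: recurrent_beyond_def)
qed

lemma empty_in_box_interior: "cpt P {} \<in> box_interior w"
proof -
  obtain \<sigma> where \<sigma>: "\<sigma> \<in> box_interior w"
    using box_interior_properties(1) by (auto simp: centred_class_def)
  then obtain A where "finite A" "A \<subseteq> {1..}" "\<sigma> = cpt P A"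
    using box_interior_properties(4) unfolding recurrent_class_def by blast
  moreover from this have "0 \<notin> A" by auto
  ultimately have "ccontained (cpt P {}) \<sigma>"
    using cpt_contained_iff[OF _ general_position_pin_path] cpt_in_cperms[OF finite.emptyI general_position_pin_path]
    by blast
  then show ?thesis
    using \<sigma> box_interior_properties(1) cpt_in_cperms[OF finite.emptyI general_position_pin_path]
    unfolding centred_class_def by blast
qed

text \<open>A short recurrent factor need not be box-indecomposable. If it decomposes, both summands
  are again short factors starting at or beyond \<open>N\<close>, so induction on the length and box
  closure apply.\<close>

lemma factor_in_box_interior:
  assumes N: "1 \<le> N" "recurrent_beyond w N l"
    and "N \<le> i" "i \<le> j" "j < i + l"
  shows "cpt P {i..j} \<in> box_interior w"
  using assms(3-5)
proof (induction "j - i" arbitrary: i j rule: less_induct)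
  case less
  note gp = general_position_pin_path
  have i1: "1 \<le> i" using less.prems N(1) by simp
  have eq: "pin_cperm (pin_factor w i j) = cpt P {i..j}" using pin_cperm_pin_factor i1 less.prems by simp
  show ?case
  proof (cases "box_indecomposable (cpt P {i..j})")
    case True
    then have "cpt P {i..j} \<in> recurrent_box_indecomposables w"
      using N(2) less.prems eq unfolding recurrent_beyond_def recurrent_box_indecomposables_def by force
    then show ?thesis using box_interior_properties(3) by blast
  next
    case False
    have card: "clength (cpt P {i..j}) = card {i..j}" using clength_cpt[OF _ gp] i1 by simp
    then obtain \<sigma> \<tau> where st: "\<sigma> \<in> cperms" "\<tau> \<in> cperms" "clength \<sigma> < card {i..j}" "clength \<tau> < card {i..j}"
      "cpt P {i..j} = \<sigma> \<boxplus> \<tau>"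
      using False less.prems cpt_in_cperms[OF _ gp, of "{i..j}"] unfolding box_indecomposable_def by auto
    obtain f where "represents f (\<sigma> \<boxplus> \<tau>) P {i..j}" using represents_cpt[OF _ gp, of "{i..j}"] st(5) by auto
    then obtain A\<^sub>1 A\<^sub>2 where A: "{i..j} = A\<^sub>1 \<union> A\<^sub>2" "A\<^sub>1 \<inter> A\<^sub>2 = {}" "A\<^sub>1 \<noteq> {}" "A\<^sub>2 \<noteq> {}" "uncut P A\<^sub>1 A\<^sub>2"
      using represents_box_sum_split[OF _ st(1,2) _ st(3,4)] i1 by (metis atLeastAtMost_iff not_one_le_zero le_trans)
    have fin: "finite A\<^sub>1" "finite A\<^sub>2" using A(1) by (metis finite_Un finite_atLeastAtMost)+
    define k where "k = Min A\<^sub>1"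
    have k: "k \<in> A\<^sub>1" "\<And>a. a \<in> A\<^sub>1 \<Longrightarrow> k \<le> a" using fin A(3) by (auto simp: k_def)
    \<comment> \<open>Point \<open>a + 1\<close> cuts the rectangle of point \<open>a\<close>, so it
      cannot belong to the outer summand. The inner summand is therefore a final segment of the
      interval, and the outer one an initial segment.\<close>
    have suc: "Suc a \<in> A\<^sub>1" if "a \<in> A\<^sub>1" "a < j" for a
    proof -
      have "i \<le> a" using that(1) A(1) by auto
      then have "Suc a \<notin> A\<^sub>2" using cut_next[OF _ that(1) A(5)] i1 by simp
      then show ?thesis using A(1) that(2) \<open>i \<le> a\<close> by (metis Un_iff Suc_leI atLeastAtMost_iff le_SucI)
    qed
    have kj: "k + d \<in> A\<^sub>1" if "k + d \<le> j" for d
      using that by (induction d) (auto simp: k suc)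
    have ikj: "i \<le> k" "k \<le> j" using k(1) A(1) by auto
    have A1: "A\<^sub>1 = {k..j}"
    proof (intro equalityI subsetI)
      fix a assume "a \<in> {k..j}"
      then show "a \<in> A\<^sub>1" using kj[of "a - k"] by simp
    qed (use k(2) A(1) in auto)
    have "A\<^sub>2 = {i..j} - A\<^sub>1" using A(1,2) by blast
    then have A2: "A\<^sub>2 = {i..<k}" using ikj by (auto simp: A1)
    then have ik: "i < k" using A(4) by simp
    then have A2': "A\<^sub>2 = {i..k - 1}" using A2 by auto
    have "cpt P {i..j} = cpt P A\<^sub>1 \<boxplus> cpt P A\<^sub>2"
      using cpt_Un[OF fin gp A(5,2)] A(1) i1 ikj A1 A2 by (metis atLeastAtMost_iff atLeastLessThan_iff not_one_le_zero le_trans)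
    moreover have "cpt P A\<^sub>1 \<in> box_interior w" unfolding A1 using less.hyps[of j k] less.prems ik ikj by auto
    moreover have "cpt P A\<^sub>2 \<in> box_interior w" unfolding A2' using less.hyps[of "k - 1" i] less.prems ik ikj by auto
    ultimately show ?thesis using box_interior_properties(2) unfolding box_closed_def by metis
  qed
qed

text \<open>Runs are split off from the left. Those of at most \<open>l\<close> indices are
  box-summed into an interior element; at the first one with more than \<open>l\<close> (hence
  \<open>i + l \<le> j\<close>) the process stops, and \<open>A\<^sub>2\<close> stays arbitrary,
  ready for the recursion.\<close>

lemma first_long_run:
  assumes N: "1 \<le> N" "recurrent_beyond w N l"
    and "finite A" "A \<subseteq> {N..}"
  shows "cpt P A \<in> box_interior w \<or> (\<exists>i j A\<^sub>1 A\<^sub>2. N \<le> i \<and> i + l \<le> j \<and> A = A\<^sub>1 \<union> ({i..j} \<union> A\<^sub>2) \<and>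
    (\<forall>a\<in>A\<^sub>1. a + 2 \<le> i) \<and> (\<forall>a\<in>A\<^sub>2. j + 2 \<le> a) \<and> cpt P A\<^sub>1 \<in> box_interior w)"
  using assms(3,4)
proof (induction "card A" arbitrary: A rule: less_induct)
  case less
  show ?case
  proof (cases "A = {}")
    case True
    then show ?thesis using empty_in_box_interior by simp
  next
    case False
    obtain i j A' where run: "i \<le> j" "A = {i..j} \<union> A'" "\<And>a. a \<in> A' \<Longrightarrow> j + 2 \<le> a"
      using first_run[OF less.prems(1) False] by metis
    have Ni: "N \<le> i" using less.prems(2) run by auto
    show ?thesis
    proof (cases "i + l \<le> j")
      case True
      then show ?thesis
        using run Ni empty_in_box_interior by (intro disjI2 exI[of _ i] exI[of _ j] exI[of _ "{}"] exI[of _ A']) auto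
    next
      case False
      then have B: "cpt P {i..j} \<in> box_interior w"
        using factor_in_box_interior[OF N Ni run(1)] by simp
      have "i \<in> A" "i \<notin> A'" using run(1,2) run(3)[of i] by auto
      then have fin: "finite A'" and A': "A' \<subseteq> {N..}" "A' \<subset> A"
        using less.prems run(2) by auto
      have sum: "cpt P ({i..j} \<union> X) = cpt P {i..j} \<boxplus> cpt P X" if "X \<subseteq> A'" for X
        using that fin run N(1) Ni finite_subset by (intro cpt_gap_sum) (auto, fastforce+)
      show ?thesis
        using less.hyps[OF psubset_card_mono[OF less.prems(1) A'(2)] fin A'(1)]
      proof (elim disjE exE conjE)
        assume "cpt P A' \<in> box_interior w"
        then show ?thesis
          using sum[of A'] B box_interior_properties(2) run(2) unfolding box_closed_def by auto
      next
        fix i' j' A\<^sub>1 A\<^sub>2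
        assume *: "N \<le> i'" "i' + l \<le> j'" "A' = A\<^sub>1 \<union> ({i'..j'} \<union> A\<^sub>2)"
          "\<forall>a\<in>A\<^sub>1. a + 2 \<le> i'" "\<forall>a\<in>A\<^sub>2. j' + 2 \<le> a" "cpt P A\<^sub>1 \<in> box_interior w"
        have "cpt P ({i..j} \<union> A\<^sub>1) \<in> box_interior w"
          using sum[of A\<^sub>1] *(3,6) B box_interior_properties(2) unfolding box_closed_def by auto
        moreover have "j + 2 \<le> i'" using run(3)[of i'] * by simp
        then have "\<forall>a\<in>{i..j} \<union> A\<^sub>1. a + 2 \<le> i'" using * by auto
        moreover have "A = ({i..j} \<union> A\<^sub>1) \<union> ({i'..j'} \<union> A\<^sub>2)" using * run(2) by blast
        ultimately show ?thesis using * by blast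
      qed
    qed
  qed
qed

section \<open>Bounds on the growth of the pin classes\<close>

definition tail_level :: "nat \<Rightarrow> nat \<Rightarrow> cperm set" where
  "tail_level N n = cpt P ` {A. finite A \<and> A \<subseteq> {N..} \<and> card A = n}"

text \<open>Words are counted instead of their centred permutations because they can be cut into
  blocks of length \<open>l\<close>.\<close>

definition factor_words :: "nat \<Rightarrow> nat \<Rightarrow> pin_letter list set" where
  "factor_words N m = (\<lambda>i. pin_factor w i (i + m - 1)) ` {N..}"

lemma tail_level_subset: "1 \<le> N \<Longrightarrow> tail_level N n \<subseteq> {\<pi> \<in> cperms. clength \<pi> = n}"
  using cpt_in_cperms[OF _ general_position_pin_path] clength_cpt[OF _ general_position_pin_path] by (fastforce simp: tail_level_def)

lemma finite_tail_level: "1 \<le> N \<Longrightarrow> finite (tail_level N n)"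
  using tail_level_subset finite_cperms_clength finite_subset by metis

lemma cpt_in_tail_level: "finite A \<Longrightarrow> A \<subseteq> {N..} \<Longrightarrow> cpt P A \<in> tail_level N (card A)"
  by (auto simp: tail_level_def)

lemma factor_words_pin_word:
  assumes "1 \<le> N" "1 \<le> m" "v \<in> factor_words N m"
  shows "pin_word v" "length v = m"
  using assms pin_word_pin_factor pin_factor_length by (auto simp: factor_words_def)

lemma finite_factor_words: "1 \<le> N \<Longrightarrow> 1 \<le> m \<Longrightarrow> finite (factor_words N m)"
  using finite_lists_length_eq[OF finite_pin_letters, of m]
  by (rule rev_finite_subset) (use factor_words_pin_word in auto)

lemma interior_subset_cperms: "box_interior w \<subseteq> cperms"
  using box_interior_properties(1) by (simp add: centred_class_def)

lemma centred_pin_class_subset_cperms: "centred_pin_class w \<subseteq> cperms"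
  by (auto simp: centred_pin_class_def)

text \<open>A single pin far out gives an interior member of length 1, and supermultiplicativity
  extends this to all lengths. The Fekete argument asks for this lower bound.\<close>

lemma card_level_interior_pos: "1 \<le> card (level (box_interior w) n)"
proof (induction n)
  case 0
  have "cpt P {} \<in> level (box_interior w) 0"
    using empty_in_box_interior clength_cpt[OF finite.emptyI general_position_pin_path] by (simp add: level_def)
  then show ?case
    using finite_level[OF interior_subset_cperms] by (metis One_nat_def Suc_leI card_gt_0_iff empty_iff)
next
  case (Suc n)
  obtain N where N: "2 \<le> N" "recurrent_beyond w N 1"
    using eventually_recurrent[of 1] by blast
  have N1: "1 \<le> N" using N(1) by simp
  have "cpt P {N..N} \<in> box_interior w"
    using factor_in_box_interior[OF N1 N(2) le_refl le_refl] by simp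
  moreover have "clength (cpt P {N..N}) = 1"
    using clength_cpt[OF finite_atLeastAtMost general_position_pin_path, of N N] N1 by simp
  ultimately have "cpt P {N..N} \<in> level (box_interior w) 1" by (simp add: level_def)
  then have "1 \<le> card (level (box_interior w) 1)"
    using finite_level[OF interior_subset_cperms] by (metis One_nat_def Suc_leI card_gt_0_iff empty_iff)
  then have "0 < card (level (box_interior w) n) * card (level (box_interior w) 1)" using Suc by simp
  also have "\<dots> \<le> (n + 1) * card (level (box_interior w) (n + 1))"
    by (rule card_level_mult_le[OF interior_subset_cperms box_interior_properties(2)])
  finally show ?case by auto
qed

lemma centred_pin_class_level: "level (centred_pin_class w) n = tail_level 1 n"
proof -
  have "finite A \<and> 0 \<notin> A \<longleftrightarrow> finite A \<and> A \<subseteq> {1..}" for A :: "nat set"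
    by (auto simp: Suc_le_eq intro: gr0I)
  then show ?thesis
    using clength_cpt[OF _ general_position_pin_path] by (fastforce simp: level_def tail_level_def centred_pin_class_eq)
qed

text \<open>A crude bound to keep the growth rates finite. The first run of length \<open>m\<close>
  is given by one of at most \<open>8 ^ m\<close> words, and the rest by induction; the base 16 is
  twice 8, so that the powers of 1/2 over all \<open>m \<ge> 1\<close> sum to at most 1.\<close>

lemma card_tail_level_1: "card (tail_level 1 n) \<le> 16 ^ n"
proof (induction n rule: less_induct)
  case (less n)
  show ?case
  proof (cases "n = 0")
    case True
    then have "tail_level 1 n \<subseteq> {cpt P {}}" by (auto simp: tail_level_def)
    then have "card (tail_level 1 n) \<le> card {cpt P {}}" by (intro card_mono) auto
    then show ?thesis using True by simp
  next
    case False
    let ?S = "\<lambda>m. (\<lambda>(v, \<tau>). pin_cperm v \<boxplus> \<tau>) ` ({v. set v \<subseteq> UNIV \<and> length v = m} \<times> tail_level 1 (n - m))"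
    have "tail_level 1 n \<subseteq> (\<Union>m\<in>{1..n}. ?S m)"
    proof
      fix \<pi> assume "\<pi> \<in> tail_level 1 n"
      then obtain A where A: "finite A" "A \<subseteq> {1..}" "card A = n" "\<pi> = cpt P A"
        by (auto simp: tail_level_def)
      have "A \<noteq> {}" using A(3) False by auto
      then obtain i j A' where run: "i \<le> j" "A = {i..j} \<union> A'" "\<And>a. a \<in> A' \<Longrightarrow> j + 2 \<le> a"
        using first_run[OF A(1)] by metis
      have i: "1 \<le> i" using A(2) run by auto
      have A': "finite A'" "A' \<subseteq> {1..}" "{i..j} \<inter> A' = {}" using A run by (auto dest: run(3))
      have "\<pi> = cpt P {i..j} \<boxplus> cpt P A'"
        unfolding A(4) run(2) using A' i run by (intro cpt_gap_sum) (auto, fastforce+)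
      then have "\<pi> = pin_cperm (pin_factor w i j) \<boxplus> cpt P A'"
        using pin_cperm_pin_factor[OF i run(1)] by simp
      moreover have c: "n = (Suc j - i) + card A'"
        using A(3) run(2) A' card_Un_disjoint[of "{i..j}" A'] by simp
      moreover have "cpt P A' \<in> tail_level 1 (n - (Suc j - i))"
        using cpt_in_tail_level[OF A'(1,2)] c by simp
      ultimately have "\<pi> \<in> ?S (Suc j - i)"
        using pin_factor_length[OF i run(1)] by force
      moreover have "Suc j - i \<in> {1..n}" using run(1) c by auto
      ultimately show "\<pi> \<in> (\<Union>m\<in>{1..n}. ?S m)" by blast
    qed
    moreover have fin: "finite ({v :: pin_letter list. set v \<subseteq> UNIV \<and> length v = m} \<times> tail_level 1 (n - m))" for m
      using finite_lists_length_eq[OF finite_pin_letters] finite_tail_level by (intro finite_cartesian_product) auto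
    ultimately have "card (tail_level 1 n) \<le> card (\<Union>m\<in>{1..n}. ?S m)"
      by (intro card_mono) auto
    also have "\<dots> \<le> (\<Sum>m\<in>{1..n}. card (?S m))" by (rule card_UN_le) simp
    also have "\<dots> \<le> (\<Sum>m\<in>{1..n}. 8 ^ m * 16 ^ (n - m))"
    proof (rule sum_mono)
      fix m assume m: "m \<in> {1..n}"
      have "card (?S m) \<le> card {v :: pin_letter list. set v \<subseteq> UNIV \<and> length v = m} * card (tail_level 1 (n - m))"
        using card_image_le[OF fin] by (metis card_cartesian_product)
      also have "\<dots> \<le> 8 ^ m * 16 ^ (n - m)"
        using less[of "n - m"] m card_lists_length_eq[OF finite_pin_letters, of m] power_mono[OF card_pin_letters, of m]
        by (intro mult_mono) auto
      finally show "card (?S m) \<le> 8 ^ m * 16 ^ (n - m)" .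
    qed
    \<comment> \<open>With \<open>8 ^ n\<close> added the sum is exactly \<open>16 ^ n\<close>, a
      form that passes through the induction.\<close>
    also have "(\<Sum>m\<in>{1..n}. 8 ^ m * 16 ^ (n - m)) + 8 ^ n = (16 ^ n :: nat)"
    proof (induction n)
      case (Suc n)
      have "(\<Sum>m\<in>{1..n}. 8 ^ m * 16 ^ (Suc n - m)) = 16 * (\<Sum>m\<in>{1..n}. 8 ^ m * 16 ^ (n - m) :: nat)"
        by (simp add: sum_distrib_left Suc_diff_le mult.left_commute)
      then show ?case using Suc by simp
    qed simp
    then have "(\<Sum>m\<in>{1..n}. 8 ^ m * 16 ^ (n - m)) \<le> (16 ^ n :: nat)" by simp
    finally show ?thesis .
  qed
qed

text \<open>By \<open>pin_word_eqI\<close> a word is fixed by its last letter, which gives the 8,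
  and its centred permutation, which is in the interior because the word is short.\<close>

lemma card_factor_words_short:
  assumes N: "1 \<le> N" "recurrent_beyond w N l"
    and m: "1 \<le> m" "m \<le> l"
  shows "card (factor_words N m) \<le> 8 * card (level (box_interior w) m)"
proof -
  let ?f = "\<lambda>v. (last v, pin_cperm v)"
  have "inj_on ?f (factor_words N m)"
    using pin_word_eqI factor_words_pin_word[OF N(1) m(1)] by (intro inj_onI) auto
  moreover have "?f ` factor_words N m \<subseteq> UNIV \<times> level (box_interior w) m"
  proof (rule image_subsetI)
    fix v assume "v \<in> factor_words N m"
    then obtain i where i: "N \<le> i" "v = pin_factor w i (i + m - 1)" by (auto simp: factor_words_def)
    have "pin_cperm v = cpt P {i..i + m - 1}"
      using pin_cperm_pin_factor i N(1) m by simp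
    moreover have "cpt P {i..i + m - 1} \<in> box_interior w"
      using factor_in_box_interior[OF N] i m by simp
    moreover have "clength (cpt P {i..i + m - 1}) = m"
      using clength_cpt[OF _ general_position_pin_path] i N(1) m by simp
    ultimately show "?f v \<in> UNIV \<times> level (box_interior w) m" by (simp add: level_def)
  qed
  ultimately have "card (factor_words N m) \<le> card ((UNIV :: pin_letter set) \<times> level (box_interior w) m)"
    using finite_pin_letters finite_level[OF interior_subset_cperms] by (intro card_inj_on_le) auto
  also have "\<dots> \<le> 8 * card (level (box_interior w) m)"
    using card_pin_letters by (simp add: card_cartesian_product)
  finally show ?thesis .
qed

text \<open>The letter in position \<open>l + 1\<close> is recorded separately: the second factor replaces it by a numeral.\<close>

lemma card_factor_words_add:
  assumes N: "2 \<le> N" and l: "1 \<le> l" and m: "1 \<le> m"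
  shows "card (factor_words N (l + m)) \<le> card (factor_words N l) * 8 * card (factor_words N m)"
proof -
  let ?f = "\<lambda>(u, a, v). u @ a # tl v"
  let ?X = "factor_words N l \<times> (UNIV :: pin_letter set) \<times> factor_words N m"
  have "factor_words N (l + m) \<subseteq> ?f ` ?X"
  proof
    fix v assume "v \<in> factor_words N (l + m)"
    then obtain i where i: "N \<le> i" "v = pin_factor w i (i + (l + m) - 1)" by (auto simp: factor_words_def)
    have "[i..<i + (l + m) - 1] = [i..<i + l - 1] @ [i + l - 1..<i + (l + m) - 1]"
      using l m upt_add_eq_append[of i "i + l - 1" m] by (simp add: add.assoc)
    also have "[i + l - 1..<i + (l + m) - 1] = (i + l - 1) # [i + l..<i + (l + m) - 1]"
      using l m upt_conv_Cons[of "i + l - 1" "i + (l + m) - 1"] by simp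
    finally have "v = pin_factor w i (i + l - 1) @ w (i + l - 1) # tl (pin_factor w (i + l) (i + l + m - 1))"
      using i N by (simp add: pin_factor_def add.assoc)
    moreover have "pin_factor w i (i + l - 1) \<in> factor_words N l" "pin_factor w (i + l) (i + l + m - 1) \<in> factor_words N m"
      using i by (auto simp: factor_words_def)
    ultimately show "v \<in> ?f ` ?X" by force
  qed
  moreover have "finite ?X" using finite_factor_words finite_pin_letters N l m by simp
  ultimately have "card (factor_words N (l + m)) \<le> card ?X"
    by (meson card_image_le card_mono finite_imageI le_trans)
  also have "\<dots> \<le> card (factor_words N l) * 8 * card (factor_words N m)"
    using card_pin_letters by (simp add: card_cartesian_product)
  finally show ?thesis .
qed

text \<open>The three pieces of \<open>first_long_run\<close> are recorded as an interior element,
  the word of the long run, and a tail. The tail again uses only indices from \<open>N\<close> on,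
  which makes the inequality recursive.\<close>

lemma card_tail_level_le:
  assumes N: "1 \<le> N" "recurrent_beyond w N l"
  shows "card (tail_level N n) \<le> card (level (box_interior w) n) +
    (\<Sum>i\<le>n. \<Sum>m\<in>{l<..n - i}. card (level (box_interior w) i) * card (factor_words N m) * card (tail_level N (n - i - m)))"
proof -
  let ?X = "\<lambda>i m. level (box_interior w) i \<times> factor_words N m \<times> tail_level N (n - i - m)"
  let ?f = "\<lambda>(\<beta>, v, \<tau>). \<beta> \<boxplus> (pin_cperm v \<boxplus> \<tau>)"
  let ?S = "\<Union>i\<in>{..n}. \<Union>m\<in>{l<..n - i}. ?f ` ?X i m"
  have "tail_level N n \<subseteq> level (box_interior w) n \<union> ?S"
  proof
    fix \<pi> assume "\<pi> \<in> tail_level N n"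
    then obtain A where A: "finite A" "A \<subseteq> {N..}" "card A = n" "\<pi> = cpt P A"
      by (auto simp: tail_level_def)
    have A0: "0 \<notin> A" using A(2) N(1) by auto
    from first_long_run[OF N A(1,2)] show "\<pi> \<in> level (box_interior w) n \<union> ?S"
    proof (elim disjE exE conjE)
      assume "cpt P A \<in> box_interior w"
      then show ?thesis using clength_cpt[OF A(1) general_position_pin_path A0] A(3,4) by (simp add: level_def)
    next
      fix i j A\<^sub>1 A\<^sub>2
      assume *: "N \<le> i" "i + l \<le> j" "A = A\<^sub>1 \<union> ({i..j} \<union> A\<^sub>2)" "\<forall>a\<in>A\<^sub>1. a + 2 \<le> i" "\<forall>a\<in>A\<^sub>2. j + 2 \<le> a"
        "cpt P A\<^sub>1 \<in> box_interior w"
      have fin: "finite A\<^sub>1" "finite A\<^sub>2" and sub: "A\<^sub>2 \<subseteq> {N..}" and zero: "0 \<notin> A\<^sub>1" "0 \<notin> A\<^sub>2"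
        using A(1,2) A0 *(3) by auto
      have i1: "1 \<le> i" "i \<le> j" using *(1,2) N(1) by auto
      have dis: "A\<^sub>1 \<inter> ({i..j} \<union> A\<^sub>2) = {}" "{i..j} \<inter> A\<^sub>2 = {}" using *(2,4,5) by fastforce+
      define m where "m = Suc j - i"
      have n: "n = card A\<^sub>1 + (m + card A\<^sub>2)"
        using A(3) *(3) dis fin by (simp add: card_Un_disjoint m_def)
      have "cpt P ({i..j} \<union> A\<^sub>2) = cpt P {i..j} \<boxplus> cpt P A\<^sub>2"
        using fin i1 zero *(5) by (intro cpt_gap_sum) auto
      moreover have "cpt P A = cpt P A\<^sub>1 \<boxplus> cpt P ({i..j} \<union> A\<^sub>2)"
        unfolding *(3) using fin i1 zero *(2,4,5) by (intro cpt_gap_sum) (auto, fastforce+)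
      ultimately have "\<pi> = ?f (cpt P A\<^sub>1, pin_factor w i j, cpt P A\<^sub>2)"
        using A(4) pin_cperm_pin_factor[OF i1] by simp
      moreover have "(cpt P A\<^sub>1, pin_factor w i j, cpt P A\<^sub>2) \<in> ?X (card A\<^sub>1) m"
      proof (intro SigmaI)
        show "cpt P A\<^sub>1 \<in> level (box_interior w) (card A\<^sub>1)"
          using *(6) clength_cpt[OF fin(1) general_position_pin_path zero(1)] by (simp add: level_def)
        show "pin_factor w i j \<in> factor_words N m"
          using *(1) i1 by (auto simp: factor_words_def m_def intro!: image_eqI[of _ _ i])
        show "cpt P A\<^sub>2 \<in> tail_level N (n - card A\<^sub>1 - m)"
          using cpt_in_tail_level[OF fin(2) sub] n by simp
      qed
      ultimately have "\<pi> \<in> ?f ` ?X (card A\<^sub>1) m" by (rule image_eqI)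
      moreover have "card A\<^sub>1 \<in> {..n}" "m \<in> {l<..n - card A\<^sub>1}" using n *(2) by (auto simp: m_def)
      ultimately show ?thesis by blast
    qed
  qed
  moreover have fin: "finite (?X i m)" if "m \<in> {l<..n - i}" for i m
    using that finite_level[OF interior_subset_cperms] finite_factor_words[OF N(1)] finite_tail_level[OF N(1)]
    by (intro finite_cartesian_product) auto
  then have finS: "finite ?S" by (intro finite_UN_I finite_imageI) auto
  ultimately have "card (tail_level N n) \<le> card (level (box_interior w) n \<union> ?S)"
    using finite_level[OF interior_subset_cperms] by (intro card_mono) auto
  also have "\<dots> \<le> card (level (box_interior w) n) + card ?S" by (rule card_Un_le)
  also have "card ?S \<le> (\<Sum>i\<le>n. card (\<Union>m\<in>{l<..n - i}. ?f ` ?X i m))" by (rule card_UN_le) simp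
  also have "\<dots> \<le> (\<Sum>i\<le>n. \<Sum>m\<in>{l<..n - i}. card (?f ` ?X i m))" by (intro sum_mono card_UN_le) simp
  also have "\<dots> \<le> (\<Sum>i\<le>n. \<Sum>m\<in>{l<..n - i}. card (?X i m))" by (intro sum_mono card_image_le fin)
  finally show ?thesis by (simp add: card_cartesian_product mult.assoc)
qed

text \<open>The indices below \<open>N\<close> form one of at most \<open>2 ^ N\<close> sets. A run
  starting at \<open>N\<close> may continue them without a gap, so it is kept with them; its length
  is determined by \<open>n\<close>, \<open>k\<close> and the size of that set and costs nothing
  extra.\<close>

lemma card_level_centred_pin_class_le:
  assumes N: "2 \<le> N"
  shows "card (level (centred_pin_class w) n) \<le> (\<Sum>k\<le>n. 2 ^ N * card (tail_level N k))"
proof -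
  let ?f = "\<lambda>k A. (\<lambda>\<tau>. cpt P (A \<union> {N..<N + (n - k - card A)}) \<boxplus> \<tau>) ` tail_level N k"
  have fin: "finite (tail_level N k)" for k using finite_tail_level N by simp
  have "level (centred_pin_class w) n \<subseteq> (\<Union>k\<in>{..n}. \<Union>A\<in>Pow {1..<N}. ?f k A)"
  proof
    fix \<pi> assume "\<pi> \<in> level (centred_pin_class w) n"
    then obtain A where A: "finite A" "A \<subseteq> {1..}" "card A = n" "\<pi> = cpt P A"
      unfolding centred_pin_class_level by (auto simp: tail_level_def)
    define A\<^sub>0 where "A\<^sub>0 = A \<inter> {..<N}"
    have A0: "finite A\<^sub>0" "A\<^sub>0 \<subseteq> {1..<N}" using A by (auto simp: A\<^sub>0_def)
    \<comment> \<open>\<open>t\<close> is the length of the run starting at \<open>N\<close>, and 0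
      if \<open>N\<close> is not in \<open>A\<close>; in both cases index \<open>N + t\<close> is
      missing and provides the gap.\<close>
    obtain t A\<^sub>2 where t: "A \<inter> {N..} = {N..<N + t} \<union> A\<^sub>2" "\<And>a. a \<in> A\<^sub>2 \<Longrightarrow> N + t + 1 \<le> a"
    proof (cases "N \<in> A")
      case True
      then have ne: "A \<inter> {N..} \<noteq> {}" by auto
      then obtain i j A' where run: "i \<le> j" "A \<inter> {N..} = {i..j} \<union> A'" "\<And>a. a \<in> A' \<Longrightarrow> j + 2 \<le> a" "i = Min (A \<inter> {N..})"
        using first_run[of "A \<inter> {N..}"] A(1) by (metis finite_Int)
      have "Min (A \<inter> {N..}) = N" using True A(1) by (intro Min_eqI) auto
      then have "i = N" using run(4) by simp
      then have *: "{i..j} = {N..<N + (Suc j - N)}" "N + (Suc j - N) + 1 = j + 2" using run(1) by auto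
      show thesis
      proof (rule that)
        show "A \<inter> {N..} = {N..<N + (Suc j - N)} \<union> A'" unfolding run(2) *(1) ..
        show "N + (Suc j - N) + 1 \<le> a" if "a \<in> A'" for a unfolding *(2) using run(3)[OF that] .
      qed
    next
      case False
      show thesis
      proof (rule that)
        show "A \<inter> {N..} = {N..<N + 0} \<union> (A \<inter> {N..})" by simp
        show "N + 0 + 1 \<le> a" if "a \<in> A \<inter> {N..}" for a using that False by (cases "a = N") auto
      qed
    qed
    have Aeq: "A = (A\<^sub>0 \<union> {N..<N + t}) \<union> A\<^sub>2" 
    proof -
      have "A = A\<^sub>0 \<union> A \<inter> {N..}" by (auto simp: A\<^sub>0_def)
      then show ?thesis unfolding t(1) Un_assoc .
    qed
    have "A\<^sub>2 \<subseteq> A \<inter> {N..}" unfolding t(1) by blast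
    then have A2: "finite A\<^sub>2" "A\<^sub>2 \<subseteq> {N..}" using A(1) by (auto intro: finite_subset)
    have gap: "i + 2 \<le> j" if "i \<in> A\<^sub>0 \<union> {N..<N + t}" "j \<in> A\<^sub>2" for i j
      using that t(2)[of j] A0(2) by fastforce
    have dis: "A\<^sub>0 \<inter> {N..<N + t} = {}" "(A\<^sub>0 \<union> {N..<N + t}) \<inter> A\<^sub>2 = {}"
      using A0 gap by (auto, fastforce+)
    then have n: "n = card A\<^sub>0 + t + card A\<^sub>2"
      using A(3) A0(1) A2(1) unfolding Aeq by (simp add: card_Un_disjoint)
    have "\<pi> = cpt P (A\<^sub>0 \<union> {N..<N + t}) \<boxplus> cpt P A\<^sub>2"
      unfolding A(4) Aeq using A0 A2 gap N by (intro cpt_gap_sum) auto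
    moreover have "t = n - card A\<^sub>2 - card A\<^sub>0" using n by simp
    ultimately have "\<pi> \<in> ?f (card A\<^sub>2) A\<^sub>0" using cpt_in_tail_level[OF A2] by blast
    moreover have "card A\<^sub>2 \<in> {..n}" using n by simp
    ultimately show "\<pi> \<in> (\<Union>k\<in>{..n}. \<Union>A\<in>Pow {1..<N}. ?f k A)" using A0(2) by blast
  qed
  moreover have "finite (\<Union>k\<in>{..n}. \<Union>A\<in>Pow {1..<N}. ?f k A)" using fin by auto
  ultimately have "card (level (centred_pin_class w) n) \<le> card (\<Union>k\<in>{..n}. \<Union>A\<in>Pow {1..<N}. ?f k A)"
    by (rule card_mono[rotated])
  also have "\<dots> \<le> (\<Sum>k\<le>n. card (\<Union>A\<in>Pow {1..<N}. ?f k A))" by (rule card_UN_le) simp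
  also have "\<dots> \<le> (\<Sum>k\<le>n. \<Sum>A\<in>Pow {1..<N}. card (?f k A))" by (intro sum_mono card_UN_le) simp
  also have "\<dots> \<le> (\<Sum>k\<le>n. \<Sum>A\<in>Pow {1..<N}. card (tail_level N k))" by (intro sum_mono card_image_le fin)
  also have "\<dots> \<le> (\<Sum>k\<le>n. 2 ^ N * card (tail_level N k))"
    by (intro sum_mono) (simp add: card_Pow)
  finally show ?thesis .
qed

text \<open>The order of choices matters: \<open>K\<close> comes from \<open>y\<close>, then
  \<open>l\<close> from \<open>K\<close> and the three rates, then \<open>N\<close> from
  \<open>l\<close>. The constant \<open>M\<close> may depend on all of them, since \<open>x\<close>
  is fixed.\<close>

lemma growth_bound:
  assumes lim: "(\<lambda>n. root n (real (card (level (box_interior w) n)))) \<longlonglongrightarrow> g" and g: "1 \<le> g" and x: "g < x"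
  shows "\<exists>M>0. \<forall>n. real (card (level (centred_pin_class w) n)) \<le> M * real (Suc n) * x ^ n"
proof -
  define b where "b = (\<lambda>n. real (card (level (box_interior w) n)))"
  define y where "y = (2 * g + x) / 3"
  define z where "z = (g + 2 * x) / 3"
  have yz: "g < y" "y < z" "z < x" "0 < y" "0 < z" "0 < x" "1 \<le> y" "1 \<le> x"
    using g x by (simp_all add: y_def z_def)
  obtain K where K: "1 \<le> K" "\<And>n. b n \<le> K * y ^ n"
    using root_tendsto_imp_bound[OF lim[folded b_def] yz(1,7)] by (auto simp: b_def)
  \<comment> \<open>The first condition on \<open>l\<close> is the one of
    \<open>concatenation_bound\<close>, the second the one of \<open>renewal_bound\<close> with the
    constant \<open>K' = 8 * K\<close> that the former produces.\<close>
  have "(\<lambda>l. 64 * K * (y / z) ^ l) \<longlonglongrightarrow> 64 * K * 0"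
    using yz by (intro tendsto_intros LIMSEQ_realpow_zero) auto
  then have "\<forall>\<^sub>F l in sequentially. 64 * K * (y / z) ^ l < 1"
    by (rule order_tendstoD(2)) simp
  moreover have "(\<lambda>l. K * (8 * K) * (z / x) ^ l / (1 - z / x) ^ 2) \<longlonglongrightarrow> K * (8 * K) * 0 / (1 - z / x) ^ 2"
    using yz by (intro tendsto_intros LIMSEQ_realpow_zero) auto
  then have "\<forall>\<^sub>F l in sequentially. K * (8 * K) * (z / x) ^ l / (1 - z / x) ^ 2 < 1 / 2"
    by (rule order_tendstoD(2)) simp
  ultimately have "\<forall>\<^sub>F l in sequentially. 64 * K * (y / z) ^ l < 1 \<and>
      K * (8 * K) * (z / x) ^ l / (1 - z / x) ^ 2 < 1 / 2 \<and> 1 \<le> l"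
    using eventually_ge_at_top[of 1] by eventually_elim simp
  then obtain l where l: "64 * K * (y / z) ^ l < 1" "K * (8 * K) * (z / x) ^ l / (1 - z / x) ^ 2 < 1 / 2" "1 \<le> l"
    by (auto simp: eventually_sequentially)
  then have l': "64 * K * y ^ l \<le> z ^ l" using yz by (simp add: power_divide field_simps)
  obtain N where N: "2 \<le> N" "recurrent_beyond w N l"
    using eventually_recurrent[of l] by blast
  have N1: "1 \<le> N" using N(1) by simp
  define W where "W = (\<lambda>m. real (card (factor_words N m)))"
  define e where "e = (\<lambda>n. real (card (tail_level N n)))"
  have short: "W m \<le> 8 * b m" if "1 \<le> m" "m \<le> l" for m
    using of_nat_mono[OF card_factor_words_short[OF N1 N(2) that], where 'a = real] by (simp add: W_def b_def)
  have long: "W (l + m) \<le> 64 * b l * W m" if "1 \<le> m" for m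
  proof -
    have "W (l + m) \<le> W l * 8 * W m"
      using of_nat_mono[OF card_factor_words_add[OF N(1) l(3) that], where 'a = real] by (simp add: W_def)
    also have "\<dots> \<le> (8 * b l) * 8 * W m"
      using short[of l] l(3) by (intro mult_right_mono) (auto simp: W_def)
    finally show ?thesis by simp
  qed
  have Wz: "W m \<le> 8 * K * z ^ m" if "1 \<le> m" for m
    using concatenation_bound[OF K(2) short long _ _ l(3) l' _ _ that] yz K(1) by (simp add: W_def)
  have bz: "b n \<le> K * z ^ n" for n
    using K(2)[of n] power_mono[of y z n] yz K(1) by (meson less_imp_le mult_left_mono order_trans zero_le_one)
  have "e n \<le> b n + (\<Sum>i\<le>n. \<Sum>m\<in>{l<..n - i}. b i * W m * e (n - i - m))" for n
    using of_nat_mono[OF card_tail_level_le[OF N1 N(2)], where 'a = real] by (simp add: e_def b_def W_def)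
  then have e: "e n \<le> 2 * K * x ^ n" for n
    using l(2) yz K(1) by (intro renewal_bound[OF bz Wz]) (auto simp: b_def W_def e_def)
  have "real (card (level (centred_pin_class w) n)) \<le> 2 ^ N * (2 * K) * real (Suc n) * x ^ n" for n
  proof -
    have "real (card (level (centred_pin_class w) n)) \<le> (\<Sum>k\<le>n. 2 ^ N * e k)"
      using of_nat_mono[OF card_level_centred_pin_class_le[OF N(1), of n], where 'a = real] by (simp add: e_def)
    \<comment> \<open>As \<open>1 \<le> x\<close>, every term is bounded by the last one, whence the
      factor \<open>n + 1\<close>.\<close>
    also have "\<dots> \<le> (\<Sum>k\<le>n. 2 ^ N * (2 * K * x ^ n))"
    proof (intro sum_mono mult_left_mono)
      fix k assume "k \<in> {..n}"
      then have "2 * K * x ^ k \<le> 2 * K * x ^ n" using yz K(1) by (intro mult_left_mono power_increasing) auto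
      then show "e k \<le> 2 * K * x ^ n" using e[of k] by linarith
    qed simp
    finally show ?thesis by (simp add: algebra_simps)
  qed
  then show ?thesis using K(1) by (intro exI[of _ "2 ^ N * (2 * K)"]) auto
qed

lemma pin_class_growth_rates:
  "\<exists>g. has_growth_rate clength (centred_pin_class w) g \<and> has_growth_rate length (pin_class w) g \<and>
    has_growth_rate clength (box_interior w) g"
proof -
  define b where "b = (\<lambda>n. real (card (level (box_interior w) n)))"
  define c where "c = (\<lambda>n. real (card (level (centred_pin_class w) n)))"
  define u where "u = (\<lambda>n. real (card {xs \<in> pin_class w. length xs = n}))"
  have bc: "b n \<le> c n" for n
    using box_interior_subset_centred_pin_class finite_level[OF centred_pin_class_subset_cperms]
    unfolding b_def c_def by (intro of_nat_mono card_mono) (auto simp: level_def)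
  have uc: "u n \<le> c n" and cu: "c n \<le> real (Suc n) ^ 2 * u n" for n
    using of_nat_mono[OF card_level_underlying(1)[OF centred_pin_class_subset_cperms, of n], where 'a = real]
      of_nat_mono[OF card_level_underlying(2)[OF centred_pin_class_subset_cperms, of n], where 'a = real]
    by (simp_all add: u_def c_def pin_class_def add.commute)
  have c16: "c n \<le> 16 ^ n" for n
    using of_nat_mono[OF card_tail_level_1[of n], where 'a = real] by (simp add: c_def centred_pin_class_level)
  have b1: "1 \<le> b n" for n
    using of_nat_mono[OF card_level_interior_pos[of n], where 'a = real] by (simp add: b_def)
  have mult: "b n * b m \<le> (real n + 1) * b (n + m)" for n m
    using of_nat_mono[OF card_level_mult_le[OF interior_subset_cperms box_interior_properties(2), of n m], where 'a = real]
    by (simp add: b_def algebra_simps)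
  \<comment> \<open>The bound \<open>16 ^ n\<close> on the centred class also bounds the interior,
    so the supremum in the Fekete argument is finite.\<close>
  obtain g where g: "1 \<le> g" "(\<lambda>n. root n (b n)) \<longlonglongrightarrow> g"
    using Fekete_root_tendsto[OF b1 order_trans[OF bc c16] _ mult] by auto
  have bound: "\<exists>M>0. \<forall>n. c n \<le> M * real (Suc n) * x ^ n" if "g < x" for x
    unfolding c_def by (rule growth_bound[OF g(2)[unfolded b_def] g(1) that])
  have low: "b n \<le> real (Suc n) ^ 2 * c n" for n
    using bc[of n] mult_right_mono[of 1 "real (Suc n) ^ 2" "c n"] by (simp add: c_def)
  have "(\<lambda>n. root n (c n)) \<longlonglongrightarrow> g"
    by (rule root_tendsto_sandwich[OF g(2,1) low bound])
  moreover have "(\<lambda>n. root n (u n)) \<longlonglongrightarrow> g"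
  proof (rule root_tendsto_sandwich[OF g(2,1) order_trans[OF bc cu]])
    fix x assume "g < x"
    then show "\<exists>M>0. \<forall>n. u n \<le> M * real (Suc n) * x ^ n" using bound[of x] uc order_trans by blast
  qed
  ultimately show ?thesis
    using g(2) unfolding b_def c_def u_def level_def
    by (intro exI[of _ g] conjI root_tendsto_imp_has_growth_rate)
qed

end

theorem theorem4p12:
  fixes w :: "nat \<Rightarrow> pin_letter"
  assumes "infinite_pin_word w"
  shows "\<exists>g :: real.
    has_growth_rate clength (centred_pin_class w) g \<and>
    has_growth_rate length (pin_class w) g \<and>
    has_growth_rate clength (box_interior w) g"
  using pin_class_growth_rates[OF assms] .

end
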